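(* Let $\mathcal{H}$ be a separable, infinite-dimensional, complex Hilbert space and let $C$ be a conjugation on $\mathcal{H}$. Then (i) $(\mathcal{O}_C,\|\cdot\|)$ is isometrically isomorphic to the dual space of $(\mathcal{O}_{C,1}, \|\cdot\|_1)$; (ii) $(\mathcal{O}_{C,1}, \|\cdot\|_1)$ is isometrically isomorphic to the dual space of $(\mathcal{O}_{C,\infty}, \|\cdot\|_\infty)$; (iii) $(\mathcal{O}_{C,p}, \|\cdot\|_p)$ is isometrically isomorphic to the dual space of $(\mathcal{O}_{C,q}, \|\cdot\|_q)$ for $1< p, q<\infty$ with $\frac{1}{p}+\frac{1}{q}=1$.
   Context: $\mathcal{B}(\mathcal{H})$ is the algebra of all bounded linear operators on $\mathcal{H}$ with operator norm $\|\cdot\|$. A conjugation on $\mathcal{H}$ is a conjugate-linear map $C:\mathcal{H}\to\mathcal{H}$ with $C^{-1}=C$ and $\langle Cx,Cy\rangle=\langle y,x\rangle$ for all $x,y\in\mathcal{H}$. $\mathcal{O}_C=\{X\in\mathcal{B}(\mathcal{H}): CXC=-X^*\}$. For $1\le p<\infty$, $\mathcal{B}_p(\mathcal{H})$ is the Schatten $p$-class with the Schatten norm $\|\cdot\|_p$; $\mathcal{B}_\infty(\mathcal{H})$ is the set of all compact operators on $\mathcal{H}$ and $\|\cdot\|_\infty$ is the operator norm. For $p\in[1,\infty]$, $\mathcal{O}_{C,p}=\mathcal{O}_C\cap\mathcal{B}_p(\mathcal{H})$. *)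

theory Defs
  imports "HOL-Analysis.Analysis"
begin

class complex_vector = real_vector +
  fixes scaleC :: "complex \<Rightarrow> 'a \<Rightarrow> 'a"  (infixr \<open>*\<^sub>C\<close> 75)
  assumes scaleC_add_right: "a *\<^sub>C (x + y) = a *\<^sub>C x + a *\<^sub>C y"
    and scaleC_add_left: "(a + b) *\<^sub>C x = a *\<^sub>C x + b *\<^sub>C x"
    and scaleC_scaleC: "a *\<^sub>C b *\<^sub>C x = (a * b) *\<^sub>C x"
    and scaleC_of_real: "complex_of_real r *\<^sub>C x = r *\<^sub>R x"

lemma scaleC_one: "1 *\<^sub>C x = (x :: 'a::complex_vector)"
  using scaleC_of_real[of 1 x] by simp

global_interpretation cvec: vector_space "scaleC :: complex \<Rightarrow> 'a \<Rightarrow> 'a::complex_vector"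
  by unfold_locales (simp_all add: scaleC_add_right scaleC_add_left scaleC_scaleC scaleC_one)

class complex_normed_vector = complex_vector + real_normed_vector +
  assumes norm_scaleC: "norm (a *\<^sub>C x) = cmod a * norm x"

text \<open>Complex Hilbert spaces; the inner product is linear in its first argument. The last axiom
  says both that the form is positive definite and that it induces the norm.\<close>

class chilbert_space = complex_normed_vector + banach +
  fixes cinner :: "'a \<Rightarrow> 'a \<Rightarrow> complex"
  assumes cinner_commute: "cinner x y = cnj (cinner y x)"
    and cinner_add_left: "cinner (x + y) z = cinner x z + cinner y z"
    and cinner_scaleC_left: "cinner (a *\<^sub>C x) y = a * cinner x y"
    and cinner_self: "cinner x x = complex_of_real ((norm x)\<^sup>2)"

instantiation blinfun :: (real_normed_vector, complex_normed_vector) complex_vector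
begin

lift_definition scaleC_blinfun :: "complex \<Rightarrow> 'a \<Rightarrow>\<^sub>L 'b \<Rightarrow> 'a \<Rightarrow>\<^sub>L 'b"
  is "\<lambda>c f x. c *\<^sub>C f x"
proof -
  fix c :: complex and f :: "'a \<Rightarrow> 'b"
  assume f: "bounded_linear f"
  have "bounded_linear (\<lambda>y::'b. c *\<^sub>C y)"
  proof (rule bounded_linear_intro[where K = "cmod c"])
    show "c *\<^sub>C (r *\<^sub>R y) = r *\<^sub>R (c *\<^sub>C y)" for r and y :: 'b
      by (simp add: scaleC_of_real[symmetric] scaleC_scaleC mult.commute)
  qed (simp_all add: scaleC_add_right norm_scaleC mult.commute)
  then show "bounded_linear (\<lambda>x. c *\<^sub>C f x)"
    using f by (rule bounded_linear_compose)
qed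

instance
  by standard
    (transfer; simp add: scaleC_add_right scaleC_add_left scaleC_scaleC scaleC_of_real)+

end

definition infinite_dimensional :: "'a::complex_vector itself \<Rightarrow> bool" where
  "infinite_dimensional _ \<longleftrightarrow> \<not> (\<exists>B :: 'a set. finite B \<and> cvec.span B = UNIV)"

text \<open>Elements of \<^typ>\<open>'a \<Rightarrow>\<^sub>L 'a\<close> are only real-linear, so complex-linearity
  is imposed here; \<^const>\<open>norm\<close> is the operator norm.\<close>

definition bounded_ops :: "('a::complex_normed_vector \<Rightarrow>\<^sub>L 'a) set" where
  "bounded_ops = {X :: 'a \<Rightarrow>\<^sub>L 'a. \<forall>c x. X (c *\<^sub>C x) = c *\<^sub>C X x}"

definition compact_ops :: "('a::complex_normed_vector \<Rightarrow>\<^sub>L 'a) set" where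
  "compact_ops = {X \<in> bounded_ops. compact (closure (blinfun_apply X ` cball 0 1))}"

definition cadjoint :: "('a::chilbert_space \<Rightarrow>\<^sub>L 'a) \<Rightarrow> ('a \<Rightarrow>\<^sub>L 'a)" where
  "cadjoint X = (THE Y :: 'a \<Rightarrow>\<^sub>L 'a. \<forall>x y. cinner (X x) y = cinner x (Y y))"

definition conjugation :: "('a::chilbert_space \<Rightarrow> 'a) \<Rightarrow> bool" where
  "conjugation C \<longleftrightarrow>
     (\<forall>x y. C (x + y) = C x + C y) \<and> (\<forall>c x. C (c *\<^sub>C x) = cnj c *\<^sub>C C x) \<and>
     (\<forall>x. C (C x) = x) \<and> (\<forall>x y. cinner (C x) (C y) = cinner y x)"

definition skew_ops :: "('a::chilbert_space \<Rightarrow> 'a) \<Rightarrow> ('a \<Rightarrow>\<^sub>L 'a) set" where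
  "skew_ops C = {X \<in> bounded_ops. \<forall>x. C (X (C x)) = - (cadjoint X x)}"

text \<open>The singular values of a compact operator \<open>X\<close> are the square roots \<open>s\<close> of the
  eigenvalues of \<open>X\<^sup>*X\<close>, repeated according to multiplicity. For \<open>s > 0\<close> the eigenspace is
  finite-dimensional, and its dimension is 0 when \<open>s\<close> is not a singular value, so that the
  sum of \<open>s powr p\<close> over the sequence of singular values is a sum over all \<open>s > 0\<close>
  weighted with the multiplicity.\<close>

definition sing_mult :: "('a::chilbert_space \<Rightarrow>\<^sub>L 'a) \<Rightarrow> real \<Rightarrow> nat" where
  "sing_mult X s = cvec.dim {x. cadjoint X (X x) = complex_of_real (s\<^sup>2) *\<^sub>C x}"

definition schatten_class :: "real \<Rightarrow> ('a::chilbert_space \<Rightarrow>\<^sub>L 'a) set" where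
  "schatten_class p =
     {X \<in> compact_ops. (\<lambda>s. real (sing_mult X s) * s powr p) summable_on {0<..}}"

definition schatten_norm :: "real \<Rightarrow> ('a::chilbert_space \<Rightarrow>\<^sub>L 'a) \<Rightarrow> real" where
  "schatten_norm p X = (\<Sum>\<^sub>\<infinity>s\<in>{0<..}. real (sing_mult X s) * s powr p) powr (1 / p)"

text \<open>A normed space is given by a complex subspace \<open>T\<close> of a vector space and a norm \<open>M\<close> on
  \<open>T\<close>. Functionals on \<open>T\<close> are represented by functions that are \<^const>\<open>undefined\<close> off \<open>T\<close>.\<close>

definition dual_space :: "'b::complex_vector set \<Rightarrow> ('b \<Rightarrow> real) \<Rightarrow> ('b \<Rightarrow> complex) set" where
  "dual_space T M = {f \<in> extensional T.
     (\<forall>x\<in>T. \<forall>y\<in>T. f (x + y) = f x + f y) \<and> (\<forall>c. \<forall>x\<in>T. f (c *\<^sub>C x) = c * f x) \<and>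
     (\<exists>K. \<forall>x\<in>T. cmod (f x) \<le> K * M x)}"

definition dual_norm :: "'b set \<Rightarrow> ('b \<Rightarrow> real) \<Rightarrow> ('b \<Rightarrow> complex) \<Rightarrow> real" where
  "dual_norm T M f = (SUP x\<in>{x \<in> T. M x \<le> 1}. cmod (f x))"

definition isometric_to_dual ::
  "'a::complex_vector set \<Rightarrow> ('a \<Rightarrow> real) \<Rightarrow> 'b::complex_vector set \<Rightarrow> ('b \<Rightarrow> real) \<Rightarrow> bool" where
  "isometric_to_dual S N T M \<longleftrightarrow> (\<exists>\<Phi>. bij_betw \<Phi> S (dual_space T M) \<and>
     (\<forall>x\<in>S. \<forall>y\<in>S. \<forall>t\<in>T. \<Phi> (x + y) t = \<Phi> x t + \<Phi> y t) \<and>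
     (\<forall>c. \<forall>x\<in>S. \<forall>t\<in>T. \<Phi> (c *\<^sub>C x) t = c * \<Phi> x t) \<and>
     (\<forall>x\<in>S. dual_norm T M (\<Phi> x) = N x))"

end

theory Submission
  imports Defs
begin

text \<open>An operator \<open>X\<close> belongs to the Schatten \<open>p\<close>-class with norm at most \<open>K\<close> iff
  \<open>\<Sum>\<^sub>i \<bar>\<langle>X e\<^sub>i, f\<^sub>i\<rangle>\<bar>\<^sup>p \<le> K\<^sup>p\<close> for all finite orthonormal families \<open>e\<close>, \<open>f\<close>. From this
  description the triangle inequality and the invariance under the involution
  \<open>X \<mapsto> C X\<^sup>* C\<close> are immediate, and a functional on the dual class that is bounded by \<open>K\<close> has,
  when tested on \<open>\<Sum>\<^sub>i c\<^sub>i \<langle>\<cdot>, f\<^sub>i\<rangle> e\<^sub>i\<close>, a representing operator of Schatten norm at most \<open>K\<close>.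
  The same test shows that the trace pairing is isometric. Functionals are determined by their values on
  operators of rank one because finite rank operators are dense.

  The skew operators are the \<open>-1\<close> eigenspace of the involution, which preserves the trace pairing and the
  norms. Hence \<open>T \<mapsto> (T - C T\<^sup>* C) / 2\<close> is a contraction onto the skew part; a functional on skew
  operators extends along it without increase of norm, and the operator that represents the extension is
  skew.\<close>

text \<open>The Schatten norms are defined through multiplicities of eigenvalues of
  \<open>X\<^sup>*X\<close>, which do not behave well under sums of operators. The bridge is a
  singular system: an orthonormal set \<open>E\<close> of eigenvectors of \<open>X\<^sup>*X\<close>
  such that \<open>X\<close> vanishes on its orthogonal complement. The norm is then the
  \<open>l^p\<close> norm of the numbers \<open>norm (X e)\<close>, and every matrix entry of
  \<open>X\<close> is a sum over \<open>E\<close>.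

  The trace enters through its values on rank-one operators: a functional is tied to
  \<open>X\<close> by linearity, a bound and the value \<open>cinner (X v) u\<close> on
  \<open>rk u v\<close>. A fixed orthonormal basis supplies one such functional.

  The three dualities differ only in two facts about the full classes: each \<open>X\<close> has a
  functional bounded by its norm, and an operator whose functional is bounded by \<open>K\<close>
  has norm at most \<open>K\<close>. The second fact yields both surjectivity and the lower bound
  for the dual norm, so the argument for skew operators is carried out once, with these facts as
  hypotheses.\<close>

lemma cinner_add_right: "cinner x (y + z) = cinner x y + cinner (x::'a::chilbert_space) z"
  by (metis cinner_add_left cinner_commute complex_cnj_add)

lemma cinner_scaleC_right: "cinner x (a *\<^sub>C y) = cnj a * cinner (x::'a::chilbert_space) y"
  by (metis cinner_commute cinner_scaleC_left complex_cnj_mult)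

lemma cinner_zero_left [simp]: "cinner 0 (x::'a::chilbert_space) = 0"
  using cinner_add_left[of 0 0 x] by simp

lemma cinner_zero_right [simp]: "cinner (x::'a::chilbert_space) 0 = 0"
  using cinner_add_right[of x 0 0] by simp

lemma cinner_minus_left: "cinner (- x) (y::'a::chilbert_space) = - cinner x y"
  using cinner_add_left[of x "- x" y] by (simp add: eq_neg_iff_add_eq_0 add.commute)

lemma cinner_minus_right: "cinner (y::'a::chilbert_space) (- x) = - cinner y x"
  using cinner_add_right[of y x "- x"] by (simp add: eq_neg_iff_add_eq_0 add.commute)

lemma cinner_diff_left: "cinner (x - y) (z::'a::chilbert_space) = cinner x z - cinner y z"
  using cinner_add_left[of x "- y" z] by (simp add: cinner_minus_left)

lemma cinner_diff_right: "cinner (z::'a::chilbert_space) (x - y) = cinner z x - cinner z y"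
  using cinner_add_right[of z x "- y"] by (simp add: cinner_minus_right)

lemma cinner_sum_left: "cinner (\<Sum>i\<in>I. f i) (y::'a::chilbert_space) = (\<Sum>i\<in>I. cinner (f i) y)"
  by (induction I rule: infinite_finite_induct) (auto simp: cinner_add_left)

lemma cinner_sum_right: "cinner (y::'a::chilbert_space) (\<Sum>i\<in>I. f i) = (\<Sum>i\<in>I. cinner y (f i))"
  by (induction I rule: infinite_finite_induct) (auto simp: cinner_add_right)

lemma scaleC_minus1_left: "(-1) *\<^sub>C (x::'a::complex_vector) = - x"
  by (metis scaleC_one cvec.scale_minus_left)

lemma scaleR_eq_scaleC: "r *\<^sub>R (x::'a::complex_vector) = complex_of_real r *\<^sub>C x"
  by (simp add: scaleC_of_real)

lemma norm_sq_eq: "complex_of_real ((norm x)\<^sup>2) = cinner x (x::'a::chilbert_space)"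
  by (rule cinner_self[symmetric])

lemma norm_add_sq:
  "(norm (x + y))\<^sup>2 = (norm x)\<^sup>2 + (norm y)\<^sup>2 + 2 * Re (cinner x (y::'a::chilbert_space))"
proof -
  have "complex_of_real ((norm (x+y))\<^sup>2) = cinner x x + cinner y y + (cinner x y + cnj (cinner x y))"
    unfolding norm_sq_eq by (simp add: cinner_add_left cinner_add_right cinner_commute[of y x])
  also have "\<dots> = complex_of_real ((norm x)\<^sup>2 + (norm y)\<^sup>2 + 2 * Re (cinner x y))"
    by (simp add: cinner_self complex_add_cnj)
  finally show ?thesis by (simp only: of_real_eq_iff)
qed

lemma norm_diff_sq:
  "(norm (x - y))\<^sup>2 = (norm x)\<^sup>2 + (norm y)\<^sup>2 - 2 * Re (cinner x (y::'a::chilbert_space))"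
  using norm_add_sq[of x "- y"] by (simp add: cinner_minus_right)

lemma mult_cnj_self: "z * cnj z = (complex_of_real (cmod z))\<^sup>2"
  by (simp add: complex_norm_square flip: of_real_power)

text \<open>Pythagoras for the component of \<open>x\<close> orthogonal to \<open>y\<close>.
  Nonnegativity of the left side is Cauchy-Schwarz, and the same drop in norm contradicts the
  minimality of a distance unless the coefficient vanishes.\<close>

lemma norm_diff_scaleC_sq:
  assumes "y \<noteq> 0"
  shows "(norm (x - (cinner x y / (norm y)\<^sup>2) *\<^sub>C y))\<^sup>2
    = (norm x)\<^sup>2 - (cmod (cinner x (y::'a::chilbert_space)))\<^sup>2 / (norm y)\<^sup>2"
proof -
  define z where "z = cinner x y"
  have "cnj (z / complex_of_real ((norm y)\<^sup>2)) * z = complex_of_real ((cmod z)\<^sup>2 / (norm y)\<^sup>2)"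
    by (simp add: mult_cnj_self mult.commute[of "cnj _"])
  then have "Re (cinner x ((z / (norm y)\<^sup>2) *\<^sub>C y)) = (cmod z)\<^sup>2 / (norm y)\<^sup>2"
    by (metis Re_complex_of_real cinner_scaleC_right z_def)
  moreover have "(norm ((z / (norm y)\<^sup>2) *\<^sub>C y))\<^sup>2 = (cmod z)\<^sup>2 / (norm y)\<^sup>2"
    using assms by (simp add: norm_scaleC norm_divide norm_mult power2_eq_square)
  ultimately show ?thesis unfolding norm_diff_sq z_def by simp
qed

lemma Cauchy_Schwarz: "cmod (cinner x y) \<le> norm x * norm (y::'a::chilbert_space)"
proof (cases "y = 0")
  case False
  then have "(cmod (cinner x y))\<^sup>2 / (norm y)\<^sup>2 \<le> (norm x)\<^sup>2"
    using norm_diff_scaleC_sq[OF False, of x] by (metis diff_ge_0_iff_ge zero_le_power2)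
  then have "(cmod (cinner x y))\<^sup>2 \<le> (norm x * norm y)\<^sup>2"
    using False by (simp add: divide_le_eq power_mult_distrib)
  then show ?thesis by (simp add: abs_le_square_iff[symmetric])
qed simp

lemma cinner_eq_zero_iff: "cinner x x = 0 \<longleftrightarrow> x = (0::'a::chilbert_space)"
  by (simp add: cinner_self)

lemma cinner_ext:
  assumes "\<And>z. cinner x z = cinner y (z::'a::chilbert_space)"
  shows "x = y"
  using assms[of "x - y"] cinner_eq_zero_iff[of "x - y"] by (simp add: cinner_diff_left)

lemma cinner_ext_right:
  assumes "\<And>z. cinner z x = cinner z (y::'a::chilbert_space)"
  shows "x = y"
  by (rule cinner_ext) (metis assms cinner_commute)

lemma bounded_linear_cinner_left: "bounded_linear (\<lambda>x. cinner x (y::'a::chilbert_space))"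
proof (rule bounded_linear_intro[where K = "norm y"])
  show "cinner (r *\<^sub>R x) y = r *\<^sub>R cinner x y" for r x
    by (simp add: scaleR_eq_scaleC cinner_scaleC_left scaleR_conv_of_real)
qed (simp_all add: cinner_add_left Cauchy_Schwarz)

lemma norm_le_if_cinner_le:
  assumes "\<And>y. cmod (cinner x y) \<le> K * norm y" "K \<ge> 0"
  shows "norm (x::'a::chilbert_space) \<le> K"
proof -
  have "norm x * norm x \<le> K * norm x"
    using assms(1)[of x] by (simp add: cinner_self power2_eq_square norm_mult)
  then show ?thesis using assms(2) by (cases "norm x = 0") (auto simp: mult_le_cancel_right)
qed

lemma bounded_linear_scaleC: "bounded_linear (\<lambda>x::'a::complex_normed_vector. a *\<^sub>C x)"
  by (rule bounded_linear_intro[where K = "cmod a"])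
     (simp_all add: scaleC_add_right norm_scaleC mult.commute scaleR_eq_scaleC scaleC_scaleC)

lemma bounded_linear_scaleC_left: "bounded_linear (\<lambda>a. a *\<^sub>C (x::'a::complex_normed_vector))"
  by (rule bounded_linear_intro[where K = "norm x"])
     (simp_all add: scaleC_add_left norm_scaleC scaleR_eq_scaleC scaleC_scaleC scaleR_conv_of_real)

section \<open>Orthogonal projections and the Riesz theorem\<close>

lemma parallelogram:
  "(norm (x - y))\<^sup>2 = 2 * (norm x)\<^sup>2 + 2 * (norm y)\<^sup>2 - (norm (x + (y::'a::chilbert_space)))\<^sup>2"
  by (simp add: norm_add_sq norm_diff_sq)

text \<open>A minimizing sequence is Cauchy by the parallelogram identity, so completeness provides
  a limit, which lies in the closed set \<open>M\<close>.\<close>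

lemma exists_closest_point:
  fixes M :: "'a::chilbert_space set"
  assumes "closed M" "cvec.subspace M"
  shows "\<exists>p\<in>M. \<forall>m\<in>M. norm (x - p) \<le> norm (x - m)"
proof -
  define D where "D = (\<lambda>m. (norm (x - m))\<^sup>2) ` M"
  define d where "d = Inf D"
  have ne: "D \<noteq> {}" using cvec.subspace_0[OF assms(2)] by (auto simp: D_def)
  have bdd: "bdd_below D" by (rule bdd_belowI[of _ 0]) (auto simp: D_def)
  have d_le: "d \<le> (norm (x - m))\<^sup>2" if "m \<in> M" for m
    unfolding d_def by (rule cInf_lower[OF _ bdd]) (use that in \<open>auto simp: D_def\<close>)
  have "\<exists>m\<in>M. (norm (x - m))\<^sup>2 < d + 1 / Suc n" for n
  proof -
    have "Inf D < d + 1 / Suc n" by (simp add: d_def)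
    then show ?thesis using cInf_lessD[OF ne] by (auto simp: D_def)
  qed
  then obtain m where m: "\<And>n. m n \<in> M" "\<And>n. (norm (x - m n))\<^sup>2 < d + 1 / Suc n"
    by metis
  have close: "(norm (m i - m j))\<^sup>2 \<le> 2 / Suc i + 2 / Suc j" for i j
  proof -
    \<comment> \<open>The midpoint lies in \<open>M\<close>, so its squared distance to
      \<open>x\<close> is at least \<open>d\<close>; this is the lower bound that the parallelogram
      identity subtracts.\<close>
    have "(1/2) *\<^sub>R (m i + m j) \<in> M"
      unfolding scaleR_eq_scaleC using assms(2) m(1) by (intro cvec.subspace_scale cvec.subspace_add)
    from d_le[OF this] have "d \<le> (norm ((1/2) *\<^sub>R ((x - m i) + (x - m j))))\<^sup>2"
      by (simp add: algebra_simps flip: scaleR_add_left)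
    then have "4 * d \<le> (norm ((x - m i) + (x - m j)))\<^sup>2"
      by (simp add: power_mult_distrib power_divide)
    then show ?thesis
      using parallelogram[of "x - m i" "x - m j"] m(2)[of i] m(2)[of j]
      by (simp add: norm_minus_commute)
  qed
  have "Cauchy m"
  proof (rule metric_CauchyI)
    fix e :: real assume e: "e > 0"
    obtain N :: nat where N: "4 / e\<^sup>2 < N" using reals_Archimedean2 by blast
    show "\<exists>N. \<forall>i\<ge>N. \<forall>j\<ge>N. dist (m i) (m j) < e"
    proof (intro exI allI impI)
      fix i j assume ij: "i \<ge> N" "j \<ge> N"
      have "(norm (m i - m j))\<^sup>2 \<le> 2 / Suc i + 2 / Suc j" by (rule close)
      also have "\<dots> \<le> 2 / Suc N + 2 / Suc N"
        using ij by (intro add_mono divide_left_mono) auto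
      also have "\<dots> = 4 / Suc N" by simp
      also have "\<dots> < e\<^sup>2"
      proof -
        have "4 < e\<^sup>2 * N" using N e by (simp add: divide_less_eq mult.commute)
        also have "\<dots> \<le> e\<^sup>2 * Suc N" by (intro mult_left_mono) auto
        finally show ?thesis by (simp add: divide_less_eq)
      qed
      finally have "norm (m i - m j) < e" using e by (simp add: power_less_imp_less_base)
      then show "dist (m i) (m j) < e" by (simp add: dist_norm)
    qed
  qed
  then obtain p where p: "m \<longlonglongrightarrow> p" using Cauchy_convergent_iff convergent_def by blast
  have pM: "p \<in> M" using closed_sequentially[OF assms(1) _ p] m(1) by blast
  have "(norm (x - p))\<^sup>2 \<le> d"
  proof (rule LIMSEQ_le)
    show "(\<lambda>n. (norm (x - m n))\<^sup>2) \<longlonglongrightarrow> (norm (x - p))\<^sup>2" by (intro tendsto_intros p)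
    show "(\<lambda>n. d + 1 / Suc n) \<longlonglongrightarrow> d"
      using tendsto_add[OF tendsto_const[of d] LIMSEQ_inverse_real_of_nat]
      by (simp add: inverse_eq_divide)
  qed (use m(2) less_imp_le in blast)
  then have "norm (x - p) \<le> norm (x - q)" if "q \<in> M" for q
    using d_le[OF that] by (meson norm_ge_zero order_trans power2_le_imp_le)
  with pM show ?thesis by blast
qed

text \<open>Removing from \<open>x - p\<close> its component along \<open>m\<close> amounts to
  moving \<open>p\<close> within \<open>M\<close>. Since this cannot shorten the vector, that
  component is zero.\<close>

lemma orthogonal_projection_exists:
  fixes M :: "'a::chilbert_space set"
  assumes "closed M" "cvec.subspace M"
  shows "\<exists>p\<in>M. \<forall>m\<in>M. cinner (x - p) m = 0"
proof -
  obtain p where p: "p \<in> M" "\<And>m. m \<in> M \<Longrightarrow> norm (x - p) \<le> norm (x - m)"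
    using exists_closest_point[OF assms] by blast
  have "cinner (x - p) m = 0" if m: "m \<in> M" for m
  proof (cases "m = 0")
    case False
    let ?c = "cinner (x - p) m / (norm m)\<^sup>2"
    have "norm (x - p) \<le> norm (x - (p + ?c *\<^sub>C m))"
      by (intro p(2) cvec.subspace_add cvec.subspace_scale assms p(1) m)
    then have "(norm (x - p))\<^sup>2 \<le> (norm ((x - p) - ?c *\<^sub>C m))\<^sup>2"
      by (simp only: diff_diff_eq power_mono norm_ge_zero)
    then have "(cmod (cinner (x - p) m))\<^sup>2 / (norm m)\<^sup>2 \<le> 0"
      unfolding norm_diff_scaleC_sq[OF False] by simp
    then show ?thesis using False by (simp add: divide_le_0_iff)
  qed simp
  with p(1) show ?thesis by blast
qed

lemma Riesz_representation:
  fixes f :: "'a::chilbert_space \<Rightarrow> complex"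
  assumes "bounded_linear f" "\<And>c x. f (c *\<^sub>C x) = c * f x"
  shows "\<exists>y. \<forall>x. f x = cinner x y"
proof (cases "\<forall>x. f x = 0")
  case True
  then show ?thesis by (intro exI[of _ 0]) simp
next
  case False
  then obtain a where a: "f a \<noteq> 0" by blast
  interpret f: bounded_linear f by (rule assms)
  have sub: "cvec.subspace {x. f x = 0}"
    by (auto simp: cvec.subspace_def f.add f.zero assms(2))
  have "closed {x. f x = 0}"
    by (intro closed_Collect_eq continuous_intros linear_continuous_on assms(1))
  from orthogonal_projection_exists[OF this sub, of a]
  obtain p where p: "f p = 0" "\<And>m. f m = 0 \<Longrightarrow> cinner (a - p) m = 0" by blast
  define r where "r = a - p"
  have fr: "f r \<noteq> 0" using a p(1) by (simp add: r_def f.diff)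
  then have r0: "r \<noteq> 0" using f.zero by auto
  show ?thesis
  proof (intro exI allI)
    fix x
    \<comment> \<open>The second vector lies in the kernel of \<open>f\<close>, to which the
      residual \<open>r\<close> of \<open>a\<close> is orthogonal; the resulting equation is solved
      for \<open>f x\<close>.\<close>
    have "cinner r (f x *\<^sub>C r - f r *\<^sub>C x) = 0"
      unfolding r_def[symmetric] by (rule p(2)[folded r_def]) (simp add: f.diff assms(2))
    then have "cinner (f x *\<^sub>C r - f r *\<^sub>C x) r = 0"
      by (metis cinner_commute complex_cnj_zero)
    then have "f x * cinner r r = f r * cinner x r"
      by (simp add: cinner_diff_left cinner_scaleC_left)
    then show "f x = cinner x (cnj (f r / cinner r r) *\<^sub>C r)"
      using r0 by (simp add: cinner_scaleC_right cinner_eq_zero_iff field_simps)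
  qed
qed

section \<open>Sesquilinear forms and adjoints\<close>

lemma bounded_opsD: "X \<in> bounded_ops \<Longrightarrow> blinfun_apply X (c *\<^sub>C x) = c *\<^sub>C blinfun_apply X x"
  by (auto simp: bounded_ops_def)

text \<open>Riesz in the second argument, applied to the conjugate of \<open>\<phi> x\<close>
  because \<open>cinner\<close> is linear in its first slot. Adjoints and the operators that
  represent functionals are both built from forms in this way.\<close>

lemma bounded_ops_exists:
  fixes \<phi> :: "'a::chilbert_space \<Rightarrow> 'a \<Rightarrow> complex"
  assumes add1: "\<And>x y z. \<phi> (x + y) z = \<phi> x z + \<phi> y z"
    and scale1: "\<And>c x z. \<phi> (c *\<^sub>C x) z = c * \<phi> x z"
    and add2: "\<And>x y z. \<phi> z (x + y) = \<phi> z x + \<phi> z y"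
    and scale2: "\<And>c x z. \<phi> z (c *\<^sub>C x) = cnj c * \<phi> z x"
    and bd: "\<And>x y. cmod (\<phi> x y) \<le> K * norm x * norm y"
  shows "\<exists>X\<in>bounded_ops. \<forall>x y. cinner (blinfun_apply X x) y = \<phi> x y"
proof -
  have "\<exists>w. \<forall>y. cnj (\<phi> x y) = cinner y w" for x
  proof (rule Riesz_representation)
    show "bounded_linear (\<lambda>y. cnj (\<phi> x y))"
    proof (rule bounded_linear_intro[where K = "K * norm x"])
      show "cnj (\<phi> x (r *\<^sub>R y)) = r *\<^sub>R cnj (\<phi> x y)" for r y
        by (simp add: scaleR_eq_scaleC scale2 scaleR_conv_of_real)
    qed (use bd[of x] in \<open>auto simp: add2 mult_ac\<close>)
  qed (simp add: scale2)
  then obtain F where F: "\<And>x y. cnj (\<phi> x y) = cinner y (F x)" by metis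
  have F': "cinner (F x) y = \<phi> x y" for x y
    by (metis F cinner_commute complex_cnj_cnj)
  have scale: "F (c *\<^sub>C x) = c *\<^sub>C F x" for c x
    by (rule cinner_ext) (simp add: F' scale1 cinner_scaleC_left)
  have "bounded_linear F"
  proof (rule bounded_linear_intro[where K = "\<bar>K\<bar>"])
    show "F (x + y) = F x + F y" for x y
      by (rule cinner_ext) (simp add: F' add1 cinner_add_left)
    show "F (r *\<^sub>R x) = r *\<^sub>R F x" for r x
      by (simp add: scaleR_eq_scaleC scale)
    show "norm (F x) \<le> norm x * \<bar>K\<bar>" for x
    proof (rule norm_le_if_cinner_le)
      fix y
      have "cmod (cinner (F x) y) \<le> K * norm x * norm y" by (simp add: F' bd)
      also have "\<dots> \<le> \<bar>K\<bar> * norm x * norm y" by (intro mult_right_mono) auto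
      finally show "cmod (cinner (F x) y) \<le> norm x * \<bar>K\<bar> * norm y" by (simp add: mult.commute)
    qed simp
  qed
  then show ?thesis
    by (intro bexI[of _ "Blinfun F"]) (simp_all add: bounded_linear_Blinfun_apply F' bounded_ops_def scale)
qed

text \<open>The definite description in \<open>cadjoint\<close> ranges over all real-linear bounded
  maps. The operator built from the form \<open>cinner x (X y)\<close> satisfies it, and
  nondegeneracy of the inner product leaves no other candidate.\<close>

lemma cadjoint_exists:
  fixes X :: "'a::chilbert_space \<Rightarrow>\<^sub>L 'a"
  assumes "X \<in> bounded_ops"
  shows "cadjoint X \<in> bounded_ops \<and> (\<forall>x y. cinner (X x) y = cinner x (cadjoint X y))"
proof -
  have "\<exists>Y\<in>bounded_ops. \<forall>x y. cinner (blinfun_apply Y x) y = cinner x (X y)"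
  proof (rule bounded_ops_exists[where K = "norm X"])
    show "cmod (cinner x (X y)) \<le> norm X * norm x * norm y" for x y
      using Cauchy_Schwarz[of x "X y"] mult_left_mono[OF norm_blinfun[of X y], of "norm x"]
      by (simp add: mult_ac)
  qed (use bounded_opsD[OF assms] in
      \<open>auto simp: cinner_add_left cinner_add_right cinner_scaleC_left cinner_scaleC_right blinfun.add_right\<close>)
  then obtain Y where Y: "Y \<in> bounded_ops" "\<And>x y. cinner (blinfun_apply Y x) y = cinner x (X y)" by blast
  have Y': "cinner (X x) y = cinner x (Y y)" for x y by (metis Y(2) cinner_commute)
  have "cadjoint X = Y" unfolding cadjoint_def
  proof (rule the_equality)
    show "Z = Y" if "\<forall>x y. cinner (X x) y = cinner x (blinfun_apply Z y)" for Z
      by (rule blinfun_eqI, rule cinner_ext_right) (metis that Y')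
  qed (simp add: Y')
  with Y(1) Y' show ?thesis by blast
qed

lemma cadjoint_bounded: "X \<in> bounded_ops \<Longrightarrow> cadjoint X \<in> bounded_ops"
  by (simp add: cadjoint_exists)

lemma cinner_cadjoint_right: "X \<in> bounded_ops \<Longrightarrow> cinner x (cadjoint X y) = cinner (X x) y"
  by (simp add: cadjoint_exists)

lemma cinner_cadjoint_left: "X \<in> bounded_ops \<Longrightarrow> cinner (cadjoint X x) y = cinner x (X y)"
  by (metis cinner_cadjoint_right cinner_commute)

section \<open>Orthonormal families, Bessel's inequality and expansions\<close>

definition onf :: "'i set \<Rightarrow> ('i \<Rightarrow> 'a::chilbert_space) \<Rightarrow> bool" where
  "onf I e \<longleftrightarrow> (\<forall>i\<in>I. \<forall>j\<in>I. cinner (e i) (e j) = (if i = j then 1 else 0))"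

lemma onfD: "onf I e \<Longrightarrow> i \<in> I \<Longrightarrow> j \<in> I \<Longrightarrow> cinner (e i) (e j) = (if i = j then 1 else 0)"
  by (simp add: onf_def)

lemma onf_subset: "onf I e \<Longrightarrow> J \<subseteq> I \<Longrightarrow> onf J e"
  unfolding onf_def by blast

lemma onf_norm: "onf I e \<Longrightarrow> i \<in> I \<Longrightarrow> norm (e i) = 1"
proof -
  assume "onf I e" "i \<in> I"
  then have "complex_of_real ((norm (e i))\<^sup>2) = complex_of_real 1"
    unfolding norm_sq_eq by (simp add: onfD)
  then have "(norm (e i))\<^sup>2 = 1" by (simp only: of_real_eq_iff)
  then show ?thesis by (metis norm_ge_zero power2_eq_1_iff zero_le_one neg_0_le_iff_le not_one_le_zero)
qed

lemma onf_cinner_lincomb: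
  assumes "onf I e" "finite I" "j \<in> I"
  shows "cinner (\<Sum>i\<in>I. c i *\<^sub>C e i) (e j) = c j"
proof -
  have "cinner (\<Sum>i\<in>I. c i *\<^sub>C e i) (e j) = (\<Sum>i\<in>I. if j = i then c i else 0)"
    unfolding cinner_sum_left by (intro sum.cong refl) (use assms onfD[OF assms(1) _ assms(3)] in \<open>auto simp: cinner_scaleC_left\<close>)
  then show ?thesis using assms by simp
qed

lemma onf_norm_lincomb:
  assumes "onf I e" "finite I"
  shows "(norm (\<Sum>i\<in>I. c i *\<^sub>C e i))\<^sup>2 = (\<Sum>i\<in>I. (cmod (c i))\<^sup>2)"
proof -
  have "complex_of_real ((norm (\<Sum>i\<in>I. c i *\<^sub>C e i))\<^sup>2) = (\<Sum>j\<in>I. cnj (c j) * c j)"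
    unfolding norm_sq_eq
    by (subst cinner_sum_right) (intro sum.cong refl, simp add: cinner_scaleC_right onf_cinner_lincomb[OF assms])
  also have "\<dots> = complex_of_real (\<Sum>i\<in>I. (cmod (c i))\<^sup>2)"
    by (simp only: of_real_sum, intro sum.cong refl, simp add: mult_cnj_self mult.commute[of "cnj _"])
  finally show ?thesis by (simp only: of_real_eq_iff)
qed

lemma onf_projection_sq:
  assumes "onf I e" "finite I"
  shows "(norm (x - (\<Sum>i\<in>I. cinner x (e i) *\<^sub>C e i)))\<^sup>2
     = (norm x)\<^sup>2 - (\<Sum>i\<in>I. (cmod (cinner x (e i)))\<^sup>2)"
proof -
  have "cinner x (\<Sum>i\<in>I. cinner x (e i) *\<^sub>C e i) = complex_of_real (\<Sum>i\<in>I. (cmod (cinner x (e i)))\<^sup>2)"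
    unfolding cinner_sum_right of_real_sum
    by (intro sum.cong refl) (simp add: cinner_scaleC_right mult_cnj_self mult.commute[of "cnj _"])
  then show ?thesis by (simp add: norm_diff_sq onf_norm_lincomb[OF assms])
qed

lemma Bessel:
  assumes "onf I e" "finite I"
  shows "(\<Sum>i\<in>I. (cmod (cinner x (e i)))\<^sup>2) \<le> (norm x)\<^sup>2"
  using onf_projection_sq[OF assms, of x] by (metis diff_ge_0_iff_ge zero_le_power2)

text \<open>Subtracting a combination of the \<open>e i\<close> from \<open>x\<close> does not
  change the residual, and a residual is never longer than the vector it comes from.\<close>

lemma onf_projection_closest:
  assumes "onf I e" "finite I"
  shows "norm (x - (\<Sum>i\<in>I. cinner x (e i) *\<^sub>C e i)) \<le> norm (x - (\<Sum>i\<in>I. c i *\<^sub>C e i))"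
proof -
  define y where "y = x - (\<Sum>i\<in>I. c i *\<^sub>C e i)"
  have "y - (\<Sum>i\<in>I. cinner y (e i) *\<^sub>C e i) = x - (\<Sum>i\<in>I. cinner x (e i) *\<^sub>C e i)"
    by (simp add: y_def cinner_diff_left onf_cinner_lincomb[OF assms] cvec.scale_left_diff_distrib
        sum_subtractf)
  then have "(norm (x - (\<Sum>i\<in>I. cinner x (e i) *\<^sub>C e i)))\<^sup>2 \<le> (norm y)\<^sup>2"
    using onf_projection_sq[OF assms, of y] by (simp add: sum_nonneg)
  then show ?thesis unfolding y_def by (rule power2_le_imp_le) simp
qed

text \<open>Membership in the closed span gives one finite combination within
  \<open>\<epsilon>\<close> of \<open>x\<close>. Padded with zero coefficients it competes over any
  larger finite \<open>Y\<close>, where the Fourier sum is at least as close.\<close>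

lemma onf_expansion:
  fixes E :: "'a::chilbert_space set"
  assumes on: "onf E (\<lambda>e. e)" and x: "x \<in> closure (cvec.span E)"
  shows "((\<lambda>e. cinner x e *\<^sub>C e) has_sum x) E"
  unfolding has_sum_def tendsto_iff eventually_finite_subsets_at_top
proof (intro allI impI)
  fix \<epsilon> :: real assume "\<epsilon> > 0"
  then obtain y where y: "y \<in> cvec.span E" "dist y x < \<epsilon>" using x closure_approachable by blast
  from y(1) obtain G c where G: "finite G" "G \<subseteq> E" "y = (\<Sum>a\<in>G. c a *\<^sub>C a)"
    by (auto simp: cvec.span_explicit)
  show "\<exists>X. finite X \<and> X \<subseteq> E \<and> (\<forall>Y. finite Y \<and> X \<subseteq> Y \<and> Y \<subseteq> E \<longrightarrow>
          dist (\<Sum>e\<in>Y. cinner x e *\<^sub>C e) x < \<epsilon>)"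
  proof (intro exI conjI allI impI)
    fix Y assume Y: "finite Y \<and> G \<subseteq> Y \<and> Y \<subseteq> E"
    have "y = (\<Sum>a\<in>Y. (if a \<in> G then c a else 0) *\<^sub>C a)"
      unfolding G(3) using Y by (intro sum.mono_neutral_cong_left) auto
    then have "norm (x - (\<Sum>e\<in>Y. cinner x e *\<^sub>C e)) \<le> norm (x - y)"
      using onf_projection_closest[OF onf_subset[OF on], of Y x] Y by metis
    then show "dist (\<Sum>e\<in>Y. cinner x e *\<^sub>C e) x < \<epsilon>"
      using y(2) by (simp add: dist_norm norm_minus_commute)
  qed (use G in auto)
qed

lemma closure_subspace:
  fixes S :: "'a::complex_normed_vector set"
  assumes "cvec.subspace S"
  shows "cvec.subspace (closure S)"
  unfolding cvec.subspace_def
proof (intro conjI ballI allI)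
  show "0 \<in> closure S" using closure_subset cvec.subspace_0[OF assms] by blast
next
  fix x y assume "x \<in> closure S" "y \<in> closure S"
  then obtain f g where "\<And>n. f n \<in> S" "f \<longlonglongrightarrow> x" "\<And>n. g n \<in> S" "g \<longlonglongrightarrow> y"
    unfolding closure_sequential by metis
  then show "x + y \<in> closure S" unfolding closure_sequential
    by (intro exI[of _ "\<lambda>n. f n + g n"]) (auto intro: tendsto_add cvec.subspace_add[OF assms])
next
  fix c x assume "x \<in> closure S"
  then obtain f where "\<And>n. f n \<in> S" "f \<longlonglongrightarrow> x" unfolding closure_sequential by metis
  then show "c *\<^sub>C x \<in> closure S" unfolding closure_sequential
    by (intro exI[of _ "\<lambda>n. c *\<^sub>C f n"])
       (auto intro: bounded_linear.tendsto[OF bounded_linear_scaleC] cvec.subspace_scale[OF assms])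
qed

text \<open>The projection \<open>p\<close> onto the closed span has the same coefficients as
  \<open>x\<close>, so the series of \<open>x\<close> converges to \<open>p\<close>.\<close>

lemma orthonormal_decomposition:
  fixes E :: "'a::chilbert_space set"
  assumes "onf E (\<lambda>e. e)"
  obtains p where "((\<lambda>e. cinner x e *\<^sub>C e) has_sum p) E" "\<And>e. e \<in> E \<Longrightarrow> cinner (x - p) e = 0"
proof -
  obtain p where p: "p \<in> closure (cvec.span E)" "\<And>m. m \<in> closure (cvec.span E) \<Longrightarrow> cinner (x - p) m = 0"
    using orthogonal_projection_exists[OF closed_closure closure_subspace[OF cvec.subspace_span], where x = x]
    by metis
  have E: "cinner (x - p) e = 0" if "e \<in> E" for e
    using that p(2) closure_subset cvec.span_base by blast
  have "((\<lambda>e. cinner x e *\<^sub>C e) has_sum p) E \<longleftrightarrow> ((\<lambda>e. cinner p e *\<^sub>C e) has_sum p) E"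
    by (rule has_sum_cong) (use E in \<open>simp add: cinner_diff_left\<close>)
  then show ?thesis using that onf_expansion[OF assms p(1)] E by blast
qed

text \<open>\<open>V\<close> is an arbitrary set, so one use of Zorn's lemma serves twice: the set
  of all vectors gives an orthonormal basis, a set of eigenvectors of \<open>X\<^sup>*X\<close>
  gives a singular system. Maximality says that no unit vector of \<open>V\<close> can be
  adjoined.\<close>

lemma maximal_onf_exists:
  fixes V :: "'a::chilbert_space set"
  obtains E where "E \<subseteq> V" "onf E (\<lambda>e. e)"
    "\<And>x. x \<in> V \<Longrightarrow> norm x = 1 \<Longrightarrow> \<exists>e\<in>E. cinner x e \<noteq> 0"
proof -
  define \<A> where "\<A> = {E. E \<subseteq> V \<and> onf E (\<lambda>e. e)}"
  have "\<exists>M\<in>\<A>. \<forall>X\<in>\<A>. M \<subseteq> X \<longrightarrow> X = M"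
  proof (rule subset_Zorn')
    fix \<C> assume "subset.chain \<A> \<C>"
    then have sub: "\<And>E. E \<in> \<C> \<Longrightarrow> E \<subseteq> V \<and> onf E (\<lambda>e. e)"
      and ch: "\<And>E F. E \<in> \<C> \<Longrightarrow> F \<in> \<C> \<Longrightarrow> E \<subseteq> F \<or> F \<subseteq> E"
      by (auto simp: subset_chain_def \<A>_def)
    show "\<Union>\<C> \<in> \<A>" unfolding \<A>_def onf_def mem_Collect_eq
    proof (intro conjI ballI)
      fix e f assume "e \<in> \<Union>\<C>" "f \<in> \<Union>\<C>"
      then obtain D1 D2 where D: "D1 \<in> \<C>" "e \<in> D1" "D2 \<in> \<C>" "f \<in> D2" by blast
      from ch[OF D(1,3)] have "\<exists>D\<in>\<C>. e \<in> D \<and> f \<in> D"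
      proof
        assume "D1 \<subseteq> D2" then show ?thesis by (intro bexI[OF _ D(3)] conjI subsetD[OF _ D(2)] D(4))
      next
        assume "D2 \<subseteq> D1" then show ?thesis by (intro bexI[OF _ D(1)] conjI subsetD[OF _ D(4)] D(2))
      qed
      then obtain D where "D \<in> \<C>" "e \<in> D" "f \<in> D" by (elim bexE conjE)
      then show "cinner e f = (if e = f then 1 else 0)" using sub[of D] onfD[of D "\<lambda>e. e"] by simp
    qed (use sub in \<open>simp add: Sup_le_iff\<close>)
  qed
  then obtain E where E: "E \<subseteq> V" "onf E (\<lambda>e. e)"
    and max: "\<And>F. F \<subseteq> V \<Longrightarrow> onf F (\<lambda>e. e) \<Longrightarrow> E \<subseteq> F \<Longrightarrow> F = E"
    by (auto simp: \<A>_def)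
  have "\<exists>e\<in>E. cinner x e \<noteq> 0" if x: "x \<in> V" "norm x = 1" for x
  proof (rule ccontr)
    assume "\<not> ?thesis"
    then have 0: "cinner x e = 0" "cinner e x = 0" if "e \<in> E" for e
      using that cinner_commute[of e x] by auto
    have xx: "cinner x x = 1" by (simp add: cinner_self x(2))
    have "onf (insert x E) (\<lambda>e. e)" unfolding onf_def
      using 0 xx onfD[OF E(2)] by (metis insert_iff zero_neq_one)
    then have "insert x E = E" using max[of "insert x E"] E(1) x(1) by blast
    then show False using 0(1)[of x] xx by auto
  qed
  with E that show ?thesis by blast
qed

lemma cinner_has_sum_left:
  assumes "(f has_sum x) E" shows "((\<lambda>e. cinner (f e) y) has_sum cinner x (y::'a::chilbert_space)) E"
  using has_sum_bounded_linear[OF bounded_linear_cinner_left assms] by (simp add: o_def)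

text \<open>A nonzero residual of \<open>x\<close>, normalised, would be a unit vector orthogonal to
  all of \<open>B\<close>.\<close>

lemma Parseval:
  fixes B :: "'a::chilbert_space set"
  assumes "onf B (\<lambda>e. e)" "\<And>x. norm x = 1 \<Longrightarrow> \<exists>e\<in>B. cinner x e \<noteq> 0"
  shows "((\<lambda>e. cinner x e * cinner e y) has_sum cinner x y) B"
proof -
  obtain p where p: "((\<lambda>e. cinner x e *\<^sub>C e) has_sum p) B" "\<And>e. e \<in> B \<Longrightarrow> cinner (x - p) e = 0"
    using orthonormal_decomposition[OF assms(1)] by blast
  have "x - p = 0"
  proof (rule ccontr)
    assume "x - p \<noteq> 0"
    then have "norm (complex_of_real (1 / norm (x - p)) *\<^sub>C (x - p)) = 1"
      by (simp add: norm_scaleC norm_divide)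
    from assms(2)[OF this] show False using p(2) by (auto simp: cinner_scaleC_left)
  qed
  then show ?thesis using cinner_has_sum_left[OF p(1), of y] by (simp add: cinner_scaleC_left)
qed

section \<open>Compact operators and conjugations\<close>

lemma blinfun_cinner_eqI:
  fixes X Y :: "'a::chilbert_space \<Rightarrow>\<^sub>L 'a"
  assumes "\<And>x y. cinner (X x) y = cinner (Y x) y"
  shows "X = Y"
  by (rule blinfun_eqI, rule cinner_ext) (rule assms)

lemma norm_blinfun_cinner_le:
  fixes X :: "'a::chilbert_space \<Rightarrow>\<^sub>L 'a"
  assumes "\<And>x y. cmod (cinner (X x) y) \<le> K * norm x * norm y" "K \<ge> 0"
  shows "norm X \<le> K"
  by (intro norm_blinfun_bound norm_le_if_cinner_le mult_nonneg_nonneg norm_ge_zero assms)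

lemma cmod_cinner_blinfun_le: "cmod (cinner (blinfun_apply X x) y) \<le> norm X * norm x * norm (y::'a::chilbert_space)"
  using Cauchy_Schwarz[of "X x" y] mult_right_mono[OF norm_blinfun[of X x] norm_ge_zero[of y]]
  by linarith

lemma subspace_bounded_ops: "cvec.subspace (bounded_ops :: ('a::complex_normed_vector \<Rightarrow>\<^sub>L 'a) set)"
  by (auto simp: cvec.subspace_def bounded_ops_def blinfun.add_left scaleC_blinfun.rep_eq
      scaleC_add_right scaleC_scaleC mult.commute)

lemma norm_scaleC_blinfun: "norm (c *\<^sub>C X) = cmod c * norm (X :: 'a::complex_normed_vector \<Rightarrow>\<^sub>L 'a)"
proof (rule antisym)
  show le: "norm (c *\<^sub>C X) \<le> cmod c * norm X" for c and X :: "'a \<Rightarrow>\<^sub>L 'a"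
  proof (rule norm_blinfun_bound)
    show "norm ((c *\<^sub>C X) x) \<le> cmod c * norm X * norm x" for x
      using mult_left_mono[OF norm_blinfun[of X x] norm_ge_zero[of c]]
      by (simp add: scaleC_blinfun.rep_eq norm_scaleC mult_ac)
  qed simp
  show "cmod c * norm X \<le> norm (c *\<^sub>C X)"
  proof (cases "c = 0")
    case False
    have "norm (inverse c *\<^sub>C c *\<^sub>C X) \<le> cmod (inverse c) * norm (c *\<^sub>C X)" by (rule le)
    then show ?thesis using False by (simp add: scaleC_scaleC norm_inverse norm_divide field_simps)
  qed simp
qed

section \<open>Rank-one and finite rank operators\<close>

definition rk :: "'a::chilbert_space \<Rightarrow> 'a \<Rightarrow> 'a \<Rightarrow>\<^sub>L 'a" where
  "rk u v = Blinfun (\<lambda>x. cinner x u *\<^sub>C v)"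

lemma rk_apply: "rk u v x = cinner x u *\<^sub>C v"
  unfolding rk_def
  by (simp add: bounded_linear_Blinfun_apply
      bounded_linear_compose[OF bounded_linear_scaleC_left bounded_linear_cinner_left])

lemma cinner_rk: "cinner (rk u v x) y = cinner x u * cinner v y"
  by (simp add: rk_apply cinner_scaleC_left)

lemma rk_bounded: "rk u v \<in> bounded_ops"
  by (simp add: bounded_ops_def rk_apply cinner_scaleC_left scaleC_scaleC)

lemma norm_rk_le: "norm (rk u v) \<le> norm u * norm v"
proof (rule norm_blinfun_bound)
  show "norm (rk u v x) \<le> norm u * norm v * norm x" for x
    using mult_right_mono[OF Cauchy_Schwarz[of x u] norm_ge_zero[of v]]
    by (simp add: rk_apply norm_scaleC mult_ac)
qed simp

definition finrank :: "('a::chilbert_space \<Rightarrow>\<^sub>L 'a) set" where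
  "finrank = cvec.span {rk u v | u v. True}"

lemma rk_finrank: "rk u v \<in> finrank"
  unfolding finrank_def by (rule cvec.span_base) blast

lemma finrank_add: "F \<in> finrank \<Longrightarrow> G \<in> finrank \<Longrightarrow> F + G \<in> finrank"
  unfolding finrank_def by (rule cvec.span_add)

lemma finrank_diff: "F \<in> finrank \<Longrightarrow> G \<in> finrank \<Longrightarrow> F - G \<in> finrank"
  unfolding finrank_def by (rule cvec.span_diff)

lemma finrank_scale: "F \<in> finrank \<Longrightarrow> c *\<^sub>C F \<in> finrank"
  unfolding finrank_def by (rule cvec.span_scale)

lemma finrank_sum: "(\<And>i. i \<in> I \<Longrightarrow> F i \<in> finrank) \<Longrightarrow> (\<Sum>i\<in>I. F i) \<in> finrank"
  unfolding finrank_def by (rule cvec.span_sum)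

lemma finrank_induct [consumes 1, case_names zero step]:
  assumes "F \<in> finrank" "P 0" "\<And>c u v F. F \<in> finrank \<Longrightarrow> P F \<Longrightarrow> P (c *\<^sub>C rk u v + F)"
  shows "P F"
proof -
  have "F \<in> finrank \<and> P F"
    using assms(1) unfolding finrank_def
  proof (induction rule: cvec.span_induct_alt)
    case base
    then show ?case using assms(2) cvec.span_zero by blast
  next
    case (step c x y)
    then show ?case using assms(3) rk_finrank finrank_add finrank_scale unfolding finrank_def by blast
  qed
  then show ?thesis ..
qed

lemma finrank_bounded: "F \<in> finrank \<Longrightarrow> F \<in> bounded_ops"
  by (induction rule: finrank_induct)
     (auto intro: cvec.subspace_0 cvec.subspace_add cvec.subspace_scale subspace_bounded_ops rk_bounded)

lemma blinfun_compose_scaleC_right: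
  "X \<in> bounded_ops \<Longrightarrow> X o\<^sub>L (c *\<^sub>C Y) = c *\<^sub>C (X o\<^sub>L (Y::'a::chilbert_space \<Rightarrow>\<^sub>L 'a))"
  by (rule blinfun_eqI) (simp add: scaleC_blinfun.rep_eq bounded_opsD)

lemma blinfun_compose_scaleC_left:
  "(c *\<^sub>C Y) o\<^sub>L X = c *\<^sub>C ((Y::'a::chilbert_space \<Rightarrow>\<^sub>L 'a) o\<^sub>L X)"
  by (rule blinfun_eqI) (simp add: scaleC_blinfun.rep_eq)

lemma finrank_compose_left:
  assumes "X \<in> bounded_ops" "F \<in> finrank" shows "X o\<^sub>L F \<in> finrank"
  using assms(2)
proof (induction rule: finrank_induct)
  case (step c u v F)
  have "X o\<^sub>L rk u v = rk u (X v)"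
    by (rule blinfun_eqI) (simp add: rk_apply bounded_opsD[OF assms(1)])
  then show ?case
    using step by (simp add: bounded_bilinear.add_right[OF bounded_bilinear_blinfun_compose] blinfun_compose_scaleC_right assms(1)
        finrank_add finrank_scale rk_finrank)
qed (simp add: finrank_def cvec.span_zero)

lemma finrank_compose_right:
  assumes "X \<in> bounded_ops" "F \<in> finrank" shows "F o\<^sub>L X \<in> finrank"
  using assms(2)
proof (induction rule: finrank_induct)
  case (step c u v F)
  have "rk u v o\<^sub>L X = rk (cadjoint X u) v"
    by (rule blinfun_eqI) (simp add: rk_apply cinner_cadjoint_right[OF assms(1)])
  then show ?case
    using step by (simp add: bounded_bilinear.add_left[OF bounded_bilinear_blinfun_compose] blinfun_compose_scaleC_left
        finrank_add finrank_scale rk_finrank)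
qed (simp add: finrank_def cvec.span_zero)

text \<open>The closure is complete, so only finite covers matter. A cover of \<open>S\<close> by
  balls of half the radius, taken as closed balls, also covers the closure.\<close>

lemma compact_closure_iff_totally_bounded:
  fixes S :: "'a::{real_normed_vector,complete_space} set"
  shows "compact (closure S) \<longleftrightarrow> (\<forall>e>0. \<exists>k. finite k \<and> S \<subseteq> (\<Union>x\<in>k. ball x e))"
proof
  assume "compact (closure S)"
  then show "\<forall>e>0. \<exists>k. finite k \<and> S \<subseteq> (\<Union>x\<in>k. ball x e)"
    using closure_subset[of S] unfolding compact_eq_totally_bounded by (meson subset_trans)
next
  assume *: "\<forall>e>0. \<exists>k. finite k \<and> S \<subseteq> (\<Union>x\<in>k. ball x e)"
  show "compact (closure S)" unfolding compact_eq_totally_bounded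
  proof (intro conjI allI impI)
    show "complete (closure S)" by (simp add: complete_eq_closed)
    fix e :: real assume e: "e > 0"
    then obtain k where k: "finite k" "S \<subseteq> (\<Union>x\<in>k. ball x (e/2))" using * half_gt_zero by blast
    have "closed (\<Union>x\<in>k. cball x (e/2))" using k(1) by (intro closed_UN) auto
    moreover have "S \<subseteq> (\<Union>x\<in>k. cball x (e/2))" using k(2) ball_subset_cball by blast
    ultimately have "closure S \<subseteq> (\<Union>x\<in>k. cball x (e/2))" by (rule closure_minimal[rotated])
    also have "\<dots> \<subseteq> (\<Union>x\<in>k. ball x e)" using e by (intro UN_mono) auto
    finally show "\<exists>k. finite k \<and> closure S \<subseteq> (\<Union>x\<in>k. ball x e)" using k(1) by blast
  qed
qed

text \<open>Any compact set around the image of the unit ball will do, which spares the computation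
  of closures for sums and multiples.\<close>

lemma compact_ops_iff:
  "X \<in> compact_ops \<longleftrightarrow> X \<in> bounded_ops \<and> (\<exists>K. compact K \<and> blinfun_apply X ` cball 0 1 \<subseteq> K)"
proof
  assume "X \<in> bounded_ops \<and> (\<exists>K. compact K \<and> blinfun_apply X ` cball 0 1 \<subseteq> K)"
  then obtain K where K: "X \<in> bounded_ops" "compact K" "blinfun_apply X ` cball 0 1 \<subseteq> K" by blast
  then have "closure (blinfun_apply X ` cball 0 1) \<subseteq> K"
    by (intro closure_minimal compact_imp_closed)
  then have "compact (K \<inter> closure (blinfun_apply X ` cball 0 1))"
    using K(2) by (intro compact_Int_closed) auto
  moreover have "K \<inter> closure (blinfun_apply X ` cball 0 1) = closure (blinfun_apply X ` cball 0 1)"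
    using \<open>closure (blinfun_apply X ` cball 0 1) \<subseteq> K\<close> by blast
  ultimately show "X \<in> compact_ops" using K(1) by (simp add: compact_ops_def)
next
  assume "X \<in> compact_ops"
  then show "X \<in> bounded_ops \<and> (\<exists>K. compact K \<and> blinfun_apply X ` cball 0 1 \<subseteq> K)"
    unfolding compact_ops_def mem_Collect_eq
    by (intro conjI exI[of _ "closure (blinfun_apply X ` cball 0 1)"]) (auto intro: subsetD[OF closure_subset])
qed

lemma compact_ops_bounded: "X \<in> compact_ops \<Longrightarrow> X \<in> bounded_ops"
  by (simp add: compact_ops_def)

lemma subspace_compact_ops: "cvec.subspace (compact_ops :: ('a::complex_normed_vector \<Rightarrow>\<^sub>L 'a) set)"
  unfolding cvec.subspace_def
proof (intro conjI ballI allI)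
  show "(0::'a \<Rightarrow>\<^sub>L 'a) \<in> compact_ops"
    unfolding compact_ops_iff using cvec.subspace_0[OF subspace_bounded_ops]
    by (intro conjI exI[of _ "{0}"]) auto
next
  fix X Y :: "'a \<Rightarrow>\<^sub>L 'a" assume "X \<in> compact_ops" "Y \<in> compact_ops"
  then obtain K L where K: "X \<in> bounded_ops" "compact K" "blinfun_apply X ` cball 0 1 \<subseteq> K"
    and L: "Y \<in> bounded_ops" "compact L" "blinfun_apply Y ` cball 0 1 \<subseteq> L"
    unfolding compact_ops_iff by blast
  have "(X + Y) ` cball 0 1 \<subseteq> {x + y |x y. x \<in> K \<and> y \<in> L}"
    using K(3) L(3) by (fastforce simp: blinfun.add_left)
  then show "X + Y \<in> compact_ops" unfolding compact_ops_iff
    by (intro conjI exI) (rule cvec.subspace_add[OF subspace_bounded_ops K(1) L(1)], rule compact_sums[OF K(2) L(2)])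
next
  fix c and X :: "'a \<Rightarrow>\<^sub>L 'a" assume "X \<in> compact_ops"
  then obtain K where K: "X \<in> bounded_ops" "compact K" "blinfun_apply X ` cball 0 1 \<subseteq> K"
    unfolding compact_ops_iff by blast
  have "compact ((\<lambda>x. c *\<^sub>C x) ` K)"
    by (intro compact_continuous_image K(2) linear_continuous_on bounded_linear_scaleC)
  moreover have "(c *\<^sub>C X) ` cball 0 1 \<subseteq> (\<lambda>x. c *\<^sub>C x) ` K"
    using K(3) by (auto simp: scaleC_blinfun.rep_eq)
  ultimately show "c *\<^sub>C X \<in> compact_ops" unfolding compact_ops_iff
    by (intro conjI exI) (rule cvec.subspace_scale[OF subspace_bounded_ops K(1)])
qed

lemma rk_compact: "rk u v \<in> compact_ops"
  unfolding compact_ops_iff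
proof (intro conjI exI)
  show "compact ((\<lambda>a. a *\<^sub>C v) ` cball 0 (norm u))"
    by (intro compact_continuous_image linear_continuous_on bounded_linear_scaleC_left compact_cball)
  have "cmod (cinner x u) \<le> norm u" if "norm x \<le> 1" for x
    using Cauchy_Schwarz[of x u] mult_right_mono[OF that norm_ge_zero[of u]] by simp
  then show "rk u v ` cball 0 1 \<subseteq> (\<lambda>a. a *\<^sub>C v) ` cball 0 (norm u)"
    by (auto simp: rk_apply)
qed (rule rk_bounded)

lemma finrank_compact: "F \<in> finrank \<Longrightarrow> F \<in> compact_ops"
  by (induction rule: finrank_induct)
     (auto intro: cvec.subspace_0 cvec.subspace_add cvec.subspace_scale subspace_compact_ops rk_compact)

lemma compact_ops_if_approx:
  fixes X :: "'a::chilbert_space \<Rightarrow>\<^sub>L 'a"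
  assumes "X \<in> bounded_ops" "\<And>e. e > 0 \<Longrightarrow> \<exists>F\<in>compact_ops. norm (X - F) \<le> e"
  shows "X \<in> compact_ops"
proof -
  have "compact (closure (blinfun_apply X ` cball 0 1))"
    unfolding compact_closure_iff_totally_bounded
  proof (intro allI impI)
    fix e :: real assume e: "e > 0"
    obtain F where F: "F \<in> compact_ops" "norm (X - F) \<le> e/2" using assms(2)[of "e/2"] e by auto
    then have "compact (closure (blinfun_apply F ` cball 0 1))" by (simp add: compact_ops_def)
    then obtain k where k: "finite k" "blinfun_apply F ` cball 0 1 \<subseteq> (\<Union>x\<in>k. ball x (e/2))"
      unfolding compact_closure_iff_totally_bounded using e half_gt_zero by blast
    have "X x \<in> (\<Union>x\<in>k. ball x e)" if x: "norm x \<le> 1" for x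
    proof -
      obtain y where y: "y \<in> k" "dist y (F x) < e/2" using k(2) x by fastforce
      have "norm (F x - X x) \<le> norm (X - F) * norm x"
        using norm_blinfun[of "X - F" x] by (simp add: blinfun.diff_left norm_minus_commute)
      also have "\<dots> \<le> e/2" using mult_mono[OF F(2) x] e by simp
      finally have "dist y (X x) < e" using y(2) dist_triangle[of y "X x" "F x"] by (simp add: dist_norm)
      then show ?thesis using y(1) by auto
    qed
    then show "\<exists>k. finite k \<and> blinfun_apply X ` cball 0 1 \<subseteq> (\<Union>x\<in>k. ball x e)"
      using k(1) by (intro exI[of _ k]) auto
  qed
  then show ?thesis using assms(1) by (simp add: compact_ops_def)
qed

text \<open>A predicate with an explicit bound in place of a supremum, so that finiteness and
  estimate are one statement. \<open>pboundD\<close> carries it from initial segments of the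
  naturals to arbitrary finite index sets.\<close>

definition pbound :: "real \<Rightarrow> real \<Rightarrow> ('a::chilbert_space \<Rightarrow>\<^sub>L 'a) \<Rightarrow> bool" where
  "pbound p K X \<longleftrightarrow> (\<forall>n e f. onf {..<n::nat} e \<longrightarrow> onf {..<n} f \<longrightarrow>
     (\<Sum>i<n. cmod (cinner (X (e i)) (f i)) powr p) \<le> K powr p)"

lemma onf_reindex:
  assumes "onf I e" "inj_on h J" "h ` J \<subseteq> I"
  shows "onf J (e \<circ> h)"
  unfolding onf_def
proof (intro ballI)
  fix i j assume ij: "i \<in> J" "j \<in> J"
  then have "h i \<in> I" "h j \<in> I" using assms(3) by auto
  then show "cinner ((e \<circ> h) i) ((e \<circ> h) j) = (if i = j then 1 else 0)"
    using onfD[OF assms(1)] inj_on_eq_iff[OF assms(2) ij] by simp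
qed

lemma pboundD:
  assumes "pbound p K X" "finite I" "onf I e" "onf I f"
  shows "(\<Sum>i\<in>I. cmod (cinner (blinfun_apply X (e i)) (f i)) powr p) \<le> K powr p"
proof -
  obtain h where h: "bij_betw h {0..<card I} I" using ex_bij_betw_nat_finite[OF assms(2)] by blast
  then have inj: "inj_on h {..<card I}" and img: "h ` {..<card I} = I"
    by (auto simp: bij_betw_def lessThan_atLeast0)
  have "onf {..<card I} (e \<circ> h)" "onf {..<card I} (f \<circ> h)"
    using onf_reindex[OF assms(3) inj eq_refl[OF img]] onf_reindex[OF assms(4) inj eq_refl[OF img]] by blast+
  then have "(\<Sum>i<card I. cmod (cinner (X (e (h i))) (f (h i))) powr p) \<le> K powr p"
    using assms(1) unfolding pbound_def comp_def by blast
  also have "(\<Sum>i<card I. cmod (cinner (X (e (h i))) (f (h i))) powr p)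
      = (\<Sum>i\<in>I. cmod (cinner (X (e i)) (f i)) powr p)"
    using sum.reindex_bij_betw[OF h, of "\<lambda>i. cmod (cinner (X (e i)) (f i)) powr p"]
    by (simp add: lessThan_atLeast0)
  finally show ?thesis .
qed

lemma onf_extend:
  assumes "onf {..<n::nat} e" "\<And>i. i < n \<Longrightarrow> cinner x (e i) = 0" "norm x = 1"
  shows "onf {..<Suc n} (e(n := x))"
proof -
  have "cinner (e i) x = 0" if "i < n" for i
    using assms(2)[OF that] by (metis cinner_commute complex_cnj_zero)
  moreover have "cinner x x = 1" by (simp add: cinner_self assms(3))
  ultimately show ?thesis
    using assms(1,2) unfolding onf_def by (auto simp: less_Suc_eq)
qed

lemma norm_orthonormal_remainder_le:
  "onf I e \<Longrightarrow> finite I \<Longrightarrow> norm (x - (\<Sum>i\<in>I. cinner x (e i) *\<^sub>C e i)) \<le> norm x"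
  using onf_projection_closest[of I e x "\<lambda>_. 0"] by simp

text \<open>A maximal pair of finite orthonormal families with \<open>\<bar>\<langle>X e\<^sub>i, f\<^sub>i\<rangle>\<bar> > \<epsilon>\<close> exists, since
  their length is bounded; off the spans of the two families, \<open>X\<close> has norm at most \<open>\<epsilon>\<close>.\<close>

lemma pbound_approx_finrank:
  fixes X :: "'a::chilbert_space \<Rightarrow>\<^sub>L 'a"
  assumes X: "X \<in> bounded_ops" and bd: "pbound p K X" and p: "p > 0" and \<epsilon>: "\<epsilon> > 0"
  shows "\<exists>F\<in>finrank. norm (X - F) \<le> \<epsilon>"
proof -
  define Q where "Q n \<longleftrightarrow> (\<exists>e f. onf {..<n::nat} e \<and> onf {..<n} f \<and>
    (\<forall>i<n. cmod (cinner (X (e i)) (f i)) > \<epsilon>))" for n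
  \<comment> \<open>Each of the \<open>n\<close> terms exceeds \<open>\<epsilon> powr p\<close>, so
    \<open>pbound\<close> caps their number.\<close>
  have "n \<le> nat \<lfloor>K powr p / \<epsilon> powr p\<rfloor>" if "Q n" for n
  proof -
    obtain e f where ef: "onf {..<n} e" "onf {..<n} f" "\<And>i. i < n \<Longrightarrow> cmod (cinner (X (e i)) (f i)) > \<epsilon>"
      using \<open>Q n\<close> unfolding Q_def by blast
    have "n * \<epsilon> powr p = (\<Sum>i<n. \<epsilon> powr p)" by simp
    also have "\<dots> \<le> (\<Sum>i<n. cmod (cinner (X (e i)) (f i)) powr p)"
      using ef(3) \<epsilon> p by (intro sum_mono powr_mono2) (auto intro: less_imp_le)
    also have "\<dots> \<le> K powr p" using bd ef(1,2) unfolding pbound_def by blast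
    finally show ?thesis using \<epsilon> by (simp add: le_nat_floor field_simps)
  qed
  moreover have "Q 0" by (simp add: Q_def onf_def)
  ultimately obtain n where n: "Q n" "\<And>m. Q m \<Longrightarrow> m \<le> n"
    using GreatestI_nat[of Q 0] Greatest_le_nat[of Q] by metis
  obtain e f where ef: "onf {..<n} e" "onf {..<n} f" "\<And>i. i < n \<Longrightarrow> cmod (cinner (X (e i)) (f i)) > \<epsilon>"
    using n(1) unfolding Q_def by blast
  define P where "P = (\<Sum>i<n. rk (e i) (e i))"
  define R where "R = (\<Sum>i<n. rk (f i) (f i))"
  \<comment> \<open>\<open>F\<close> is chosen so that \<open>X - F\<close> is the compression
    \<open>(1 - R) X (1 - P)\<close>, which only involves vectors orthogonal to the two
    families.\<close>
  define F where "F = (X o\<^sub>L P) + (R o\<^sub>L X) - (R o\<^sub>L (X o\<^sub>L P))"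
  have PR: "P \<in> finrank" "R \<in> finrank" unfolding P_def R_def by (auto intro: finrank_sum rk_finrank)
  have P_apply: "P x = (\<Sum>i<n. cinner x (e i) *\<^sub>C e i)" for x
    by (simp add: P_def blinfun.sum_left rk_apply)
  have R_apply: "R x = (\<Sum>i<n. cinner x (f i) *\<^sub>C f i)" for x
    by (simp add: R_def blinfun.sum_left rk_apply)
  have R_adj: "cinner (R x) y = cinner x (R y)" for x y
    by (auto simp: R_apply cinner_sum_left cinner_sum_right cinner_scaleC_left cinner_scaleC_right
        cinner_commute[of y] intro!: sum.cong)
  have key: "cmod (cinner (X x) y) \<le> \<epsilon> * norm x * norm y"
    if x: "\<And>i. i < n \<Longrightarrow> cinner x (e i) = 0" and y: "\<And>i. i < n \<Longrightarrow> cinner y (f i) = 0" for x y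
  proof (rule ccontr)
    assume gt: "\<not> ?thesis"
    then have 0: "norm x \<noteq> 0" "norm y \<noteq> 0" by (auto simp: not_le)
    define x' where "x' = complex_of_real (1 / norm x) *\<^sub>C x"
    define y' where "y' = complex_of_real (1 / norm y) *\<^sub>C y"
    \<comment> \<open>Normalised, \<open>x\<close> and \<open>y\<close> would prolong the families
      by one, against the maximality of \<open>n\<close>.\<close>
    have "cmod (cinner (X x') y') > \<epsilon>"
      using gt 0 by (simp add: x'_def y'_def bounded_opsD[OF X] cinner_scaleC_left cinner_scaleC_right
          norm_mult norm_divide not_le field_simps)
    moreover have "onf {..<Suc n} (e(n := x'))" "onf {..<Suc n} (f(n := y'))"
      using 0 by (auto intro!: onf_extend ef simp: x'_def y'_def cinner_scaleC_left x y norm_scaleC norm_divide)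
    ultimately have "Q (Suc n)"
      unfolding Q_def using ef(3)
      by (intro exI[of _ "e(n := x')"] exI[of _ "f(n := y')"]) (auto simp: less_Suc_eq)
    then show False using n(2) by force
  qed
  have "norm (X - F) \<le> \<epsilon>"
  proof (rule norm_blinfun_cinner_le)
    fix x y
    have "cinner ((X - F) x) y = cinner (X (x - P x)) (y - R y)"
      by (simp add: F_def blinfun.diff_left blinfun.add_left blinfun.diff_right cinner_diff_left cinner_add_left cinner_diff_right
          R_adj)
    also have "cmod \<dots> \<le> \<epsilon> * norm (x - P x) * norm (y - R y)"
      by (rule key) (simp_all add: cinner_diff_left P_apply R_apply onf_cinner_lincomb[OF ef(1)] onf_cinner_lincomb[OF ef(2)])
    also have "\<dots> \<le> \<epsilon> * norm x * norm y"
      using \<epsilon> unfolding P_apply R_apply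
      by (intro mult_mono norm_orthonormal_remainder_le ef) auto
    finally show "cmod (cinner ((X - F) x) y) \<le> \<epsilon> * norm x * norm y" .
  qed (use \<epsilon> in simp)
  moreover have "F \<in> finrank" unfolding F_def
    by (intro finrank_add finrank_diff finrank_compose_left finrank_compose_right finrank_bounded[OF PR(2)] PR X)
  ultimately show ?thesis by blast
qed

lemma pbound_compact:
  assumes "X \<in> bounded_ops" "pbound p K X" "p > 0"
  shows "X \<in> compact_ops"
  using assms by (intro compact_ops_if_approx) (auto dest: pbound_approx_finrank finrank_compact)

text \<open>The transpose of \<open>X\<close> relative to \<open>C\<close>. Taking adjoints and
  conjugating by \<open>C\<close> are both conjugate-linear in \<open>X\<close>, so the transpose is
  complex-linear in \<open>X\<close> and the skew operators form a complex subspace.\<close>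

definition ctrans :: "('a::chilbert_space \<Rightarrow> 'a) \<Rightarrow> ('a \<Rightarrow>\<^sub>L 'a) \<Rightarrow> ('a \<Rightarrow>\<^sub>L 'a)" where
  "ctrans C X = Blinfun (\<lambda>x. C (cadjoint X (C x)))"

context
  fixes C :: "'a::chilbert_space \<Rightarrow> 'a"
  assumes C: "conjugation C"
begin

lemma conj_add: "C (x + y) = C x + C y" and conj_scale: "C (c *\<^sub>C x) = cnj c *\<^sub>C C x"
  and conj_conj: "C (C x) = x" and cinner_conj: "cinner (C x) (C y) = cinner y x"
  using C by (simp_all add: conjugation_def)

lemma norm_conj: "norm (C x) = norm x"
proof -
  have "complex_of_real ((norm (C x))\<^sup>2) = complex_of_real ((norm x)\<^sup>2)"
    unfolding norm_sq_eq by (simp add: cinner_conj)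
  then have "(norm (C x))\<^sup>2 = (norm x)\<^sup>2" by (simp only: of_real_eq_iff)
  then show ?thesis by simp
qed

lemma cinner_conj_left: "cinner (C x) y = cinner (C y) x"
  using cinner_conj[of x "C y"] by (simp add: conj_conj)

lemma cinner_conj_right: "cinner x (C y) = cinner y (C x)"
  using cinner_conj[of x "C y"] by (metis cinner_conj conj_conj)

lemma bounded_linear_conj: "bounded_linear C"
  by (rule bounded_linear_intro[where K = 1]) (auto simp: conj_add norm_conj scaleR_eq_scaleC conj_scale)

lemma ctrans_apply: "ctrans C X x = C (cadjoint X (C x))"
  unfolding ctrans_def
  by (simp add: bounded_linear_Blinfun_apply bounded_linear_compose[OF bounded_linear_conj]
      bounded_linear_compose[OF blinfun.bounded_linear_right bounded_linear_conj])

lemma cinner_ctrans: "X \<in> bounded_ops \<Longrightarrow> cinner (ctrans C X x) y = cinner (X (C y)) (C x)"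
  by (simp add: ctrans_apply cinner_conj_left cinner_cadjoint_right)

lemma ctrans_bounded: "X \<in> bounded_ops \<Longrightarrow> ctrans C X \<in> bounded_ops"
  by (simp add: bounded_ops_def ctrans_apply conj_scale bounded_opsD[OF cadjoint_bounded])

lemma ctrans_add:
  "X \<in> bounded_ops \<Longrightarrow> Y \<in> bounded_ops \<Longrightarrow> ctrans C (X + Y) = ctrans C X + ctrans C Y"
  by (rule blinfun_cinner_eqI)
     (simp add: cinner_ctrans cvec.subspace_add[OF subspace_bounded_ops] blinfun.add_left cinner_add_left)

lemma ctrans_scale: "X \<in> bounded_ops \<Longrightarrow> ctrans C (c *\<^sub>C X) = c *\<^sub>C ctrans C X"
  by (rule blinfun_cinner_eqI)
     (simp add: cinner_ctrans cvec.subspace_scale[OF subspace_bounded_ops] scaleC_blinfun.rep_eq cinner_scaleC_left)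

lemma ctrans_ctrans: "X \<in> bounded_ops \<Longrightarrow> ctrans C (ctrans C X) = X"
  by (rule blinfun_cinner_eqI) (simp add: cinner_ctrans ctrans_bounded conj_conj)

lemma ctrans_rk: "ctrans C (rk u v) = rk (C v) (C u)"
proof (rule blinfun_cinner_eqI)
  fix x y
  have "cinner (ctrans C (rk u v) x) y = cinner (C y) u * cinner v (C x)"
    by (simp add: cinner_ctrans rk_bounded cinner_rk)
  also have "\<dots> = cinner (C u) y * cinner x (C v)"
    by (simp only: cinner_conj_left[of y] cinner_conj_right[of v])
  finally show "cinner (ctrans C (rk u v) x) y = cinner (rk (C v) (C u) x) y"
    by (simp add: cinner_rk)
qed

lemma norm_ctrans_le: "X \<in> bounded_ops \<Longrightarrow> norm (ctrans C X) \<le> norm X"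
proof (rule norm_blinfun_cinner_le)
  fix x y assume "X \<in> bounded_ops"
  then show "cmod (cinner (ctrans C X x) y) \<le> norm X * norm x * norm y"
    using cmod_cinner_blinfun_le[of X "C y" "C x"] by (simp add: cinner_ctrans norm_conj mult_ac)
qed simp

text \<open>Conjugating both sides of \<open>C X C = - X\<^sup>*\<close> by \<open>C\<close> moves
  the adjoint to the other side and exhibits the skew operators as an eigenspace of the
  transpose.\<close>

lemma skew_ops_eq: "skew_ops C = {X \<in> bounded_ops. ctrans C X = - X}"
proof -
  have neg: "C (- x) = - C x" for x using conj_scale[of "-1" x] by (simp add: scaleC_minus1_left)
  have "(\<forall>x. C (X (C x)) = - cadjoint X x) \<longleftrightarrow> ctrans C X = - X" for X :: "'a \<Rightarrow>\<^sub>L 'a"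
  proof
    assume *: "\<forall>x. C (X (C x)) = - cadjoint X x"
    show "ctrans C X = - X"
    proof (rule blinfun_eqI)
      fix x
      have "- cadjoint X (C x) = C (X x)" using *[rule_format, of "C x"] by (simp add: conj_conj)
      then have "cadjoint X (C x) = - C (X x)" by (metis minus_minus)
      then show "ctrans C X x = (- X) x" by (simp add: ctrans_apply neg conj_conj blinfun.minus_left)
    qed
  next
    assume *: "ctrans C X = - X"
    show "\<forall>x. C (X (C x)) = - cadjoint X x"
    proof
      fix x
      have "C (cadjoint X x) = - X (C x)"
        using arg_cong[OF *, of "\<lambda>Y. Y (C x)"] by (simp add: ctrans_apply conj_conj blinfun.minus_left)
      then have "cadjoint X x = C (- X (C x))" by (metis conj_conj)
      then show "C (X (C x)) = - cadjoint X x" by (simp add: neg)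
    qed
  qed
  then show ?thesis by (auto simp: skew_ops_def)
qed

lemma onf_conj: "onf I e \<Longrightarrow> onf I (\<lambda>i. C (e i))"
  by (auto simp: onf_def cinner_conj)

lemma pbound_ctrans: "X \<in> bounded_ops \<Longrightarrow> pbound p K X \<Longrightarrow> pbound p K (ctrans C X)"
  unfolding pbound_def by (auto simp: cinner_ctrans onf_conj)

end

section \<open>Singular systems of compact operators\<close>

text \<open>Vectors \<open>w n\<close> in the unit ball of \<open>M\<close> whose images approach
  the supremum \<open>m\<close> of \<open>norm (X x)\<close> almost satisfy the eigenvalue equation
  for \<open>m\<^sup>2\<close>. Compactness makes \<open>X (w n)\<close> converge along a
  subsequence, hence also \<open>A (w n)\<close>, and since \<open>m > 0\<close> the approximate
  equation forces the vectors \<open>w n\<close> themselves to converge.\<close>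

lemma norm_attaining_eigenvector:
  fixes X :: "'a::chilbert_space \<Rightarrow>\<^sub>L 'a"
  assumes X: "X \<in> compact_ops" and M: "cvec.subspace M" "closed M"
    and inv: "\<And>x. x \<in> M \<Longrightarrow> cadjoint X (X x) \<in> M" and ne: "\<exists>x\<in>M. X x \<noteq> 0"
  shows "\<exists>x\<in>M. norm x = 1 \<and> X x \<noteq> 0 \<and> cadjoint X (X x) = complex_of_real ((norm (X x))\<^sup>2) *\<^sub>C x"
proof -
  note Xb = compact_ops_bounded[OF X]
  define S where "S = (\<lambda>x. norm (X x)) ` {x \<in> M. norm x \<le> 1}"
  define m where "m = Sup S"
  have bdd: "bdd_above S"
  proof (rule bdd_aboveI)
    fix s assume "s \<in> S"
    then obtain x where x: "s = norm (X x)" "norm x \<le> 1" by (auto simp: S_def)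
    show "s \<le> norm X"
      using norm_blinfun[of X x] mult_left_mono[OF x(2) norm_ge_zero[of X]] x(1) by simp
  qed
  have S_le: "norm (X x) \<le> m" if "x \<in> M" "norm x \<le> 1" for x
    unfolding m_def using bdd that by (intro cSup_upper) (auto simp: S_def)
  have le_m: "norm (X x) \<le> m * norm x" if x: "x \<in> M" for x
  proof (cases "x = 0")
    case False
    have "norm (X (complex_of_real (1 / norm x) *\<^sub>C x)) \<le> m"
      using False by (intro S_le cvec.subspace_scale M(1) x) (simp add: norm_scaleC norm_divide)
    then show ?thesis using False
      by (simp add: bounded_opsD[OF Xb] norm_scaleC norm_divide field_simps)
  qed simp
  obtain x0 where x0: "x0 \<in> M" "X x0 \<noteq> 0" using ne by blast
  have m_pos: "m > 0"
  proof (rule ccontr)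
    assume "\<not> m > 0"
    then have "m * norm x0 \<le> 0" by (intro mult_nonpos_nonneg) auto
    then have "norm (X x0) \<le> 0" using le_m[OF x0(1)] by linarith
    then show False using x0(2) by simp
  qed
  have "\<exists>x\<in>M. norm x \<le> 1 \<and> m - 1 / real (Suc n) < norm (X x)" for n
  proof -
    have "S \<noteq> {}" using cvec.subspace_0[OF M(1)] by (auto simp: S_def)
    moreover have "m - 1 / real (Suc n) < Sup S" unfolding m_def by simp
    ultimately show ?thesis using less_cSupD[of S] by (auto simp: S_def)
  qed
  then obtain z where z: "\<And>n. z n \<in> M" "\<And>n. norm (z n) \<le> 1" "\<And>n::nat. m - 1 / real (Suc n) < norm (X (z n))"
    by metis
  obtain K where K: "compact K" "blinfun_apply X ` cball 0 1 \<subseteq> K" using X compact_ops_iff by blast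
  have "\<forall>n. X (z n) \<in> K" using K(2) z(2) by auto
  then obtain y r where r: "strict_mono r" "((\<lambda>n. X (z n)) \<circ> r) \<longlonglongrightarrow> y"
    using K(1) unfolding compact_def by metis
  define w where "w = z \<circ> r"
  have w: "w n \<in> M" "norm (w n) \<le> 1" for n using z by (simp_all add: w_def)
  have lim_y: "(\<lambda>n. X (w n)) \<longlonglongrightarrow> y" using r(2) by (simp add: w_def o_def)
  have lim_m: "(\<lambda>n. norm (X (w n))) \<longlonglongrightarrow> m"
  proof (rule tendsto_sandwich)
    show "\<forall>\<^sub>F n in sequentially. m - 1 / real (Suc n) \<le> norm (X (w n))"
    proof (intro always_eventually allI)
      fix n
      have "m - 1 / real (Suc n) \<le> m - 1 / real (Suc (r n))"
        using seq_suble[OF r(1), of n] by (simp add: frac_le)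
      then show "m - 1 / real (Suc n) \<le> norm (X (w n))" using z(3)[of "r n"] by (simp add: w_def)
    qed
    show "\<forall>\<^sub>F n in sequentially. norm (X (w n)) \<le> m" using S_le w by simp
    show "(\<lambda>n. m - 1 / real (Suc n)) \<longlonglongrightarrow> m"
      using tendsto_diff[OF tendsto_const[of m] LIMSEQ_inverse_real_of_nat] by (simp add: inverse_eq_divide)
  qed simp
  have ny: "norm y = m" using LIMSEQ_unique[OF tendsto_norm[OF lim_y] lim_m] .
  define A where "A x = cadjoint X (X x)" for x
  \<comment> \<open>Invariance of \<open>M\<close> enters here: the bound \<open>m\<close> is
    applied to \<open>A (w n)\<close>, which lies in \<open>M\<close>.\<close>
  have A_le: "norm (A (w n)) \<le> m * norm (X (w n))" for n
  proof -
    have "norm (A (w n)) * norm (A (w n)) = cmod (cinner (X (A (w n))) (X (w n)))"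
      by (simp add: A_def cinner_cadjoint_right[OF Xb, symmetric] cinner_self power2_eq_square norm_mult)
    also have "\<dots> \<le> norm (X (A (w n))) * norm (X (w n))" by (rule Cauchy_Schwarz)
    also have "\<dots> \<le> (m * norm (A (w n))) * norm (X (w n))"
      using inv[OF w(1)] by (intro mult_right_mono le_m) (auto simp: A_def)
    finally show ?thesis
      using m_pos by (cases "norm (A (w n)) = 0") (auto simp: mult_ac)
  qed
  \<comment> \<open>Expanding the square gives at most
    \<open>m\<^sup>2 |X w|\<^sup>2 + m^4 - 2 m\<^sup>2 |X w|\<^sup>2\<close>, which is
    \<open>g n\<close>.\<close>
  define g where "g n = m ^ 4 - m\<^sup>2 * (norm (X (w n)))\<^sup>2" for n
  have le_g: "(norm (A (w n) - complex_of_real (m\<^sup>2) *\<^sub>C w n))\<^sup>2 \<le> g n" for n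
  proof -
    have "cinner (A (w n)) (w n) = complex_of_real ((norm (X (w n)))\<^sup>2)"
      unfolding A_def by (simp add: cinner_cadjoint_left[OF Xb] cinner_self)
    then have "Re (cinner (A (w n)) (complex_of_real (m\<^sup>2) *\<^sub>C w n)) = m\<^sup>2 * (norm (X (w n)))\<^sup>2"
      unfolding cinner_scaleC_right by (simp flip: of_real_mult of_real_power)
    moreover have "(norm (A (w n)))\<^sup>2 \<le> (m * norm (X (w n)))\<^sup>2" using A_le by (simp add: power_mono)
    moreover have "(norm (complex_of_real (m\<^sup>2) *\<^sub>C w n))\<^sup>2 \<le> (m\<^sup>2)\<^sup>2"
      using w(2)[of n] by (intro power_mono) (simp_all add: norm_scaleC norm_power mult_left_le)
    ultimately show ?thesis
      unfolding norm_diff_sq g_def by (simp add: power_mult_distrib)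
  qed
  have "g \<longlonglongrightarrow> 0"
  proof -
    have "g \<longlonglongrightarrow> m ^ 4 - m\<^sup>2 * m\<^sup>2" unfolding g_def by (intro tendsto_intros lim_m)
    then show ?thesis by (simp add: power4_eq_xxxx power2_eq_square mult.assoc)
  qed
  from tendsto_sandwich[OF _ _ tendsto_const[of 0] this, of "\<lambda>n. (norm (A (w n) - complex_of_real (m\<^sup>2) *\<^sub>C w n))\<^sup>2"]
  have "(\<lambda>n. (norm (A (w n) - complex_of_real (m\<^sup>2) *\<^sub>C w n))\<^sup>2) \<longlonglongrightarrow> 0"
    using le_g by simp
  from tendsto_real_sqrt[OF this]
  have diff0: "(\<lambda>n. A (w n) - complex_of_real (m\<^sup>2) *\<^sub>C w n) \<longlonglongrightarrow> 0"
    by (simp only: real_sqrt_zero real_sqrt_abs abs_norm_cancel tendsto_norm_zero_iff)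
  have "(\<lambda>n. A (w n)) \<longlonglongrightarrow> cadjoint X y" unfolding A_def by (intro tendsto_intros lim_y)
  from tendsto_diff[OF this diff0]
  have "(\<lambda>n. complex_of_real (m\<^sup>2) *\<^sub>C w n) \<longlonglongrightarrow> cadjoint X y" by simp
  from bounded_linear.tendsto[OF bounded_linear_scaleC this, of "complex_of_real (1 / m\<^sup>2)"]
  have lim_w: "w \<longlonglongrightarrow> complex_of_real (1 / m\<^sup>2) *\<^sub>C cadjoint X y" (is "_ \<longlonglongrightarrow> ?x")
    using m_pos by (simp add: scaleC_scaleC)
  have xM: "?x \<in> M" using closed_sequentially[OF M(2) _ lim_w] w(1) by blast
  have "(\<lambda>n. X (w n)) \<longlonglongrightarrow> X ?x" by (intro tendsto_intros lim_w)
  then have Xx: "X ?x = y" using lim_y LIMSEQ_unique by blast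
  \<comment> \<open>The limit has norm at most 1 as a limit, and at least 1 because
    \<open>m = norm (X ?x) \<le> m * norm ?x\<close>.\<close>
  have "norm ?x \<le> 1" by (rule LIMSEQ_le_const2[OF tendsto_norm[OF lim_w]]) (use w(2) in auto)
  moreover have "m \<le> m * norm ?x" using le_m[OF xM] unfolding Xx ny .
  ultimately have "norm ?x = 1" using m_pos by simp
  moreover have "cadjoint X (X ?x) = complex_of_real ((norm (X ?x))\<^sup>2) *\<^sub>C ?x"
    unfolding Xx ny using m_pos by (simp add: scaleC_scaleC)
  moreover have "X ?x \<noteq> 0" unfolding Xx using ny m_pos by auto
  ultimately show ?thesis using xM by blast
qed

text \<open>Right singular vectors for the nonzero singular values. The value belonging to
  \<open>e\<close> is \<open>norm (X e)\<close>, multiplicity is counted by distinct vectors, and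
  the last clause says that \<open>E\<close> exhausts the orthogonal complement of the
  kernel.\<close>

definition singular_system :: "('a::chilbert_space \<Rightarrow>\<^sub>L 'a) \<Rightarrow> 'a set \<Rightarrow> bool" where
  "singular_system X E \<longleftrightarrow> onf E (\<lambda>e. e) \<and>
     (\<forall>e\<in>E. X e \<noteq> 0 \<and> cadjoint X (X e) = complex_of_real ((norm (X e))\<^sup>2) *\<^sub>C e) \<and>
     (\<forall>x. (\<forall>e\<in>E. cinner x e = 0) \<longrightarrow> X x = 0)"

text \<open>A maximal orthonormal set of eigenvectors works: its orthogonal complement is invariant
  under \<open>X\<^sup>*X\<close>, so if \<open>X\<close> did not vanish there, the complement would
  contain a further eigenvector.\<close>

lemma singular_system_exists:
  fixes X :: "'a::chilbert_space \<Rightarrow>\<^sub>L 'a"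
  assumes X: "X \<in> compact_ops"
  shows "\<exists>E. singular_system X E"
proof -
  note Xb = compact_ops_bounded[OF X]
  define V where "V = {x. X x \<noteq> 0 \<and> cadjoint X (X x) = complex_of_real ((norm (X x))\<^sup>2) *\<^sub>C x}"
  obtain E where E: "E \<subseteq> V" "onf E (\<lambda>e. e)"
    and max: "\<And>x. x \<in> V \<Longrightarrow> norm x = 1 \<Longrightarrow> \<exists>e\<in>E. cinner x e \<noteq> 0"
    using maximal_onf_exists[of V] by blast
  define M where "M = {x. \<forall>e\<in>E. cinner x e = 0}"
  have M: "cvec.subspace M"
    by (auto simp: M_def cvec.subspace_def cinner_add_left cinner_scaleC_left)
  have "M = (\<Inter>e\<in>E. {x. cinner x e = 0})" by (auto simp: M_def)
  then have "closed M"
    by (auto intro!: closed_INT closed_Collect_eq linear_continuous_on bounded_linear_cinner_left)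
  have inv: "cadjoint X (X x) \<in> M" if x: "x \<in> M" for x
    unfolding M_def mem_Collect_eq
  proof
    fix e assume e: "e \<in> E"
    have "cinner (cadjoint X (X x)) e = cinner x (cadjoint X (X e))"
      by (simp add: cinner_cadjoint_left[OF Xb] cinner_cadjoint_right[OF Xb])
    also have "\<dots> = cinner x (complex_of_real ((norm (X e))\<^sup>2) *\<^sub>C e)"
      using subsetD[OF E(1) e] by (simp add: V_def)
    also have "\<dots> = 0" using x e by (simp add: cinner_scaleC_right M_def)
    finally show "cinner (cadjoint X (X x)) e = 0" .
  qed
  have "X x = 0" if "x \<in> M" for x
  proof (rule ccontr)
    assume "X x \<noteq> 0"
    with that have "\<exists>x\<in>M. X x \<noteq> 0" by blast
    from norm_attaining_eigenvector[OF X M \<open>closed M\<close> inv this]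
    obtain x where x: "x \<in> M" "norm x = 1" "x \<in> V" unfolding V_def by auto
    from max[OF x(3,2)] x(1) show False by (auto simp: M_def)
  qed
  then show ?thesis
    using E unfolding singular_system_def M_def V_def by (intro exI[of _ E]) auto
qed

context
  fixes X :: "'a::chilbert_space \<Rightarrow>\<^sub>L 'a" and E
  assumes X: "X \<in> compact_ops" and E: "singular_system X E"
begin

lemma singular_onf: "onf E (\<lambda>e. e)"
  using E by (simp add: singular_system_def)

lemma singular_nonzero: "e \<in> E \<Longrightarrow> X e \<noteq> 0"
  using E by (simp add: singular_system_def)

lemma singular_eigen: "e \<in> E \<Longrightarrow> cadjoint X (X e) = complex_of_real ((norm (X e))\<^sup>2) *\<^sub>C e"
  using E by (simp add: singular_system_def)

lemma singular_kernel: "(\<And>e. e \<in> E \<Longrightarrow> cinner x e = 0) \<Longrightarrow> X x = 0"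
  using E by (simp add: singular_system_def)

text \<open>The singular value decomposition in weak form. The part of \<open>x\<close> off the
  closed span of \<open>E\<close> lies in the kernel of \<open>X\<close>.\<close>

lemma singular_expansion: "((\<lambda>e. cinner x e * cinner (X e) y) has_sum cinner (X x) y) E"
proof -
  obtain p where p: "((\<lambda>e. cinner x e *\<^sub>C e) has_sum p) E" "\<And>e. e \<in> E \<Longrightarrow> cinner (x - p) e = 0"
    using orthonormal_decomposition[OF singular_onf] by blast
  have "X (x - p) = 0" by (rule singular_kernel) (rule p(2))
  then have Xp: "X p = X x" by (simp add: blinfun.diff_right)
  have "((\<lambda>e. X (cinner x e *\<^sub>C e)) has_sum X x) E"
    using has_sum_bounded_linear[OF blinfun.bounded_linear_right p(1), of X] by (simp add: Xp o_def)
  from cinner_has_sum_left[OF this, of y] show ?thesis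
    by (simp add: bounded_opsD[OF compact_ops_bounded[OF X]] cinner_scaleC_left)
qed

lemma singular_orthogonal:
  "e \<in> E \<Longrightarrow> f \<in> E \<Longrightarrow> cinner (X e) (X f) = (if e = f then complex_of_real ((norm (X e))\<^sup>2) else 0)"
  using onfD[OF singular_onf, of e f] singular_eigen[of e]
  by (simp add: cinner_cadjoint_left[OF compact_ops_bounded[OF X], symmetric] cinner_scaleC_left)

lemma singular_onf_image: "onf E (\<lambda>e. complex_of_real (1 / norm (X e)) *\<^sub>C X e)"
  unfolding onf_def
proof (intro ballI)
  fix e f assume "e \<in> E" "f \<in> E"
  then show "cinner (complex_of_real (1 / norm (X e)) *\<^sub>C X e) (complex_of_real (1 / norm (X f)) *\<^sub>C X f)
      = (if e = f then 1 else 0)"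
    using singular_nonzero[of e] singular_nonzero[of f]
    by (simp add: cinner_scaleC_left cinner_scaleC_right singular_orthogonal power2_eq_square)
qed

text \<open>Distinct images \<open>X e\<close> and \<open>X f\<close> are orthogonal, hence at
  distance at least \<open>\<epsilon>\<close>, so no ball of radius \<open>\<epsilon>/2\<close> in a
  finite cover of the image of the unit ball holds two of them.\<close>

lemma finite_large_singular:
  assumes "\<epsilon> > 0" shows "finite {e \<in> E. norm (X e) \<ge> \<epsilon>}"
proof -
  have "compact (closure (blinfun_apply X ` cball 0 1))" using X by (simp add: compact_ops_def)
  then obtain k where k: "finite k" "blinfun_apply X ` cball 0 1 \<subseteq> (\<Union>x\<in>k. ball x (\<epsilon>/2))"
    unfolding compact_closure_iff_totally_bounded using assms half_gt_zero by blast
  have "\<exists>x\<in>k. dist x (X e) < \<epsilon>/2" if "e \<in> E" for e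
    using k(2) onf_norm[OF singular_onf that] by (auto simp: image_subset_iff)
  then obtain h where h: "\<And>e. e \<in> E \<Longrightarrow> h e \<in> k \<and> dist (h e) (X e) < \<epsilon>/2" by metis
  have "inj_on h {e \<in> E. norm (X e) \<ge> \<epsilon>}"
  proof (rule inj_onI, rule ccontr)
    fix e f assume ef: "e \<in> {e \<in> E. norm (X e) \<ge> \<epsilon>}" "f \<in> {e \<in> E. norm (X e) \<ge> \<epsilon>}" "h e = h f" "e \<noteq> f"
    then have "dist (X e) (X f) < \<epsilon>" using h[of e] h[of f] dist_triangle[of "X e" "X f" "h e"]
      by (simp add: dist_commute)
    then have "(norm (X e - X f))\<^sup>2 < \<epsilon>\<^sup>2" by (simp add: dist_norm power_strict_mono)
    moreover have "(norm (X e - X f))\<^sup>2 = (norm (X e))\<^sup>2 + (norm (X f))\<^sup>2"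
      using ef by (simp add: norm_diff_sq singular_orthogonal)
    moreover have "(norm (X e))\<^sup>2 \<ge> \<epsilon>\<^sup>2" using ef(1) assms by (simp add: power_mono)
    ultimately show False using zero_le_power2[of "norm (X f)"] by linarith
  qed
  moreover have "h ` {e \<in> E. norm (X e) \<ge> \<epsilon>} \<subseteq> k" using h by blast
  ultimately show ?thesis using k(1) by (rule inj_on_finite)
qed

text \<open>The eigenspace for \<open>s\<^sup>2\<close> is spanned by the members of
  \<open>E\<close> with \<open>norm (X e) = s\<close>. What remains of an eigenvector off this span
  is orthogonal to all of \<open>E\<close>, so \<open>X\<close> kills it, and as
  \<open>s > 0\<close> the eigenvalue equation makes it zero.\<close>

lemma sing_mult_eq_card:
  assumes s: "s > 0"
  shows "sing_mult X s = card {e \<in> E. norm (X e) = s}" and "finite {e \<in> E. norm (X e) = s}"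
proof -
  note Xb = compact_ops_bounded[OF X]
  define V where "V = {x. cadjoint X (X x) = complex_of_real (s\<^sup>2) *\<^sub>C x}"
  define G where "G = {e \<in> E. norm (X e) = s}"
  show fin: "finite {e \<in> E. norm (X e) = s}"
    by (rule finite_subset[OF _ finite_large_singular[OF s]]) auto
  have GE: "G \<subseteq> E" by (auto simp: G_def)
  note onG = onf_subset[OF singular_onf GE]
  have V: "cvec.subspace V"
    using bounded_opsD[OF Xb] bounded_opsD[OF cadjoint_bounded[OF Xb]]
    by (auto simp: cvec.subspace_def V_def blinfun.add_right scaleC_add_right scaleC_scaleC mult.commute)
  have "G \<subseteq> V" using singular_eigen by (auto simp: G_def V_def)
  have "V \<subseteq> cvec.span G"
  proof
    fix x assume x: "x \<in> V"
    define r where "r = x - (\<Sum>e\<in>G. cinner x e *\<^sub>C e)"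
    have "(\<Sum>e\<in>G. cinner x e *\<^sub>C e) \<in> V"
      using \<open>G \<subseteq> V\<close> V by (intro cvec.subspace_sum cvec.subspace_scale) auto
    then have rV: "r \<in> V" unfolding r_def by (intro cvec.subspace_diff V x)
    have "cinner r e = 0" if e: "e \<in> E" for e
    proof (cases "e \<in> G")
      case True
      then show ?thesis using fin by (simp add: r_def cinner_diff_left onf_cinner_lincomb[OF onG] G_def[symmetric])
    next
      case False
      \<comment> \<open>Eigenvectors of the self-adjoint \<open>X\<^sup>*X\<close> for the distinct
        eigenvalues \<open>s\<^sup>2\<close> and \<open>(norm (X e))\<^sup>2\<close> are
        orthogonal.\<close>
      have "complex_of_real (s\<^sup>2) * cinner r e = cinner (cadjoint X (X r)) e"
        using rV by (simp add: V_def cinner_scaleC_left)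
      also have "\<dots> = cinner r (cadjoint X (X e))"
        by (simp add: cinner_cadjoint_left[OF Xb] cinner_cadjoint_right[OF Xb])
      also have "\<dots> = complex_of_real ((norm (X e))\<^sup>2) * cinner r e"
        by (simp add: singular_eigen[OF e] cinner_scaleC_right)
      finally have "complex_of_real (s\<^sup>2 - (norm (X e))\<^sup>2) * cinner r e = 0"
        by (simp add: left_diff_distrib)
      moreover have "s\<^sup>2 \<noteq> (norm (X e))\<^sup>2"
        using False e s by (auto simp: G_def)
      ultimately show ?thesis by (simp flip: of_real_power)
    qed
    then have "X r = 0" by (rule singular_kernel)
    then have "r = 0" using rV s by (simp add: V_def cvec.scale_eq_0_iff)
    then have "x = (\<Sum>e\<in>G. cinner x e *\<^sub>C e)" by (simp add: r_def)
    also have "\<dots> \<in> cvec.span G" by (intro cvec.span_sum cvec.span_scale cvec.span_base)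
    finally show "x \<in> cvec.span G" .
  qed
  then have span: "cvec.span G = cvec.span V"
    using \<open>G \<subseteq> V\<close> by (metis antisym cvec.span_mono cvec.span_span)
  have "cvec.independent G"
  proof (rule cvec.independent_if_scalars_zero)
    show "finite G" using fin by (simp add: G_def)
    fix c x assume "(\<Sum>x\<in>G. c x *\<^sub>C x) = 0" "x \<in> G"
    then show "c x = 0" using onf_cinner_lincomb[OF onG \<open>finite G\<close>, of x c] by simp
  qed
  then have "cvec.dim V = card G" using cvec.dim_eq_card[OF span] by simp
  then show "sing_mult X s = card {e \<in> E. norm (X e) = s}" by (simp add: sing_mult_def V_def G_def)
qed

text \<open>Grouping \<open>E\<close> by the value of \<open>norm (X e)\<close> turns the sum over
  singular vectors into the sum over \<open>s\<close> weighted by multiplicity. In the direction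
  from groups to vectors, convergence of the double family rests on the terms being
  nonnegative.\<close>

lemma schatten_singular:
  "((\<lambda>s. real (sing_mult X s) * s powr p) has_sum S) {0<..} \<longleftrightarrow> ((\<lambda>e. norm (X e) powr p) has_sum S) E"
proof -
  define B where "B s = {e \<in> E. norm (X e) = s}" for s
  have re: "((\<lambda>e. norm (X e) powr p) has_sum T) E
      \<longleftrightarrow> ((\<lambda>z. fst z powr p) has_sum T) (Sigma {0<..} B)" for T
    by (rule has_sum_reindex_bij_witness[of _ snd "\<lambda>e. (norm (X e), e)"])
       (auto simp: B_def singular_nonzero)
  have inner: "((\<lambda>e. fst (s, e) powr p) has_sum real (sing_mult X s) * s powr p) (B s)"
    if "s \<in> {0<..}" for s
    using has_sum_finite[OF sing_mult_eq_card(2)[of s], of "\<lambda>_. s powr p"] that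
    by (simp add: B_def sing_mult_eq_card(1)[of s])
  show ?thesis
  proof
    assume "((\<lambda>e. norm (X e) powr p) has_sum S) E"
    then show "((\<lambda>s. real (sing_mult X s) * s powr p) has_sum S) {0<..}"
      unfolding re using has_sum_SigmaD[OF _ inner] by blast
  next
    assume *: "((\<lambda>s. real (sing_mult X s) * s powr p) has_sum S) {0<..}"
    have "(\<lambda>z. fst z powr p) summable_on (Sigma {0<..} B)"
      by (rule summable_on_SigmaI[OF inner]) (use * in \<open>auto simp: summable_on_def\<close>)
    then obtain T where T: "((\<lambda>z. fst z powr p) has_sum T) (Sigma {0<..} B)"
      by (auto simp: summable_on_def)
    have "((\<lambda>s. real (sing_mult X s) * s powr p) has_sum T) {0<..}"
      by (rule has_sum_SigmaD[OF T inner])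
    then have "T = S" using * has_sum_unique by blast
    then show "((\<lambda>e. norm (X e) powr p) has_sum S) E" using T re by simp
  qed
qed

lemma schatten_class_singular: "X \<in> schatten_class p \<longleftrightarrow> (\<lambda>e. norm (X e) powr p) summable_on E"
proof -
  have "(\<lambda>s. real (sing_mult X s) * s powr p) summable_on {0<..} \<longleftrightarrow> (\<lambda>e. norm (X e) powr p) summable_on E"
    unfolding summable_on_def by (rule iff_exI) (rule schatten_singular)
  then show ?thesis using X by (simp add: schatten_class_def)
qed

lemma schatten_norm_singular:
  assumes "X \<in> schatten_class p"
  shows "schatten_norm p X = (\<Sum>\<^sub>\<infinity>e\<in>E. norm (X e) powr p) powr (1 / p)"
proof -
  have "((\<lambda>e. norm (X e) powr p) has_sum (\<Sum>\<^sub>\<infinity>e\<in>E. norm (X e) powr p)) E"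
    using assms unfolding schatten_class_singular by (rule has_sum_infsum)
  then show ?thesis unfolding schatten_norm_def schatten_singular[symmetric] by (simp only: infsumI)
qed

end

section \<open>Schatten classes\<close>

text \<open>A convex function lies above its tangent at \<open>m\<close>. This is Young's inequality
  for \<open>t\<close> and \<open>m powr (p - 1)\<close> with the exponents \<open>p\<close> and
  \<open>p / (p - 1)\<close>.\<close>

lemma powr_tangent_le:
  fixes p t m :: real
  assumes "p \<ge> 1" "t \<ge> 0" "m > 0"
  shows "m powr p + p * m powr (p - 1) * (t - m) \<le> t powr p"
proof (cases "p = 1")
  case False
  then have p: "p > 1" using assms by simp
  define q where "q = p / (p - 1)"
  have q: "q > 1" "1/p + 1/q = 1" using p by (auto simp: q_def field_simps)
  have pq: "(p - 1) * q = p" using p by (simp add: q_def)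
  have "t * m powr (p - 1) \<le> t powr p / p + (m powr (p - 1)) powr q / q"
    using assms by (intro Youngs_inequality p q) auto
  also have "(m powr (p - 1)) powr q = m powr p" by (simp add: powr_powr pq)
  also have "m powr p / q = m powr p * (p - 1) / p" by (simp add: q_def)
  finally have "p * (t * m powr (p - 1)) \<le> p * (t powr p / p + m powr p * (p - 1) / p)"
    using p by (intro mult_left_mono) auto
  also have "\<dots> = t powr p + m powr p * (p - 1)" using p by (simp add: field_simps)
  finally have "p * (t * m powr (p - 1)) \<le> t powr p + m powr p * (p - 1)" .
  moreover have "m powr (p - 1) * m = m powr p"
    using assms(3) powr_add[of m "p - 1" 1] by simp
  moreover have "p * m powr (p - 1) * (t - m) = p * (t * m powr (p - 1)) - p * (m powr (p - 1) * m)"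
    by (simp add: algebra_simps)
  ultimately show ?thesis by (simp add: algebra_simps)
qed (use assms in simp)

text \<open>Jensen's inequality for weights of total at most 1: the tangent inequality at the
  weighted sum \<open>m\<close>, summed with the weights.\<close>

lemma powr_weighted_sum_le:
  fixes p :: real and a t :: "'i \<Rightarrow> real"
  assumes p: "p \<ge> 1" and fin: "finite G" and a: "\<And>j. j \<in> G \<Longrightarrow> a j \<ge> 0" "(\<Sum>j\<in>G. a j) \<le> 1"
    and t: "\<And>j. j \<in> G \<Longrightarrow> t j \<ge> 0"
  shows "(\<Sum>j\<in>G. a j * t j) powr p \<le> (\<Sum>j\<in>G. a j * t j powr p)"
proof -
  define m where "m = (\<Sum>j\<in>G. a j * t j)"
  have nn: "(\<Sum>j\<in>G. a j * t j powr p) \<ge> 0" by (intro sum_nonneg mult_nonneg_nonneg a) auto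
  show ?thesis
  proof (cases "m = 0")
    case True
    then show ?thesis using nn p by (simp add: m_def)
  next
    case False
    moreover have "m \<ge> 0" unfolding m_def by (intro sum_nonneg mult_nonneg_nonneg a t)
    ultimately have m: "m > 0" by simp
    define s where "s = (\<Sum>j\<in>G. a j)"
    \<comment> \<open>The missing weight \<open>1 - s\<close> only helps, since
      \<open>p \<ge> 1\<close> makes the added term nonnegative; with it the expression becomes the
      weighted sum of tangents.\<close>
    have "m powr p \<le> m powr p + m powr p * ((p - 1) * (1 - s))"
      using p a(2) by (simp add: s_def)
    also have "\<dots> = s * m powr p + p * m powr (p - 1) * (m - s * m)"
      using m powr_add[of m "p - 1" 1] by (simp add: algebra_simps)
    also have "\<dots> = (\<Sum>j\<in>G. a j * (m powr p + p * m powr (p - 1) * (t j - m)))"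
    proof -
      define c where "c = p * m powr (p - 1)"
      have "(\<Sum>j\<in>G. a j * (m powr p + c * (t j - m)))
          = (\<Sum>j\<in>G. a j * (m powr p - c * m) + c * (a j * t j))"
        by (intro sum.cong refl) (simp add: algebra_simps)
      also have "\<dots> = s * (m powr p - c * m) + c * m"
        by (simp add: sum.distrib s_def m_def sum_distrib_right sum_distrib_left)
      finally show ?thesis by (simp add: c_def algebra_simps)
    qed
    also have "\<dots> \<le> (\<Sum>j\<in>G. a j * t j powr p)"
      by (intro sum_mono mult_left_mono powr_tangent_le p t m a)
    finally show ?thesis by (simp add: m_def)
  qed
qed

text \<open>The bounds \<open>A\<close> and \<open>B\<close> stand in for the exact norms, since
  these are only known as estimates. If one of them is 0, all terms vanish; otherwise Young's
  inequality applies to \<open>b i / B\<close> and \<open>a i / A\<close>.\<close>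

lemma Hoelder_sum:
  fixes p q :: real and a b :: "'i \<Rightarrow> real"
  assumes pq: "p > 1" "q > 1" "1/p + 1/q = 1" and fin: "finite I"
    and a: "\<And>i. i \<in> I \<Longrightarrow> a i \<ge> 0" and b: "\<And>i. i \<in> I \<Longrightarrow> b i \<ge> 0"
    and A: "(\<Sum>i\<in>I. a i powr q) \<le> A powr q" "A \<ge> 0" and B: "(\<Sum>i\<in>I. b i powr p) \<le> B powr p" "B \<ge> 0"
  shows "(\<Sum>i\<in>I. a i * b i) \<le> A * B"
proof (cases "A = 0 \<or> B = 0")
  case True
  have "a i = 0" if "i \<in> I" "A = 0" for i
  proof -
    have "(\<Sum>i\<in>I. a i powr q) = 0" using A pq that by (simp add: antisym sum_nonneg)
    then show ?thesis using that fin by (simp add: sum_nonneg_eq_0_iff)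
  qed
  moreover have "b i = 0" if "i \<in> I" "B = 0" for i
  proof -
    have "(\<Sum>i\<in>I. b i powr p) = 0" using B pq that by (simp add: antisym sum_nonneg)
    then show ?thesis using that fin by (simp add: sum_nonneg_eq_0_iff)
  qed
  ultimately have "(\<Sum>i\<in>I. a i * b i) = 0" using True by (intro sum.neutral) auto
  then show ?thesis using A B by simp
next
  case False
  then have AB: "A > 0" "B > 0" using A B by auto
  have "(\<Sum>i\<in>I. (b i / B) * (a i / A)) \<le> (\<Sum>i\<in>I. (b i / B) powr p / p + (a i / A) powr q / q)"
    using AB a b by (intro sum_mono Youngs_inequality pq) auto
  also have "\<dots> = (\<Sum>i\<in>I. b i powr p) / B powr p / p + (\<Sum>i\<in>I. a i powr q) / A powr q / q"
    using a b AB by (simp add: sum.distrib powr_divide sum_divide_distrib)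
  also have "\<dots> \<le> 1 / p + 1 / q"
    using A B AB pq by (intro add_mono divide_right_mono) (auto simp: divide_le_eq_1)
  finally have "(\<Sum>i\<in>I. a i * b i) / (A * B) \<le> 1"
    using pq by (simp add: sum_divide_distrib mult.commute)
  then show ?thesis using AB by (simp add: divide_le_eq)
qed

text \<open>The image of a finite orthonormal family under a contraction is of this kind. The
  diagonal contraction that carries the phases in the trace estimate produces such families, which
  need not be orthonormal.\<close>

definition bessel :: "'i set \<Rightarrow> ('i \<Rightarrow> 'a::chilbert_space) \<Rightarrow> bool" where
  "bessel I x \<longleftrightarrow> (\<forall>i\<in>I. norm (x i) \<le> 1) \<and> (\<forall>z. (\<Sum>i\<in>I. (cmod (cinner z (x i)))\<^sup>2) \<le> (norm z)\<^sup>2)"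

lemma onf_bessel: "onf I e \<Longrightarrow> finite I \<Longrightarrow> bessel I e"
  by (simp add: bessel_def Bessel onf_norm)

lemma cmod_cinner_commute: "cmod (cinner x y) = cmod (cinner y (x::'a::chilbert_space))"
  by (metis cinner_commute complex_mod_cnj)

lemma sum_mult_le_1:
  fixes a b :: "'i \<Rightarrow> real"
  assumes "(\<Sum>i\<in>I. (a i)\<^sup>2) \<le> 1" "(\<Sum>i\<in>I. (b i)\<^sup>2) \<le> 1"
  shows "(\<Sum>i\<in>I. a i * b i) \<le> 1"
proof -
  have "(\<Sum>i\<in>I. a i * b i) \<le> (\<Sum>i\<in>I. ((a i)\<^sup>2 + (b i)\<^sup>2) / 2)"
    using sum_squares_bound[of "a _" "b _"] by (intro sum_mono) (simp add: field_simps)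
  also have "\<dots> = ((\<Sum>i\<in>I. (a i)\<^sup>2) + (\<Sum>i\<in>I. (b i)\<^sup>2)) / 2"
    by (simp add: sum.distrib sum_divide_distrib add_divide_distrib)
  finally show ?thesis using assms by simp
qed

text \<open>The weights \<open>\<bar>\<langle>x\<^sub>i, u\<^sub>j\<rangle>\<bar> \<bar>\<langle>v\<^sub>j, y\<^sub>i\<rangle>\<bar>\<close> form a doubly substochastic matrix, so that the
  bound follows from the convexity of the \<open>p\<close>-th power.\<close>

lemma bessel_sum_powr_le_finite:
  fixes u v :: "'j \<Rightarrow> 'a::chilbert_space" and t :: "'j \<Rightarrow> complex"
  assumes p: "p \<ge> 1" and I: "finite I" "bessel I x" "bessel I y"
    and J: "finite J" "onf J u" "onf J v"
  shows "(\<Sum>i\<in>I. cmod (\<Sum>j\<in>J. t j * cinner (x i) (u j) * cinner (v j) (y i)) powr p)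
    \<le> (\<Sum>j\<in>J. cmod (t j) powr p)"
proof -
  define a where "a i j = cmod (cinner (x i) (u j)) * cmod (cinner (v j) (y i))" for i j
  have row: "(\<Sum>j\<in>J. a i j) \<le> 1" if i: "i \<in> I" for i
  proof -
    have 1: "(norm (x i))\<^sup>2 \<le> 1" "(norm (y i))\<^sup>2 \<le> 1" using I i by (auto simp: bessel_def power_le_one)
    show ?thesis unfolding a_def cmod_cinner_commute[of "v _"]
      using order_trans[OF Bessel[OF J(2,1)] 1(1)] order_trans[OF Bessel[OF J(3,1)] 1(2)]
      by (rule sum_mult_le_1)
  qed
  have col: "(\<Sum>i\<in>I. a i j) \<le> 1" if j: "j \<in> J" for j
  proof -
    have "(\<Sum>i\<in>I. (cmod (cinner (u j) (x i)))\<^sup>2) \<le> 1" "(\<Sum>i\<in>I. (cmod (cinner (v j) (y i)))\<^sup>2) \<le> 1"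
      using I onf_norm[OF J(2) j] onf_norm[OF J(3) j] unfolding bessel_def by (metis one_power2)+
    then show ?thesis unfolding a_def cmod_cinner_commute[of "x _"] by (rule sum_mult_le_1)
  qed
  have "(\<Sum>i\<in>I. cmod (\<Sum>j\<in>J. t j * cinner (x i) (u j) * cinner (v j) (y i)) powr p)
      \<le> (\<Sum>i\<in>I. (\<Sum>j\<in>J. a i j * cmod (t j)) powr p)"
  proof (intro sum_mono powr_mono2)
    fix i
    show "cmod (\<Sum>j\<in>J. t j * cinner (x i) (u j) * cinner (v j) (y i)) \<le> (\<Sum>j\<in>J. a i j * cmod (t j))"
      by (rule order_trans[OF norm_sum]) (simp add: a_def norm_mult mult_ac)
  qed (use p in auto)
  \<comment> \<open>Row sums at most 1 permit Jensen's inequality for each \<open>i\<close>; after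
    the sums are exchanged, column sums at most 1 remove the weights.\<close>
  also have "\<dots> \<le> (\<Sum>i\<in>I. \<Sum>j\<in>J. a i j * cmod (t j) powr p)"
    by (intro sum_mono powr_weighted_sum_le p J row) (auto simp: a_def)
  also have "\<dots> = (\<Sum>j\<in>J. (\<Sum>i\<in>I. a i j) * cmod (t j) powr p)"
    by (subst sum.swap) (simp add: sum_distrib_right)
  also have "\<dots> \<le> (\<Sum>j\<in>J. 1 * cmod (t j) powr p)"
    by (intro sum_mono mult_right_mono col) auto
  finally show ?thesis by simp
qed

text \<open>Passage to infinite singular expansions: the finite inequality holds for each partial
  expansion, and both moduli and \<open>p\<close>-th powers are continuous.\<close>

lemma bessel_sum_powr_le:
  fixes u v :: "'j \<Rightarrow> 'a::chilbert_space" and t :: "'j \<Rightarrow> complex"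
  assumes p: "p \<ge> 1" and I: "finite I" "bessel I x" "bessel I y" and J: "onf J u" "onf J v"
    and lim: "\<And>i. i \<in> I \<Longrightarrow> ((\<lambda>j. t j * cinner (x i) (u j) * cinner (v j) (y i)) has_sum a i) J"
    and S: "\<And>G. finite G \<Longrightarrow> G \<subseteq> J \<Longrightarrow> (\<Sum>j\<in>G. cmod (t j) powr p) \<le> S"
  shows "(\<Sum>i\<in>I. cmod (a i) powr p) \<le> S"
proof (rule tendsto_upperbound)
  show "((\<lambda>G. \<Sum>i\<in>I. cmod (\<Sum>j\<in>G. t j * cinner (x i) (u j) * cinner (v j) (y i)) powr p)
     \<longlongrightarrow> (\<Sum>i\<in>I. cmod (a i) powr p)) (finite_subsets_at_top J)"
    using lim p unfolding has_sum_def
    by (intro tendsto_sum tendsto_powr' tendsto_norm tendsto_const) auto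
  show "\<forall>\<^sub>F G in finite_subsets_at_top J.
     (\<Sum>i\<in>I. cmod (\<Sum>j\<in>G. t j * cinner (x i) (u j) * cinner (v j) (y i)) powr p) \<le> S"
  proof (rule eventually_finite_subsets_at_top_weakI)
    fix G assume G: "finite G" "G \<subseteq> J"
    show "(\<Sum>i\<in>I. cmod (\<Sum>j\<in>G. t j * cinner (x i) (u j) * cinner (v j) (y i)) powr p) \<le> S"
      by (rule order_trans[OF bessel_sum_powr_le_finite[OF p I G(1) onf_subset[OF J(1) G(2)]
            onf_subset[OF J(2) G(2)]] S[OF G]])
  qed
qed simp

section \<open>The variational description of the Schatten norm\<close>

lemma scaled_singular_eq:
  "x \<noteq> 0 \<Longrightarrow> complex_of_real (norm x) * a * cinner (complex_of_real (1 / norm x) *\<^sub>C x) y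
    = a * cinner (x::'a::chilbert_space) y"
  by (simp add: cinner_scaleC_left)

lemma schatten_norm_powr:
  assumes "X \<in> schatten_class p" "singular_system X E" "p \<ge> 1"
  shows "schatten_norm p X powr p = (\<Sum>\<^sub>\<infinity>e\<in>E. norm (X e) powr p)"
proof -
  have X: "X \<in> compact_ops" using assms(1) by (simp add: schatten_class_def)
  have "(\<Sum>\<^sub>\<infinity>e\<in>E. norm (X e) powr p) \<ge> 0" by (rule infsum_nonneg) simp
  then show ?thesis using assms(3)
    by (simp add: schatten_norm_singular[OF X assms(2,1)] powr_powr)
qed

lemma schatten_norm_nonneg [simp]: "schatten_norm p X \<ge> 0"
  by (simp add: schatten_norm_def)

lemma schatten_compact: "X \<in> schatten_class p \<Longrightarrow> X \<in> compact_ops"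
  by (simp add: schatten_class_def)

lemma schatten_bounded: "X \<in> schatten_class p \<Longrightarrow> X \<in> bounded_ops"
  by (simp add: schatten_compact compact_ops_bounded)

text \<open>The singular expansion has orthonormal left and right vectors, so the substochastic
  estimate applies with the singular values as \<open>t\<close>. Bessel families are allowed because
  the Hoelder step of the trace pairing meets them.\<close>

lemma schatten_bessel_le:
  assumes X: "X \<in> schatten_class p" and p: "p \<ge> 1" and I: "finite I" "bessel I x" "bessel I y"
  shows "(\<Sum>i\<in>I. cmod (cinner (blinfun_apply X (x i)) (y i)) powr p) \<le> schatten_norm p X powr p"
proof -
  note Xc = schatten_compact[OF X]
  obtain E where E: "singular_system X E" using singular_system_exists[OF Xc] by blast
  show ?thesis unfolding schatten_norm_powr[OF X E p]
  proof (rule bessel_sum_powr_le[OF p I singular_onf[OF Xc E] singular_onf_image[OF Xc E],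
        where t = "\<lambda>e. complex_of_real (norm (X e))"])
    fix i
    show "((\<lambda>e. complex_of_real (norm (X e)) * cinner (x i) e *
        cinner (complex_of_real (1 / norm (X e)) *\<^sub>C X e) (y i)) has_sum cinner (X (x i)) (y i)) E"
      using singular_expansion[OF Xc E, of "x i" "y i"] singular_nonzero[OF Xc E]
      by (subst has_sum_cong[OF scaled_singular_eq]) auto
  next
    fix G assume "finite G" "G \<subseteq> E"
    then have "(\<Sum>e\<in>G. norm (X e) powr p) \<le> (\<Sum>\<^sub>\<infinity>e\<in>E. norm (X e) powr p)"
      using X schatten_class_singular[OF Xc E] by (intro finite_sum_le_infsum) auto
    then show "(\<Sum>e\<in>G. cmod (complex_of_real (norm (X e))) powr p) \<le> (\<Sum>\<^sub>\<infinity>e\<in>E. norm (X e) powr p)" by simp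
  qed
qed

lemma schatten_pbound:
  assumes "X \<in> schatten_class p" "p \<ge> 1" "schatten_norm p X \<le> K"
  shows "pbound p K X"
  unfolding pbound_def
proof (intro allI impI)
  fix n :: nat and e f :: "nat \<Rightarrow> 'a"
  assume "onf {..<n} e" "onf {..<n} f"
  then have "(\<Sum>i<n. cmod (cinner (X (e i)) (f i)) powr p) \<le> schatten_norm p X powr p"
    using assms by (intro schatten_bessel_le onf_bessel) auto
  also have "\<dots> \<le> K powr p" using assms by (intro powr_mono2) auto
  finally show "(\<Sum>i<n. cmod (cinner (X (e i)) (f i)) powr p) \<le> K powr p" .
qed

text \<open>Tested on the singular vectors \<open>e\<close> and their normalised images, the entries
  \<open>cinner (X e) (X e / norm (X e))\<close> are the singular values themselves. Compactness
  comes from the finite rank approximation that \<open>pbound\<close> provides.\<close>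

lemma pbound_schatten:
  assumes X: "X \<in> bounded_ops" and bd: "pbound p K X" and p: "p \<ge> 1" and K: "K \<ge> 0"
  shows "X \<in> schatten_class p" and "schatten_norm p X \<le> K"
proof -
  have Xc: "X \<in> compact_ops" using pbound_compact[OF X bd] p by simp
  obtain E where E: "singular_system X E" using singular_system_exists[OF Xc] by blast
  have le: "(\<Sum>e\<in>G. norm (X e) powr p) \<le> K powr p" if G: "finite G" "G \<subseteq> E" for G
  proof -
    have "(\<Sum>e\<in>G. cmod (cinner (X e) (complex_of_real (1 / norm (X e)) *\<^sub>C X e)) powr p) \<le> K powr p"
      using pboundD[OF bd G(1) onf_subset[OF singular_onf[OF Xc E] G(2)]
          onf_subset[OF singular_onf_image[OF Xc E] G(2)]] .
    moreover have "cmod (cinner (X e) (complex_of_real (1 / norm (X e)) *\<^sub>C X e)) = norm (X e)" for e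
      by (simp add: cinner_scaleC_right cinner_self norm_mult norm_divide power2_eq_square)
    ultimately show ?thesis by simp
  qed
  then have sm: "(\<lambda>e. norm (X e) powr p) summable_on E"
    by (intro nonneg_bdd_above_summable_on bdd_aboveI[of _ "K powr p"]) auto
  then show "X \<in> schatten_class p" by (simp add: schatten_class_singular[OF Xc E])
  then have "schatten_norm p X = (\<Sum>\<^sub>\<infinity>e\<in>E. norm (X e) powr p) powr (1 / p)"
    by (rule schatten_norm_singular[OF Xc E])
  also have "\<dots> \<le> (K powr p) powr (1 / p)"
    using p by (intro powr_mono2 infsum_le_finite_sums[OF sm] infsum_nonneg le) auto
  also have "\<dots> = K" using p K by (simp add: powr_powr)
  finally show "schatten_norm p X \<le> K" .
qed

text \<open>Minkowski's inequality from Jensen's: \<open>a + b\<close> is \<open>K + L\<close> times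
  the mean of \<open>a / K\<close> and \<open>b / L\<close> with weights \<open>K / (K + L)\<close>
  and \<open>L / (K + L)\<close>.\<close>

lemma pbound_add:
  assumes X: "pbound p K X" and Y: "pbound p L Y" and p: "p \<ge> 1" and KL: "K > 0" "L > 0"
  shows "pbound p (K + L) (X + Y)"
  unfolding pbound_def
proof (intro allI impI)
  fix n :: nat and e f :: "nat \<Rightarrow> 'a"
  assume on: "onf {..<n} e" "onf {..<n} f"
  define a where "a i = cmod (cinner (X (e i)) (f i))" for i
  define b where "b i = cmod (cinner (Y (e i)) (f i))" for i
  have ab: "(\<Sum>i<n. a i powr p) \<le> K powr p" "(\<Sum>i<n. b i powr p) \<le> L powr p"
    using X Y on unfolding pbound_def a_def b_def by blast+
  define s where "s = K + L"
  have s: "s > 0" using KL by (simp add: s_def)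
  have "cmod (cinner ((X + Y) (e i)) (f i)) powr p
      \<le> s powr p * (K / s * (a i powr p / K powr p) + L / s * (b i powr p / L powr p))" for i
  proof -
    have "cmod (cinner ((X + Y) (e i)) (f i)) powr p \<le> (a i + b i) powr p"
      unfolding a_def b_def using p
      by (intro powr_mono2) (auto simp: blinfun.add_left cinner_add_left norm_triangle_ineq)
    also have "\<dots> = (s * (K / s * (a i / K) + L / s * (b i / L))) powr p"
      using KL s by (simp add: distrib_left)
    also have "\<dots> = s powr p * (K / s * (a i / K) + L / s * (b i / L)) powr p"
      using KL s by (intro powr_mult)
    also have "(K / s * (a i / K) + L / s * (b i / L)) powr p
        \<le> K / s * (a i / K) powr p + L / s * (b i / L) powr p"
      using powr_weighted_sum_le[OF p, of "{True, False}" "\<lambda>z. if z then K / s else L / s"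
          "\<lambda>z. if z then a i / K else b i / L"] KL s
      by (auto simp: a_def b_def s_def simp flip: add_divide_distrib)
    finally show ?thesis using KL s by (simp add: powr_divide a_def b_def)
  qed
  then have "(\<Sum>i<n. cmod (cinner ((X + Y) (e i)) (f i)) powr p)
      \<le> (\<Sum>i<n. s powr p * (K / s * (a i powr p / K powr p) + L / s * (b i powr p / L powr p)))"
    by (rule sum_mono)
  also have "\<dots> = s powr p * (K / s * ((\<Sum>i<n. a i powr p) / K powr p) + L / s * ((\<Sum>i<n. b i powr p) / L powr p))"
    by (simp add: sum_distrib_left sum.distrib sum_divide_distrib distrib_left)
  also have "\<dots> \<le> s powr p * (K / s * 1 + L / s * 1)"
    using ab KL s by (intro mult_left_mono add_mono) (auto simp: divide_le_eq_1)
  also have "\<dots> = s powr p" using s by (simp add: s_def flip: add_divide_distrib)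
  finally show "(\<Sum>i<n. cmod (cinner ((X + Y) (e i)) (f i)) powr p) \<le> (K + L) powr p"
    by (simp add: s_def)
qed

lemma pbound_scale:
  assumes "pbound p K X" "K \<ge> 0"
  shows "pbound p (cmod c * K) (c *\<^sub>C X)"
  unfolding pbound_def
proof (intro allI impI)
  fix n :: nat and e f :: "nat \<Rightarrow> 'a"
  assume "onf {..<n} e" "onf {..<n} f"
  then have "(\<Sum>i<n. cmod (cinner (X (e i)) (f i)) powr p) \<le> K powr p"
    using assms(1) unfolding pbound_def by blast
  then have "cmod c powr p * (\<Sum>i<n. cmod (cinner (X (e i)) (f i)) powr p) \<le> cmod c powr p * K powr p"
    by (intro mult_left_mono) auto
  then show "(\<Sum>i<n. cmod (cinner ((c *\<^sub>C X) (e i)) (f i)) powr p) \<le> (cmod c * K) powr p"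
    using assms(2)
    by (simp add: scaleC_blinfun.rep_eq cinner_scaleC_left norm_mult powr_mult sum_distrib_left)
qed

lemma schatten_add:
  assumes X: "X \<in> schatten_class p" and Y: "Y \<in> schatten_class p" and p: "p \<ge> 1"
  shows "X + Y \<in> schatten_class p" and "schatten_norm p (X + Y) \<le> schatten_norm p X + schatten_norm p Y"
proof -
  have bd: "X + Y \<in> bounded_ops"
    by (intro cvec.subspace_add[OF subspace_bounded_ops] schatten_bounded[OF X] schatten_bounded[OF Y])
  \<comment> \<open>The summand \<open>\<epsilon>\<close> keeps both bounds positive, as the
    division in \<open>pbound_add\<close> requires; it is sent to 0 afterwards.\<close>
  have pb: "pbound p (schatten_norm p X + \<epsilon> + (schatten_norm p Y + \<epsilon>)) (X + Y)" if "\<epsilon> > 0" for \<epsilon>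
    using that by (intro pbound_add schatten_pbound X Y p add_nonneg_pos) auto
  show "X + Y \<in> schatten_class p"
    by (rule pbound_schatten(1)[OF bd pb[of 1] p]) (simp_all add: add_nonneg_nonneg)
  show "schatten_norm p (X + Y) \<le> schatten_norm p X + schatten_norm p Y"
  proof (rule field_le_epsilon)
    fix \<epsilon> :: real assume "\<epsilon> > 0"
    then show "schatten_norm p (X + Y) \<le> schatten_norm p X + schatten_norm p Y + \<epsilon>"
      using pbound_schatten(2)[OF bd pb[of "\<epsilon>/2"] p] by (simp add: add_nonneg_nonneg)
  qed
qed

lemma schatten_scale:
  assumes X: "X \<in> schatten_class p" and p: "p \<ge> 1"
  shows "c *\<^sub>C X \<in> schatten_class p" and "schatten_norm p (c *\<^sub>C X) \<le> cmod c * schatten_norm p X"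
proof -
  have "c *\<^sub>C X \<in> bounded_ops" by (intro cvec.subspace_scale[OF subspace_bounded_ops] schatten_bounded[OF X])
  note * = pbound_schatten[OF this _ p]
  have "pbound p (cmod c * schatten_norm p X) (c *\<^sub>C X)"
    by (intro pbound_scale schatten_pbound X p) auto
  from *[OF this]
  show "c *\<^sub>C X \<in> schatten_class p" "schatten_norm p (c *\<^sub>C X) \<le> cmod c * schatten_norm p X"
    by simp_all
qed

lemma schatten_ctrans:
  assumes X: "X \<in> schatten_class p" and p: "p \<ge> 1" and C: "conjugation C"
  shows "ctrans C X \<in> schatten_class p" and "schatten_norm p (ctrans C X) \<le> schatten_norm p X"
  using pbound_schatten[OF ctrans_bounded[OF C schatten_bounded[OF X]]
      pbound_ctrans[OF C schatten_bounded[OF X] schatten_pbound[OF X p order_refl]] p] by auto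

section \<open>Test operators and rank-one operators in the Schatten classes\<close>

lemma pbound_lincomb:
  fixes u v :: "'j \<Rightarrow> 'a::chilbert_space"
  assumes p: "p \<ge> 1" and J: "finite J" "onf J u" "onf J v"
  shows "pbound p ((\<Sum>j\<in>J. cmod (c j) powr p) powr (1 / p)) (\<Sum>j\<in>J. c j *\<^sub>C rk (u j) (v j))"
  unfolding pbound_def
proof (intro allI impI)
  fix n :: nat and e f :: "nat \<Rightarrow> 'a"
  assume on: "onf {..<n} e" "onf {..<n} f"
  have "(\<Sum>i<n. cmod (\<Sum>j\<in>J. c j * cinner (e i) (u j) * cinner (v j) (f i)) powr p)
      \<le> (\<Sum>j\<in>J. cmod (c j) powr p)"
    by (intro bessel_sum_powr_le_finite p J onf_bessel on) simp_all
  moreover have "cinner ((\<Sum>j\<in>J. c j *\<^sub>C rk (u j) (v j)) x) y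
      = (\<Sum>j\<in>J. c j * cinner x (u j) * cinner (v j) y)" for x y
    by (simp add: blinfun.sum_left cinner_sum_left scaleC_blinfun.rep_eq cinner_scaleC_left cinner_rk mult.assoc)
  ultimately show "(\<Sum>i<n. cmod (cinner ((\<Sum>j\<in>J. c j *\<^sub>C rk (u j) (v j)) (e i)) (f i)) powr p)
      \<le> ((\<Sum>j\<in>J. cmod (c j) powr p) powr (1 / p)) powr p"
    using p by (simp add: powr_powr sum_nonneg)
qed

lemma schatten_lincomb:
  fixes u v :: "'j \<Rightarrow> 'a::chilbert_space"
  assumes p: "p \<ge> 1" and J: "finite J" "onf J u" "onf J v"
  shows "(\<Sum>j\<in>J. c j *\<^sub>C rk (u j) (v j)) \<in> schatten_class p"
    and "schatten_norm p (\<Sum>j\<in>J. c j *\<^sub>C rk (u j) (v j)) \<le> (\<Sum>j\<in>J. cmod (c j) powr p) powr (1 / p)"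
proof -
  have "(\<Sum>j\<in>J. c j *\<^sub>C rk (u j) (v j)) \<in> bounded_ops"
    by (intro finrank_bounded finrank_sum finrank_scale rk_finrank)
  from pbound_schatten[OF this pbound_lincomb[OF p J] p]
  show "(\<Sum>j\<in>J. c j *\<^sub>C rk (u j) (v j)) \<in> schatten_class p"
    "schatten_norm p (\<Sum>j\<in>J. c j *\<^sub>C rk (u j) (v j)) \<le> (\<Sum>j\<in>J. cmod (c j) powr p) powr (1 / p)"
    by simp_all
qed

lemma schatten_rk:
  assumes p: "p \<ge> 1"
  shows "rk u v \<in> schatten_class p" and "schatten_norm p (rk u v) \<le> norm u * norm (v::'a::chilbert_space)"
proof -
  have "rk u v \<in> schatten_class p \<and> schatten_norm p (rk u v) \<le> norm u * norm v"
  proof (cases "u = 0 \<or> v = 0")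
    case True
    then have "rk u v = 0" by (intro blinfun_eqI) (auto simp: rk_apply)
    moreover have "pbound p 0 (0::'a \<Rightarrow>\<^sub>L 'a)" by (simp add: pbound_def)
    moreover have "(0::'a \<Rightarrow>\<^sub>L 'a) \<in> bounded_ops" by (rule cvec.subspace_0[OF subspace_bounded_ops])
    ultimately show ?thesis using pbound_schatten[of 0 p 0] p True by auto
  next
    case False
    define u' where "u' = complex_of_real (1 / norm u) *\<^sub>C u"
    define v' where "v' = complex_of_real (1 / norm v) *\<^sub>C v"
    have "onf {()} (\<lambda>_. u')" "onf {()} (\<lambda>_. v')"
      using False by (simp_all add: onf_def cinner_self u'_def v'_def norm_scaleC norm_divide)
    note * = schatten_lincomb[OF p _ this, of "\<lambda>_. complex_of_real (norm u * norm v)"]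
    have "complex_of_real (norm u * norm v) *\<^sub>C rk u' v' = rk u v"
      using False by (intro blinfun_eqI)
        (simp add: scaleC_blinfun.rep_eq rk_apply u'_def v'_def cinner_scaleC_right scaleC_scaleC)
    then show ?thesis using * p by (simp add: powr_powr norm_mult)
  qed
  then show "rk u v \<in> schatten_class p" "schatten_norm p (rk u v) \<le> norm u * norm v" by auto
qed

lemma subspace_schatten:
  assumes "p \<ge> 1" shows "cvec.subspace (schatten_class p :: ('a::chilbert_space \<Rightarrow>\<^sub>L 'a) set)"
proof -
  have "rk 0 0 = (0::'a \<Rightarrow>\<^sub>L 'a)" by (rule blinfun_eqI) (simp add: rk_apply)
  then have "(0::'a \<Rightarrow>\<^sub>L 'a) \<in> schatten_class p" using schatten_rk(1)[OF assms] by metis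
  then show ?thesis
    by (auto simp: cvec.subspace_def schatten_add schatten_scale assms)
qed

section \<open>Approximation by truncated singular expansions\<close>

lemma singular_remainder:
  assumes X: "X \<in> compact_ops" and E: "singular_system X E" and G: "finite G" "G \<subseteq> E"
  shows "((\<lambda>e. cinner x e * cinner (X e) y) has_sum cinner ((X - (\<Sum>e\<in>G. rk e (X e))) x) y) (E - G)"
proof -
  have "cinner ((\<Sum>e\<in>G. rk e (X e)) x) y = (\<Sum>e\<in>G. cinner x e * cinner (X e) y)"
    by (simp add: blinfun.sum_left cinner_sum_left cinner_rk)
  then have "((\<lambda>e. cinner x e * cinner (X e) y) has_sum cinner ((\<Sum>e\<in>G. rk e (X e)) x) y) G"
    using has_sum_finite[OF G(1)] by metis
  from has_sum_Diff[OF singular_expansion[OF X E] this G(2)]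
  show ?thesis by (simp add: blinfun.diff_left cinner_diff_left)
qed

text \<open>After truncation at \<open>G\<close> the remainder has a singular expansion over
  \<open>E - G\<close>. The tail of the \<open>p\<close>-th powers is at most
  \<open>\<epsilon> powr p\<close>, which is \<open>pbound\<close> with constant
  \<open>\<epsilon>\<close>.\<close>

lemma schatten_approx_finrank:
  assumes X: "X \<in> schatten_class p" and p: "p \<ge> 1" and \<epsilon>: "\<epsilon> > 0"
  shows "\<exists>F\<in>finrank. schatten_norm p (X - F) \<le> \<epsilon>"
proof -
  note Xc = schatten_compact[OF X]
  obtain E where E: "singular_system X E" using singular_system_exists[OF Xc] by blast
  have sm: "(\<lambda>e. norm (X e) powr p) summable_on E"
    using X schatten_class_singular[OF Xc E] by blast
  obtain G where G: "finite G" "G \<subseteq> E"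
    "dist (\<Sum>e\<in>G. norm (X e) powr p) (\<Sum>\<^sub>\<infinity>e\<in>E. norm (X e) powr p) \<le> \<epsilon> powr p"
    using infsum_finite_approximation[OF sm, of "\<epsilon> powr p"] \<epsilon> by auto
  define F where "F = (\<Sum>e\<in>G. rk e (X e))"
  have F: "F \<in> finrank" unfolding F_def by (intro finrank_sum rk_finrank)
  have "pbound p \<epsilon> (X - F)" unfolding pbound_def
  proof (intro allI impI)
    fix n :: nat and x y :: "nat \<Rightarrow> 'a"
    assume on: "onf {..<n} x" "onf {..<n} y"
    show "(\<Sum>i<n. cmod (cinner ((X - F) (x i)) (y i)) powr p) \<le> \<epsilon> powr p"
    proof (rule bessel_sum_powr_le[OF p finite_lessThan onf_bessel[OF on(1)] onf_bessel[OF on(2)]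
          onf_subset[OF singular_onf[OF Xc E] Diff_subset[of E G]]
          onf_subset[OF singular_onf_image[OF Xc E] Diff_subset[of E G]],
          where t = "\<lambda>e. complex_of_real (norm (X e))"])
      fix i
      show "((\<lambda>e. complex_of_real (norm (X e)) * cinner (x i) e *
          cinner (complex_of_real (1 / norm (X e)) *\<^sub>C X e) (y i)) has_sum cinner ((X - F) (x i)) (y i)) (E - G)"
        using singular_remainder[OF Xc E G(1,2), of "x i" "y i"] singular_nonzero[OF Xc E] unfolding F_def
        by (subst has_sum_cong[OF scaled_singular_eq]) auto
    next
      fix H assume H: "finite H" "H \<subseteq> E - G"
      have "(\<Sum>e\<in>G. norm (X e) powr p) + (\<Sum>e\<in>H. norm (X e) powr p) = (\<Sum>e\<in>G \<union> H. norm (X e) powr p)"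
        using G H by (intro sum.union_disjoint[symmetric]) auto
      also have "\<dots> \<le> (\<Sum>\<^sub>\<infinity>e\<in>E. norm (X e) powr p)"
        using G H by (intro finite_sum_le_infsum sm) auto
      finally show "(\<Sum>e\<in>H. cmod (complex_of_real (norm (X e))) powr p) \<le> \<epsilon> powr p"
        using G(3) by (simp add: dist_real_def)
    qed simp_all
  qed
  moreover have "X - F \<in> bounded_ops"
    by (intro cvec.subspace_diff[OF subspace_bounded_ops] finrank_bounded F schatten_bounded[OF X])
  ultimately have "schatten_norm p (X - F) \<le> \<epsilon>" using pbound_schatten(2) p \<epsilon> by force
  with F show ?thesis by blast
qed

text \<open>Only finitely many singular values reach \<open>\<epsilon>\<close>. Once these are cut
  off, orthonormality of the normalised images and Bessel's inequality for \<open>E\<close> bound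
  the remainder by \<open>\<epsilon>\<close>.\<close>

lemma compact_approx_finrank:
  fixes X :: "'a::chilbert_space \<Rightarrow>\<^sub>L 'a"
  assumes X: "X \<in> compact_ops" and \<epsilon>: "\<epsilon> > 0"
  shows "\<exists>F\<in>finrank. norm (X - F) \<le> \<epsilon>"
proof -
  obtain E where E: "singular_system X E" using singular_system_exists[OF X] by blast
  define G where "G = {e \<in> E. norm (X e) \<ge> \<epsilon>}"
  have G: "finite G" "G \<subseteq> E" using finite_large_singular[OF X E \<epsilon>] by (auto simp: G_def)
  define F where "F = (\<Sum>e\<in>G. rk e (X e))"
  have "norm (X - F) \<le> \<epsilon>"
  proof (rule norm_blinfun_cinner_le)
    fix x y
    show "cmod (cinner ((X - F) x) y) \<le> \<epsilon> * norm x * norm y"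
    proof (rule tendsto_upperbound)
      show "((\<lambda>H. cmod (\<Sum>e\<in>H. cinner x e * cinner (X e) y)) \<longlongrightarrow> cmod (cinner ((X - F) x) y))
          (finite_subsets_at_top (E - G))"
        using singular_remainder[OF X E G] unfolding has_sum_def F_def by (intro tendsto_norm)
      show "\<forall>\<^sub>F H in finite_subsets_at_top (E - G).
          cmod (\<Sum>e\<in>H. cinner x e * cinner (X e) y) \<le> \<epsilon> * norm x * norm y"
      proof (rule eventually_finite_subsets_at_top_weakI)
        fix H assume H: "finite H" "H \<subseteq> E - G"
        then have HE: "H \<subseteq> E" by blast
        \<comment> \<open>A partial sum of the remainder at \<open>x\<close>, written with
          normalised images so that Pythagoras applies.\<close>
        define w where "w = (\<Sum>e\<in>H. (cinner x e * complex_of_real (norm (X e))) *\<^sub>C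
          (complex_of_real (1 / norm (X e)) *\<^sub>C X e))"
        have "(norm w)\<^sup>2 = (\<Sum>e\<in>H. (cmod (cinner x e * complex_of_real (norm (X e))))\<^sup>2)"
          unfolding w_def by (rule onf_norm_lincomb[OF onf_subset[OF singular_onf_image[OF X E] HE] H(1)])
        also have "\<dots> \<le> (\<Sum>e\<in>H. (cmod (cinner x e))\<^sup>2 * \<epsilon>\<^sup>2)"
          using H(2) by (intro sum_mono) (auto simp: norm_mult power_mult_distrib G_def intro!: mult_left_mono power_mono)
        also have "\<dots> \<le> (norm x)\<^sup>2 * \<epsilon>\<^sup>2"
          unfolding sum_distrib_right[symmetric]
          by (rule mult_right_mono[OF Bessel[OF onf_subset[OF singular_onf[OF X E] HE] H(1)]]) simp
        finally have "(norm w)\<^sup>2 \<le> (\<epsilon> * norm x)\<^sup>2" by (simp add: power_mult_distrib mult.commute)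
        then have "norm w \<le> \<epsilon> * norm x" by (rule power2_le_imp_le) (use \<epsilon> in simp)
        have "w = (\<Sum>e\<in>H. cinner x e *\<^sub>C X e)"
          unfolding w_def using singular_nonzero[OF X E] HE
          by (intro sum.cong refl) (auto simp: scaleC_scaleC)
        then have "(\<Sum>e\<in>H. cinner x e * cinner (X e) y) = cinner w y"
          by (simp add: cinner_sum_left cinner_scaleC_left)
        then show "cmod (\<Sum>e\<in>H. cinner x e * cinner (X e) y) \<le> \<epsilon> * norm x * norm y"
          using Cauchy_Schwarz[of w y] mult_right_mono[OF \<open>norm w \<le> \<epsilon> * norm x\<close> norm_ge_zero[of y]]
          by simp
      qed
    qed simp
  qed (use \<epsilon> in simp)
  moreover have "F \<in> finrank" unfolding F_def by (intro finrank_sum rk_finrank)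
  ultimately show ?thesis by blast
qed

text \<open>Compactness has no description by \<open>pbound\<close>, so invariance passes through
  approximation: \<open>ctrans C\<close> maps rank-one operators to rank-one operators and does not
  increase the operator norm.\<close>

lemma compact_ctrans:
  assumes "X \<in> compact_ops" "conjugation C" shows "ctrans C X \<in> compact_ops"
proof (rule compact_ops_if_approx)
  note Xb = compact_ops_bounded[OF assms(1)]
  show "ctrans C X \<in> bounded_ops" by (rule ctrans_bounded[OF assms(2) Xb])
  fix \<epsilon> :: real assume "\<epsilon> > 0"
  then obtain F where F: "F \<in> finrank" "norm (X - F) \<le> \<epsilon>" using compact_approx_finrank[OF assms(1)] by blast
  have "ctrans C F \<in> finrank"
    using F(1)
  proof (induction rule: finrank_induct)
    case zero
    have "ctrans C 0 = 0"
      by (rule blinfun_cinner_eqI)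
         (simp add: cinner_ctrans[OF assms(2)] cvec.subspace_0[OF subspace_bounded_ops])
    then show ?case by (simp add: finrank_def cvec.span_zero)
  next
    case (step c u v F)
    then show ?case
      by (simp add: ctrans_add[OF assms(2)] ctrans_scale[OF assms(2)] ctrans_rk[OF assms(2)] finrank_add
          finrank_scale rk_finrank finrank_bounded rk_bounded cvec.subspace_scale[OF subspace_bounded_ops])
  qed
  moreover have "norm (ctrans C X - ctrans C F) \<le> \<epsilon>"
  proof -
    have "X - F \<in> bounded_ops" by (intro cvec.subspace_diff[OF subspace_bounded_ops] Xb finrank_bounded F)
    moreover from this have "ctrans C ((X - F) + F) = ctrans C (X - F) + ctrans C F"
      by (rule ctrans_add[OF assms(2)]) (rule finrank_bounded[OF F(1)])
    then have "ctrans C X - ctrans C F = ctrans C (X - F)" by simp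
    ultimately show ?thesis using norm_ctrans_le[OF assms(2), of "X - F"] F(2) by simp
  qed
  ultimately show "\<exists>F\<in>compact_ops. norm (ctrans C X - F) \<le> \<epsilon>" using finrank_compact by blast
qed

section \<open>The trace pairing\<close>

lemma orthonormal_basis_exists:
  "\<exists>B :: 'a::chilbert_space set. onf B (\<lambda>e. e) \<and> (\<forall>x. norm x = 1 \<longrightarrow> (\<exists>e\<in>B. cinner x e \<noteq> 0))"
proof (rule maximal_onf_exists[of "UNIV :: 'a set"])
  fix E :: "'a set"
  assume on: "onf E (\<lambda>e. e)" and max: "\<And>x. x \<in> UNIV \<Longrightarrow> norm x = 1 \<Longrightarrow> \<exists>e\<in>E. cinner x e \<noteq> 0"
  show ?thesis by (intro exI[of _ E] conjI allI impI on) (rule max[OF UNIV_I])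
qed

lemma has_sum_sum:
  fixes f :: "'i \<Rightarrow> 'b \<Rightarrow> 'c::topological_comm_monoid_add"
  assumes "\<And>i. i \<in> I \<Longrightarrow> (f i has_sum s i) A"
  shows "((\<lambda>x. \<Sum>i\<in>I. f i x) has_sum (\<Sum>i\<in>I. s i)) A"
  using assms by (induction I rule: infinite_finite_induct) (auto intro: has_sum_add)

lemma mult_cnj_sgn: "z * cnj (sgn z) = complex_of_real (cmod z)"
proof (cases "z = 0")
  case False
  have "z * cnj (sgn z) = z * cnj z / complex_of_real (cmod z)"
    by (simp add: sgn_div_norm scaleR_conv_of_real divide_inverse mult_ac)
  then show ?thesis using False by (simp add: mult_cnj_self power2_eq_square)
qed simp

lemma cmod_cnj_sgn_le: "cmod (cnj (sgn z)) \<le> 1"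
  by (simp add: norm_sgn)

text \<open>Inserting the phases \<open>\<epsilon>\<^sub>e\<close> of the diagonal entries turns the sum of their moduli into
  \<open>\<Sum>\<^sub>u \<langle>X T u, W u\<rangle>\<close> for the diagonal contraction \<open>W\<close>, where \<open>u\<close> runs through the right singular
  vectors of \<open>T\<close>.\<close>

lemma trace_partial_sums_le:
  fixes X T :: "'a::chilbert_space \<Rightarrow>\<^sub>L 'a"
  assumes X: "X \<in> bounded_ops" and T: "T \<in> schatten_class q" and q: "q \<ge> 1"
    and B: "onf B (\<lambda>e. e)" and F: "finite F" "F \<subseteq> B"
    and pairing: "\<And>(c::'a \<Rightarrow> real) H w y A. finite H \<Longrightarrow> onf H w \<Longrightarrow> bessel H y \<Longrightarrow>
      (\<And>u. u \<in> H \<Longrightarrow> c u \<ge> 0) \<Longrightarrow> A \<ge> 0 \<Longrightarrow> (\<Sum>u\<in>H. c u powr q) \<le> A powr q \<Longrightarrow>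
      (\<Sum>u\<in>H. c u * cmod (cinner (X (w u)) (y u))) \<le> A * N"
  shows "(\<Sum>e\<in>F. cmod (cinner (X (T e)) e)) \<le> schatten_norm q T * N"
proof -
  note Tc = schatten_compact[OF T]
  obtain E where E: "singular_system T E" using singular_system_exists[OF Tc] by blast
  define \<epsilon> where "\<epsilon> e = cnj (sgn (cinner (X (T e)) e))" for e
  have \<epsilon>: "cmod (\<epsilon> e) \<le> 1" for e unfolding \<epsilon>_def by (rule cmod_cnj_sgn_le)
  have onF: "onf F (\<lambda>e. e)" by (rule onf_subset[OF B F(2)])
  \<comment> \<open>\<open>W\<close> keeps the coordinates in \<open>F\<close> and multiplies them
    by the conjugate phases; \<open>V\<close> is its adjoint. Bessel's inequality for
    \<open>V z\<close> then shows that \<open>W\<close> maps orthonormal families to Bessel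
    families.\<close>
  define W where "W u = (\<Sum>e\<in>F. (cnj (\<epsilon> e) * cinner u e) *\<^sub>C e)" for u
  define V where "V z = (\<Sum>e\<in>F. (\<epsilon> e * cinner z e) *\<^sub>C e)" for z
  have contr: "(\<Sum>e\<in>F. (cmod (d e * cinner z e))\<^sup>2) \<le> (norm z)\<^sup>2" if "\<And>e. cmod (d e) \<le> 1" for d z
  proof -
    have "(\<Sum>e\<in>F. (cmod (d e * cinner z e))\<^sup>2) \<le> (\<Sum>e\<in>F. (cmod (cinner z e))\<^sup>2)"
    proof (intro sum_mono power_mono)
      show "cmod (d e * cinner z e) \<le> cmod (cinner z e)" for e
        using mult_right_mono[OF that[of e] norm_ge_zero[of "cinner z e"]] by (simp add: norm_mult)
    qed simp
    also have "\<dots> \<le> (norm z)\<^sup>2" by (rule Bessel[OF onF F(1)])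
    finally show ?thesis .
  qed
  have W_le: "norm (W u) \<le> norm u" for u
  proof (rule power2_le_imp_le)
    show "(norm (W u))\<^sup>2 \<le> (norm u)\<^sup>2"
      unfolding W_def onf_norm_lincomb[OF onF F(1)] by (rule contr) (simp add: \<epsilon>)
  qed simp
  have V_le: "(norm (V z))\<^sup>2 \<le> (norm z)\<^sup>2" for z
    unfolding V_def onf_norm_lincomb[OF onF F(1)] by (rule contr) (rule \<epsilon>)
  have WV: "cinner z (W u) = cinner (V z) u" for z u
    unfolding V_def W_def cinner_sum_left cinner_sum_right
    by (intro sum.cong refl) (simp add: cinner_scaleC_left cinner_scaleC_right cinner_commute[of _ u])
  have bes: "bessel H W" if H: "finite H" "H \<subseteq> E" for H
    unfolding bessel_def
  proof (intro conjI ballI allI)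
    fix u assume "u \<in> H"
    then show "norm (W u) \<le> 1" using W_le[of u] onf_norm[OF singular_onf[OF Tc E], of u] H(2) by auto
  next
    fix z
    have "(\<Sum>u\<in>H. (cmod (cinner (V z) u))\<^sup>2) \<le> (norm (V z))\<^sup>2"
      by (rule Bessel[OF onf_subset[OF singular_onf[OF Tc E] H(2)] H(1)])
    then show "(\<Sum>u\<in>H. (cmod (cinner z (W u)))\<^sup>2) \<le> (norm z)\<^sup>2"
      unfolding WV using V_le[of z] by linarith
  qed
  \<comment> \<open>A finite combination of singular expansions of \<open>T\<close> exchanges the
    two sums, and the phases turn its limit into the sum of the moduli.\<close>
  have "((\<lambda>u. \<Sum>e\<in>F. \<epsilon> e * (cinner e u * cinner (T u) (cadjoint X e)))
      has_sum (\<Sum>e\<in>F. \<epsilon> e * cinner (T e) (cadjoint X e))) E"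
    by (intro has_sum_sum has_sum_cmult_right singular_expansion[OF Tc E])
  moreover have "(\<Sum>e\<in>F. \<epsilon> e * (cinner e u * cinner (T u) (cadjoint X e))) = cinner (X (T u)) (W u)" for u
    unfolding W_def cinner_sum_right cinner_cadjoint_right[OF X]
    by (intro sum.cong refl) (simp add: cinner_scaleC_right cinner_commute[of u])
  moreover have "(\<Sum>e\<in>F. \<epsilon> e * cinner (T e) (cadjoint X e))
      = complex_of_real (\<Sum>e\<in>F. cmod (cinner (X (T e)) e))"
    unfolding of_real_sum cinner_cadjoint_right[OF X] \<epsilon>_def
    by (intro sum.cong refl) (metis mult.commute mult_cnj_sgn)
  ultimately have lim: "((\<lambda>u. cinner (X (T u)) (W u)) has_sum complex_of_real (\<Sum>e\<in>F. cmod (cinner (X (T e)) e))) E"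
    by simp
  have "cmod (complex_of_real (\<Sum>e\<in>F. cmod (cinner (X (T e)) e))) \<le> schatten_norm q T * N"
  proof (rule tendsto_upperbound)
    show "((\<lambda>H. cmod (\<Sum>u\<in>H. cinner (X (T u)) (W u)))
        \<longlongrightarrow> cmod (complex_of_real (\<Sum>e\<in>F. cmod (cinner (X (T e)) e)))) (finite_subsets_at_top E)"
      using lim unfolding has_sum_def by (rule tendsto_norm)
    show "\<forall>\<^sub>F H in finite_subsets_at_top E. cmod (\<Sum>u\<in>H. cinner (X (T u)) (W u)) \<le> schatten_norm q T * N"
    proof (rule eventually_finite_subsets_at_top_weakI)
      fix H assume H: "finite H" "H \<subseteq> E"
      define w where "w u = complex_of_real (1 / norm (T u)) *\<^sub>C T u" for u
      have "cmod (\<Sum>u\<in>H. cinner (X (T u)) (W u)) \<le> (\<Sum>u\<in>H. norm (T u) * cmod (cinner (X (w u)) (W u)))"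
      proof (rule order_trans[OF norm_sum], rule sum_mono)
        fix u assume "u \<in> H"
        then have "T u \<noteq> 0" using singular_nonzero[OF Tc E] H(2) by blast
        then show "cmod (cinner (X (T u)) (W u)) \<le> norm (T u) * cmod (cinner (X (w u)) (W u))"
          by (simp add: w_def bounded_opsD[OF X] cinner_scaleC_left norm_mult norm_divide)
      qed
      \<comment> \<open>The hypothesis is used with the singular values of \<open>T\<close> as
        coefficients, its left singular vectors as orthonormal family and \<open>W\<close> as Bessel
        family.\<close>
      also have "\<dots> \<le> schatten_norm q T * N"
      proof (rule pairing[OF H(1) _ bes[OF H]])
        show "onf H w" unfolding w_def by (rule onf_subset[OF singular_onf_image[OF Tc E] H(2)])
        show "(\<Sum>u\<in>H. norm (T u) powr q) \<le> schatten_norm q T powr q"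
          unfolding schatten_norm_powr[OF T E q]
          using T schatten_class_singular[OF Tc E] H by (intro finite_sum_le_infsum) auto
      qed auto
      finally show "cmod (\<Sum>u\<in>H. cinner (X (T u)) (W u)) \<le> schatten_norm q T * N" .
    qed
  qed simp
  then show ?thesis unfolding norm_of_real by linarith
qed

text \<open>An axiomatic form of \<open>f T = tr (X T)\<close>, since the trace of
  \<open>X o\<^sub>L rk u v\<close> is \<open>cinner (X v) u\<close>. The bound \<open>K\<close> is
  kept apart from the norm of \<open>X\<close>, so that one predicate covers both the functional of
  a given operator and the operator of a given functional.\<close>

definition represents ::
  "('a::chilbert_space \<Rightarrow>\<^sub>L 'a) set \<Rightarrow> (('a \<Rightarrow>\<^sub>L 'a) \<Rightarrow> real) \<Rightarrow> real \<Rightarrow> ('a \<Rightarrow>\<^sub>L 'a) \<Rightarrow> (('a \<Rightarrow>\<^sub>L 'a) \<Rightarrow> complex) \<Rightarrow> bool"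
  where "represents \<T> M K X f \<longleftrightarrow>
    (\<forall>S\<in>\<T>. \<forall>T\<in>\<T>. f (S + T) = f S + f T) \<and> (\<forall>c. \<forall>T\<in>\<T>. f (c *\<^sub>C T) = c * f T) \<and>
    (\<forall>T\<in>\<T>. cmod (f T) \<le> K * M T) \<and> (\<forall>u v. f (rk u v) = cinner (X v) u)"

lemma represents_add:
    "represents \<T> M K X f \<Longrightarrow> S \<in> \<T> \<Longrightarrow> T \<in> \<T> \<Longrightarrow> f (S + T) = f S + f T"
  and represents_scale: "represents \<T> M K X f \<Longrightarrow> T \<in> \<T> \<Longrightarrow> f (c *\<^sub>C T) = c * f T"
  and represents_bound: "represents \<T> M K X f \<Longrightarrow> T \<in> \<T> \<Longrightarrow> cmod (f T) \<le> K * M T"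
  and represents_rk: "represents \<T> M K X f \<Longrightarrow> f (rk u v) = cinner (X v) u"
  by (simp_all add: represents_def)

text \<open>\<open>Z T\<close> stands for \<open>X o\<^sub>L T\<close> or
  \<open>T o\<^sub>L X\<close>: the estimate of partial sums wants the factor with summable singular
  values on the right, and this factor may be either one. The uniform bound on partial sums makes
  the diagonal series absolutely convergent.\<close>

lemma trace_represents:
  fixes X :: "'a::chilbert_space \<Rightarrow>\<^sub>L 'a" and Z :: "('a \<Rightarrow>\<^sub>L 'a) \<Rightarrow> ('a \<Rightarrow>\<^sub>L 'a)"
  assumes bd: "\<And>T F. T \<in> \<T> \<Longrightarrow> finite F \<Longrightarrow> F \<subseteq> B \<Longrightarrow> (\<Sum>e\<in>F. cmod (cinner (Z T e) e)) \<le> K * M T"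
    and add: "\<And>S T. Z (S + T) = Z S + Z T" and scale: "\<And>c T. Z (c *\<^sub>C T) = c *\<^sub>C Z T"
    and rk: "\<And>u v. ((\<lambda>e. cinner (Z (rk u v) e) e) has_sum cinner (X v) u) B"
  shows "represents \<T> M K X (\<lambda>T. \<Sum>\<^sub>\<infinity>e\<in>B. cinner (Z T e) e)"
proof -
  have abs: "(\<lambda>e. norm (cinner (Z T e) e)) summable_on B" if "T \<in> \<T>" for T
    unfolding abs_summable_iff_bdd_above
    by (rule bdd_aboveI[of _ "K * M T"]) (use bd[OF that] in auto)
  have sm: "(\<lambda>e. cinner (Z T e) e) summable_on B" if "T \<in> \<T>" for T
    by (rule Infinite_Sum.abs_summable_summable[OF abs[OF that]])
  show ?thesis unfolding represents_def
  proof (intro conjI ballI allI)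
    fix S T assume "S \<in> \<T>" "T \<in> \<T>"
    then show "(\<Sum>\<^sub>\<infinity>e\<in>B. cinner (Z (S + T) e) e)
        = (\<Sum>\<^sub>\<infinity>e\<in>B. cinner (Z S e) e) + (\<Sum>\<^sub>\<infinity>e\<in>B. cinner (Z T e) e)"
      by (simp add: add blinfun.add_left cinner_add_left infsum_add sm)
  next
    fix c T assume "T \<in> \<T>"
    then show "(\<Sum>\<^sub>\<infinity>e\<in>B. cinner (Z (c *\<^sub>C T) e) e) = c * (\<Sum>\<^sub>\<infinity>e\<in>B. cinner (Z T e) e)"
      by (simp add: scale scaleC_blinfun.rep_eq cinner_scaleC_left infsum_cmult_right sm)
  next
    fix T assume T: "T \<in> \<T>"
    have "cmod (\<Sum>\<^sub>\<infinity>e\<in>B. cinner (Z T e) e) \<le> (\<Sum>\<^sub>\<infinity>e\<in>B. cmod (cinner (Z T e) e))"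
      by (rule norm_infsum_bound[OF abs[OF T]])
    also have "\<dots> \<le> K * M T" using abs[OF T] bd[OF T] by (rule infsum_le_finite_sums)
    finally show "cmod (\<Sum>\<^sub>\<infinity>e\<in>B. cinner (Z T e) e) \<le> K * M T" .
  next
    fix u v
    show "(\<Sum>\<^sub>\<infinity>e\<in>B. cinner (Z (rk u v) e) e) = cinner (X v) u" by (rule infsumI[OF rk])
  qed
qed

lemma trace_rk_right:
  fixes X :: "'a::chilbert_space \<Rightarrow>\<^sub>L 'a"
  assumes "X \<in> bounded_ops" "onf B (\<lambda>e. e)" "\<And>x. norm x = 1 \<Longrightarrow> \<exists>e\<in>B. cinner x e \<noteq> 0"
  shows "((\<lambda>e. cinner ((X o\<^sub>L rk u v) e) e) has_sum cinner (X v) u) B"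
proof -
  have "((\<lambda>e. cinner (X v) e * cinner e u) has_sum cinner (X v) u) B"
    by (rule Parseval[OF assms(2,3)])
  then show ?thesis by (simp add: rk_apply bounded_opsD[OF assms(1)] cinner_scaleC_left mult.commute)
qed

text \<open>The opposite order has the same trace, because
  \<open>cinner v (cadjoint X u) = cinner (X v) u\<close>.\<close>

lemma trace_rk_left:
  fixes X :: "'a::chilbert_space \<Rightarrow>\<^sub>L 'a"
  assumes "X \<in> bounded_ops" "onf B (\<lambda>e. e)" "\<And>x. norm x = 1 \<Longrightarrow> \<exists>e\<in>B. cinner x e \<noteq> 0"
  shows "((\<lambda>e. cinner ((rk u v o\<^sub>L X) e) e) has_sum cinner (X v) u) B"
proof -
  have "((\<lambda>e. cinner v e * cinner e (cadjoint X u)) has_sum cinner v (cadjoint X u)) B"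
    by (rule Parseval[OF assms(2,3)])
  then show ?thesis by (simp add: cinner_rk cinner_cadjoint_right[OF assms(1)] mult.commute)
qed

text \<open>The Hoelder inequality for the exponents 1 and infinity: an entry of \<open>X\<close>
  between vectors of norm at most 1 is at most \<open>norm X\<close>.\<close>

lemma pairing_bounded_op:
  fixes X :: "'a::chilbert_space \<Rightarrow>\<^sub>L 'a" and c :: "'i \<Rightarrow> real"
  assumes "onf H w" "bessel H y" "\<And>u. u \<in> H \<Longrightarrow> c u \<ge> 0" "A \<ge> 0" "(\<Sum>u\<in>H. c u powr 1) \<le> A powr 1"
  shows "(\<Sum>u\<in>H. c u * cmod (cinner (X (w u)) (y u))) \<le> A * norm X"
proof -
  have "(\<Sum>u\<in>H. c u * cmod (cinner (X (w u)) (y u))) \<le> (\<Sum>u\<in>H. c u * norm X)"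
  proof (intro sum_mono mult_left_mono assms(3))
    fix u assume u: "u \<in> H"
    have "cmod (cinner (X (w u)) (y u)) \<le> norm X * norm (w u) * norm (y u)" by (rule cmod_cinner_blinfun_le)
    also have "\<dots> \<le> norm X"
      using assms(2) u mult_left_le[of "norm (y u)" "norm X"] by (simp add: onf_norm[OF assms(1) u] bessel_def)
    finally show "cmod (cinner (X (w u)) (y u)) \<le> norm X" .
  qed
  also have "\<dots> \<le> A * norm X"
    using assms(3-5) unfolding sum_distrib_right[symmetric] by (intro mult_right_mono) auto
  finally show ?thesis .
qed

lemma trace_represents_bounded_op:
  fixes X :: "'a::chilbert_space \<Rightarrow>\<^sub>L 'a"
  assumes X: "X \<in> bounded_ops"
  shows "\<exists>f. represents (schatten_class 1) (schatten_norm 1) (norm X) X f"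
proof -
  obtain B :: "'a set" where *: "onf B (\<lambda>e. e) \<and> (\<forall>x. norm x = 1 \<longrightarrow> (\<exists>e\<in>B. cinner x e \<noteq> 0))"
    using orthonormal_basis_exists by (rule exE)
  note B = conjunct1[OF *] conjunct2[OF *, rule_format]
  have "represents (schatten_class 1) (schatten_norm 1) (norm X) X (\<lambda>T. \<Sum>\<^sub>\<infinity>e\<in>B. cinner ((X o\<^sub>L T) e) e)"
  proof (rule trace_represents)
    fix T :: "'a \<Rightarrow>\<^sub>L 'a" and F assume T: "T \<in> schatten_class 1" and F: "finite F" "F \<subseteq> B"
    have "(\<Sum>e\<in>F. cmod (cinner (X (T e)) e)) \<le> schatten_norm 1 T * norm X"
    proof (rule trace_partial_sums_le[OF X T order_refl B(1) F])
      fix c :: "'a \<Rightarrow> real" and H and w y :: "'a \<Rightarrow> 'a" and A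
      assume H: "finite H" and w: "onf H w" and y: "bessel H y" and c: "\<And>u. u \<in> H \<Longrightarrow> c u \<ge> 0"
        and A: "A \<ge> 0" "(\<Sum>u\<in>H. c u powr 1) \<le> A powr 1"
      show "(\<Sum>u\<in>H. c u * cmod (cinner (X (w u)) (y u))) \<le> A * norm X"
        using w y c A by (rule pairing_bounded_op)
    qed
    then show "(\<Sum>e\<in>F. cmod (cinner ((X o\<^sub>L T) e) e)) \<le> norm X * schatten_norm 1 T" by (simp add: mult.commute)
  qed (rule trace_rk_right[OF X B] | simp add: X blinfun_compose_scaleC_right
      bounded_bilinear.add_right[OF bounded_bilinear_blinfun_compose])+
  then show ?thesis by blast
qed

lemma trace_represents_trace_class:
  fixes X :: "'a::chilbert_space \<Rightarrow>\<^sub>L 'a"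
  assumes X: "X \<in> schatten_class 1"
  shows "\<exists>f. represents compact_ops norm (schatten_norm 1 X) X f"
proof -
  obtain B :: "'a set" where *: "onf B (\<lambda>e. e) \<and> (\<forall>x. norm x = 1 \<longrightarrow> (\<exists>e\<in>B. cinner x e \<noteq> 0))"
    using orthonormal_basis_exists by (rule exE)
  note B = conjunct1[OF *] conjunct2[OF *, rule_format]
  \<comment> \<open>Here \<open>X\<close> is the trace class factor and stands on the right, while
    the compact \<open>T\<close> is treated as a bounded operator.\<close>
  have "represents compact_ops norm (schatten_norm 1 X) X (\<lambda>T. \<Sum>\<^sub>\<infinity>e\<in>B. cinner ((T o\<^sub>L X) e) e)"
  proof (rule trace_represents)
    fix T :: "'a \<Rightarrow>\<^sub>L 'a" and F assume T: "T \<in> compact_ops" and F: "finite F" "F \<subseteq> B"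
    have "(\<Sum>e\<in>F. cmod (cinner (T (X e)) e)) \<le> schatten_norm 1 X * norm T"
    proof (rule trace_partial_sums_le[OF compact_ops_bounded[OF T] X order_refl B(1) F])
      fix c :: "'a \<Rightarrow> real" and H and w y :: "'a \<Rightarrow> 'a" and A
      assume H: "finite H" and w: "onf H w" and y: "bessel H y" and c: "\<And>u. u \<in> H \<Longrightarrow> c u \<ge> 0"
        and A: "A \<ge> 0" "(\<Sum>u\<in>H. c u powr 1) \<le> A powr 1"
      show "(\<Sum>u\<in>H. c u * cmod (cinner (T (w u)) (y u))) \<le> A * norm T"
        using w y c A by (rule pairing_bounded_op)
    qed
    then show "(\<Sum>e\<in>F. cmod (cinner ((T o\<^sub>L X) e) e)) \<le> schatten_norm 1 X * norm T" by simp
  qed (rule trace_rk_left[OF schatten_bounded[OF X] B] | simp add: blinfun_compose_scaleC_left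
      bounded_bilinear.add_left[OF bounded_bilinear_blinfun_compose])+
  then show ?thesis by blast
qed

lemma trace_represents_schatten:
  fixes X :: "'a::chilbert_space \<Rightarrow>\<^sub>L 'a"
  assumes pq: "p > 1" "q > 1" "1/p + 1/q = 1" and X: "X \<in> schatten_class p"
  shows "\<exists>f. represents (schatten_class q) (schatten_norm q) (schatten_norm p X) X f"
proof -
  obtain B :: "'a set" where *: "onf B (\<lambda>e. e) \<and> (\<forall>x. norm x = 1 \<longrightarrow> (\<exists>e\<in>B. cinner x e \<noteq> 0))"
    using orthonormal_basis_exists by (rule exE)
  note B = conjunct1[OF *] conjunct2[OF *, rule_format]
  have q1: "q \<ge> 1" and p1: "p \<ge> 1" using pq by auto
  have "represents (schatten_class q) (schatten_norm q) (schatten_norm p X) X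
      (\<lambda>T. \<Sum>\<^sub>\<infinity>e\<in>B. cinner ((X o\<^sub>L T) e) e)"
  proof (rule trace_represents)
    fix T :: "'a \<Rightarrow>\<^sub>L 'a" and F assume T: "T \<in> schatten_class q" and F: "finite F" "F \<subseteq> B"
    have "(\<Sum>e\<in>F. cmod (cinner (X (T e)) e)) \<le> schatten_norm q T * schatten_norm p X"
    proof (rule trace_partial_sums_le[OF schatten_bounded[OF X] T q1 B(1) F])
      fix c :: "'a \<Rightarrow> real" and H and w y :: "'a \<Rightarrow> 'a" and A
      assume H: "finite H" and w: "onf H w" and y: "bessel H y" and c: "\<And>u. u \<in> H \<Longrightarrow> c u \<ge> 0"
        and A: "A \<ge> 0" "(\<Sum>u\<in>H. c u powr q) \<le> A powr q"
      show "(\<Sum>u\<in>H. c u * cmod (cinner (X (w u)) (y u))) \<le> A * schatten_norm p X"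
        by (rule Hoelder_sum[OF pq H c _ A(2,1) schatten_bessel_le[OF X p1 H onf_bessel[OF w H] y]]) auto
    qed
    then show "(\<Sum>e\<in>F. cmod (cinner ((X o\<^sub>L T) e) e)) \<le> schatten_norm p X * schatten_norm q T"
      by (simp add: mult.commute)
  qed (rule trace_rk_right[OF schatten_bounded[OF X] B] | simp add: schatten_bounded[OF X]
      blinfun_compose_scaleC_right bounded_bilinear.add_right[OF bounded_bilinear_blinfun_compose])+
  then show ?thesis by blast
qed

section \<open>Norm bounds for representing operators\<close>

lemma rk_add_left: "rk (u + u') v = rk u v + rk u' v"
  by (rule blinfun_eqI) (simp add: rk_apply blinfun.add_left cinner_add_right scaleC_add_left)

lemma rk_add_right: "rk u (v + v') = rk u v + rk u v'"
  by (rule blinfun_eqI) (simp add: rk_apply blinfun.add_left scaleC_add_right)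

lemma rk_scale_left: "rk (c *\<^sub>C u) v = cnj c *\<^sub>C rk u v"
  by (rule blinfun_eqI) (simp add: rk_apply scaleC_blinfun.rep_eq cinner_scaleC_right scaleC_scaleC)

lemma rk_scale_right: "rk u (c *\<^sub>C v) = c *\<^sub>C rk u v"
  by (rule blinfun_eqI) (simp add: rk_apply scaleC_blinfun.rep_eq scaleC_scaleC mult.commute)

lemma represents_lincomb:
  fixes u v :: "'i \<Rightarrow> 'a::chilbert_space"
  assumes f: "represents \<T> M K X f" and \<T>: "cvec.subspace \<T>" "\<And>u v. rk u v \<in> \<T>" and "finite I"
  shows "f (\<Sum>i\<in>I. c i *\<^sub>C rk (u i) (v i)) = (\<Sum>i\<in>I. c i * cinner (X (v i)) (u i))"
proof -
  have zero: "f 0 = 0"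
    using f \<T>(2)[of 0 0] unfolding represents_def by (metis cvec.scale_zero_left mult_zero_left)
  have "(\<Sum>i\<in>I. c i *\<^sub>C rk (u i) (v i)) \<in> \<T> \<and>
      f (\<Sum>i\<in>I. c i *\<^sub>C rk (u i) (v i)) = (\<Sum>i\<in>I. c i * cinner (X (v i)) (u i))"
    using \<open>finite I\<close>
  proof (induction I)
    case empty
    then show ?case using zero cvec.subspace_0[OF \<T>(1)] by simp
  next
    case (insert i I)
    have "c i *\<^sub>C rk (u i) (v i) \<in> \<T>" by (rule cvec.subspace_scale[OF \<T>])
    then show ?case
      using insert f \<T>(2) cvec.subspace_add[OF \<T>(1)] unfolding represents_def by simp
  qed
  then show ?thesis ..
qed

text \<open>The counterpart of \<open>schatten_lincomb\<close> for the operator norm: Pythagoras for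
  \<open>v\<close> and Bessel's inequality for \<open>u\<close> make the test operator a
  contraction.\<close>

lemma norm_lincomb_rk_le_1:
  fixes u v :: "'i \<Rightarrow> 'a::chilbert_space"
  assumes "finite I" "onf I u" "onf I v" "\<And>i. cmod (c i) \<le> 1"
  shows "norm (\<Sum>i\<in>I. c i *\<^sub>C rk (u i) (v i)) \<le> 1"
proof (rule norm_blinfun_bound)
  fix x
  have "(norm (\<Sum>i\<in>I. (c i * cinner x (u i)) *\<^sub>C v i))\<^sup>2 = (\<Sum>i\<in>I. (cmod (c i * cinner x (u i)))\<^sup>2)"
    by (rule onf_norm_lincomb[OF assms(3,1)])
  also have "\<dots> \<le> (\<Sum>i\<in>I. (cmod (cinner x (u i)))\<^sup>2)"
  proof (intro sum_mono power_mono)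
    show "cmod (c i * cinner x (u i)) \<le> cmod (cinner x (u i))" for i
      using mult_right_mono[OF assms(4)[of i] norm_ge_zero[of "cinner x (u i)"]] by (simp add: norm_mult)
  qed simp
  also have "\<dots> \<le> (norm x)\<^sup>2" by (rule Bessel[OF assms(2,1)])
  finally have "norm (\<Sum>i\<in>I. (c i * cinner x (u i)) *\<^sub>C v i) \<le> norm x"
    by (rule power2_le_imp_le) simp
  then show "norm ((\<Sum>i\<in>I. c i *\<^sub>C rk (u i) (v i)) x) \<le> 1 * norm x"
    by (simp add: blinfun.sum_left scaleC_blinfun.rep_eq rk_apply scaleC_scaleC)
qed simp

text \<open>Rank-one operators suffice as tests, because the trace norm of \<open>rk y x\<close> is
  at most \<open>norm y * norm x\<close>.\<close>

lemma represented_bounded_op: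
  fixes X :: "'a::chilbert_space \<Rightarrow>\<^sub>L 'a"
  assumes f: "represents (schatten_class 1) (schatten_norm 1) K X f" and K: "K \<ge> 0"
  shows "norm X \<le> K"
proof (rule norm_blinfun_cinner_le)
  fix x y :: 'a
  have "cmod (f (rk y x)) \<le> K * schatten_norm 1 (rk y x)"
    by (rule represents_bound[OF f schatten_rk(1)[OF order_refl]])
  also have "\<dots> \<le> K * (norm y * norm x)" using K schatten_rk(2)[of 1] by (intro mult_left_mono) auto
  finally show "cmod (cinner (X x) y) \<le> K * norm x * norm y"
    by (simp add: represents_rk[OF f] mult_ac)
qed (rule K)

text \<open>Coefficients that cancel the phases of the entries make \<open>f T\<close> the sum of
  their moduli, while \<open>T\<close> remains a contraction.\<close>

lemma represented_trace_class:
  fixes X :: "'a::chilbert_space \<Rightarrow>\<^sub>L 'a"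
  assumes X: "X \<in> bounded_ops" and f: "represents compact_ops norm K X f" and K: "K \<ge> 0"
  shows "X \<in> schatten_class 1 \<and> schatten_norm 1 X \<le> K"
proof -
  have "pbound 1 K X" unfolding pbound_def
  proof (intro allI impI)
    fix n :: nat and e g :: "nat \<Rightarrow> 'a"
    assume on: "onf {..<n} e" "onf {..<n} g"
    define c where "c i = cnj (sgn (cinner (X (e i)) (g i)))" for i
    define T where "T = (\<Sum>i<n. c i *\<^sub>C rk (g i) (e i))"
    have "f T = (\<Sum>i<n. c i * cinner (X (e i)) (g i))"
      unfolding T_def by (rule represents_lincomb[OF f subspace_compact_ops rk_compact finite_lessThan])
    also have "\<dots> = complex_of_real (\<Sum>i<n. cmod (cinner (X (e i)) (g i)))"
      unfolding of_real_sum c_def by (intro sum.cong refl) (metis mult.commute mult_cnj_sgn)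
    finally have "cmod (f T) = \<bar>\<Sum>i<n. cmod (cinner (X (e i)) (g i))\<bar>" by (simp only: norm_of_real)
    then have "(\<Sum>i<n. cmod (cinner (X (e i)) (g i))) \<le> cmod (f T)" by (simp only: abs_ge_self)
    also have "\<dots> \<le> K * norm T"
    proof -
      have "T \<in> finrank" unfolding T_def by (intro finrank_sum finrank_scale rk_finrank)
      then show ?thesis by (intro represents_bound[OF f] finrank_compact)
    qed
    also have "\<dots> \<le> K * 1"
      unfolding T_def using K on by (intro mult_left_mono norm_lincomb_rk_le_1) (auto simp: c_def norm_sgn)
    finally show "(\<Sum>i<n. cmod (cinner (X (e i)) (g i)) powr 1) \<le> K powr 1" using K by simp
  qed
  then show ?thesis using pbound_schatten[OF X _ _ K, of 1] by simp
qed

text \<open>The coefficients are the extremal ones of Hoelder's inequality: the phase is cancelled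
  and the modulus is \<open>a i powr (p - 1)\<close>. Since \<open>(p - 1) * q = p\<close>, both
  \<open>f T\<close> and the \<open>q\<close>-th power of the norm of \<open>T\<close> are
  controlled by the same sum \<open>A\<close>.\<close>

lemma represented_schatten:
  fixes X :: "'a::chilbert_space \<Rightarrow>\<^sub>L 'a"
  assumes pq: "p > 1" "q > 1" "1/p + 1/q = 1"
    and X: "X \<in> bounded_ops" and f: "represents (schatten_class q) (schatten_norm q) K X f" and K: "K \<ge> 0"
  shows "X \<in> schatten_class p \<and> schatten_norm p X \<le> K"
proof -
  have q1: "q \<ge> 1" using pq by simp
  have pq': "(p - 1) * q = p" using pq by (simp add: field_simps)
  have "pbound p K X" unfolding pbound_def
  proof (intro allI impI)
    fix n :: nat and e g :: "nat \<Rightarrow> 'a"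
    assume on: "onf {..<n} e" "onf {..<n} g"
    define a where "a i = cmod (cinner (X (e i)) (g i))" for i
    define c where "c i = complex_of_real (a i powr (p - 1)) * cnj (sgn (cinner (X (e i)) (g i)))" for i
    define T where "T = (\<Sum>i<n. c i *\<^sub>C rk (g i) (e i))"
    define A where "A = (\<Sum>i<n. a i powr p)"
    have A0: "A \<ge> 0" unfolding A_def by (rule sum_nonneg) simp
    note T_norm = schatten_lincomb[OF q1 finite_lessThan on(2,1), of c, folded T_def]
    have "f T = (\<Sum>i<n. c i * cinner (X (e i)) (g i))"
      unfolding T_def using represents_lincomb[OF f subspace_schatten[OF q1] schatten_rk(1)[OF q1] finite_lessThan] .
    also have "\<dots> = complex_of_real A"
      unfolding of_real_sum A_def
    proof (intro sum.cong refl)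
      fix i
      have "c i * cinner (X (e i)) (g i) = complex_of_real (a i powr (p - 1) * a i)"
        using mult_cnj_sgn[of "cinner (X (e i)) (g i)"] by (simp add: c_def a_def mult_ac)
      also have "a i powr (p - 1) * a i = a i powr p"
        using powr_add[of "a i" "p - 1" 1] by (simp add: a_def)
      finally show "c i * cinner (X (e i)) (g i) = complex_of_real (a i powr p)" .
    qed
    finally have "A \<le> cmod (f T)" by simp
    also have "\<dots> \<le> K * schatten_norm q T" by (rule represents_bound[OF f T_norm(1)])
    also have "\<dots> \<le> K * A powr (1 / q)"
    proof -
      have "cmod (c i) powr q \<le> a i powr p" for i
      proof -
        have "cmod (c i) \<le> a i powr (p - 1)"
          unfolding c_def norm_mult using cmod_cnj_sgn_le[of "cinner (X (e i)) (g i)"]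
          by (simp add: mult_left_le)
        then have "cmod (c i) powr q \<le> (a i powr (p - 1)) powr q" using pq by (intro powr_mono2) auto
        then show ?thesis by (simp add: powr_powr pq')
      qed
      then have "(\<Sum>i<n. cmod (c i) powr q) powr (1 / q) \<le> A powr (1 / q)"
        unfolding A_def using pq by (intro powr_mono2 sum_mono sum_nonneg) auto
      then show ?thesis using T_norm(2) K by (intro mult_left_mono) auto
    qed
    finally have le: "A \<le> K * A powr (1 / q)" .
    \<comment> \<open>The factor \<open>A powr (1 / q)\<close> is cancelled, so \<open>A = 0\<close>
      is separated; the remaining exponent is \<open>1 - 1/q = 1/p\<close>.\<close>
    have "A \<le> K powr p"
    proof (cases "A = 0")
      case False
      then have A: "A > 0" using A0 by simp
      have "A powr (1 / p) * A powr (1 / q) = A" using A pq(3) by (simp flip: powr_add)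
      then have "A powr (1 / p) * A powr (1 / q) \<le> K * A powr (1 / q)" using le by simp
      then have "A powr (1 / p) \<le> K" using A by simp
      then have "(A powr (1 / p)) powr p \<le> K powr p" using pq by (intro powr_mono2) auto
      then show ?thesis using A pq by (simp add: powr_powr)
    qed simp
    then show "(\<Sum>i<n. cmod (cinner (X (e i)) (g i)) powr p) \<le> K powr p" by (simp add: A_def a_def)
  qed
  then show ?thesis using pbound_schatten[OF X _ _ K, of p] pq by simp
qed

section \<open>Duality for the skew parts\<close>

text \<open>\<open>\<S>\<close> with \<open>N\<close> is the dual side and \<open>\<T>\<close> with
  \<open>M\<close> the predual. The duality of the full classes is condensed in
  \<open>exists_rep\<close> and \<open>rep\<close>, of which \<open>rep\<close> also returns sums
  and multiples of members of \<open>\<S>\<close> to \<open>\<S>\<close>. The conditions on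
  \<open>M\<close> make the projection onto the skew part a contraction and let finite rank
  operators determine functionals.\<close>

locale skew_dual_pair =
  fixes C :: "'a::chilbert_space \<Rightarrow> 'a"
    and \<S> :: "('a \<Rightarrow>\<^sub>L 'a) set" and N :: "('a \<Rightarrow>\<^sub>L 'a) \<Rightarrow> real"
    and \<T> :: "('a \<Rightarrow>\<^sub>L 'a) set" and M :: "('a \<Rightarrow>\<^sub>L 'a) \<Rightarrow> real"
  assumes conj: "conjugation C"
    and \<T>_sub: "cvec.subspace \<T>" and \<T>_bounded: "\<T> \<subseteq> bounded_ops"
    and M_nonneg: "\<And>T. M T \<ge> 0"
    and M_add: "\<And>S T. S \<in> \<T> \<Longrightarrow> T \<in> \<T> \<Longrightarrow> M (S + T) \<le> M S + M T"
    and M_scale: "\<And>c T. T \<in> \<T> \<Longrightarrow> M (c *\<^sub>C T) \<le> cmod c * M T"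
    and \<T>_ctrans: "\<And>T. T \<in> \<T> \<Longrightarrow> ctrans C T \<in> \<T>" and M_ctrans: "\<And>T. T \<in> \<T> \<Longrightarrow> M (ctrans C T) \<le> M T"
    and \<T>_rk: "\<And>u v. rk u v \<in> \<T>" and M_rk: "\<And>u v. M (rk u v) \<le> norm u * norm v"
    and \<T>_approx: "\<And>T \<epsilon>. T \<in> \<T> \<Longrightarrow> \<epsilon> > 0 \<Longrightarrow> \<exists>F\<in>finrank. M (T - F) \<le> \<epsilon>"
    and \<S>_bounded: "\<S> \<subseteq> bounded_ops" and N_nonneg: "\<And>X. N X \<ge> 0"
    and exists_rep: "\<And>X. X \<in> \<S> \<Longrightarrow> \<exists>f. represents \<T> M (N X) X f"
    and rep: "\<And>X K f. X \<in> bounded_ops \<Longrightarrow> K \<ge> 0 \<Longrightarrow> represents \<T> M K X f \<Longrightarrow> X \<in> \<S> \<and> N X \<le> K"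
begin

lemma finrank_\<T>: "F \<in> finrank \<Longrightarrow> F \<in> \<T>"
  by (induction rule: finrank_induct)
     (auto intro: cvec.subspace_0[OF \<T>_sub] cvec.subspace_add[OF \<T>_sub] cvec.subspace_scale[OF \<T>_sub] \<T>_rk)

lemma represents_unique:
  assumes f: "represents \<T> M K X f" and g: "represents \<T> M L X g" and T: "T \<in> \<T>"
  shows "f T = g T"
proof -
  have fin: "f F = g F" if "F \<in> finrank" for F
    using that
  proof (induction rule: finrank_induct)
    case zero
    have "f 0 = 0" "g 0 = 0"
      using represents_scale[OF f, of 0 0] represents_scale[OF g, of 0 0] cvec.subspace_0[OF \<T>_sub] by simp_all
    then show ?case by simp
  next
    case (step c u v F)
    have "c *\<^sub>C rk u v \<in> \<T>" by (rule cvec.subspace_scale[OF \<T>_sub \<T>_rk])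
    then show ?case
      using step finrank_\<T>[OF step(1)] by (simp add: represents_add[OF f] represents_add[OF g]
          represents_scale[OF f \<T>_rk] represents_scale[OF g \<T>_rk] represents_rk[OF f] represents_rk[OF g])
  qed
  have "cmod (f T - g T) \<le> 0"
  proof (rule field_le_epsilon)
    fix \<epsilon> :: real assume \<epsilon>: "\<epsilon> > 0"
    \<comment> \<open>The denominator dominates \<open>K + L\<close> whatever their signs, and it is
      positive.\<close>
    define \<delta> where "\<delta> = \<epsilon> / (\<bar>K\<bar> + \<bar>L\<bar> + 1)"
    have \<delta>: "\<delta> > 0" using \<epsilon> by (simp add: \<delta>_def)
    obtain F where F: "F \<in> finrank" "M (T - F) \<le> \<delta>" using \<T>_approx[OF T \<delta>] by blast
    have D: "T - F \<in> \<T>" by (rule cvec.subspace_diff[OF \<T>_sub T finrank_\<T>[OF F(1)]])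
    have "f T = f (T - F) + f F" "g T = g (T - F) + g F"
      using represents_add[OF f D finrank_\<T>[OF F(1)]] represents_add[OF g D finrank_\<T>[OF F(1)]] by simp_all
    then have "f T - g T = f (T - F) - g (T - F)" using fin[OF F(1)] by simp
    then have "cmod (f T - g T) \<le> cmod (f (T - F)) + cmod (g (T - F))" by (simp add: norm_triangle_ineq4)
    also have "\<dots> \<le> K * M (T - F) + L * M (T - F)"
      by (intro add_mono represents_bound[OF f] represents_bound[OF g] D)
    also have "\<dots> \<le> (\<bar>K\<bar> + \<bar>L\<bar> + 1) * M (T - F)"
      unfolding distrib_right[symmetric] by (intro mult_right_mono M_nonneg) simp
    also have "\<dots> \<le> (\<bar>K\<bar> + \<bar>L\<bar> + 1) * \<delta>" by (intro mult_left_mono F(2)) simp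
    also have "\<dots> = \<epsilon>" by (simp add: \<delta>_def)
    finally show "cmod (f T - g T) \<le> 0 + \<epsilon>" by simp
  qed
  then show ?thesis by simp
qed

text \<open>On \<open>\<T>\<close> the choice is canonical by \<open>represents_unique\<close>.
  Additivity and homogeneity in \<open>X\<close> follow from this: the sum or multiple of the
  functionals represents the sum or multiple of the operators.\<close>

definition functional :: "('a \<Rightarrow>\<^sub>L 'a) \<Rightarrow> ('a \<Rightarrow>\<^sub>L 'a) \<Rightarrow> complex" where
  "functional X = (SOME f. represents \<T> M (N X) X f)"

lemma functional: "X \<in> \<S> \<Longrightarrow> represents \<T> M (N X) X (functional X)"
  unfolding functional_def using exists_rep by (rule someI_ex)

lemma functional_eq:
  assumes "X \<in> bounded_ops" "K \<ge> 0" "represents \<T> M K X f" "T \<in> \<T>"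
  shows "functional X T = f T"
  using represents_unique[OF functional assms(3,4)] rep[OF assms(1-3)] by simp

lemma functional_add:
  assumes X: "X \<in> \<S>" and Y: "Y \<in> \<S>" and T: "T \<in> \<T>"
  shows "functional (X + Y) T = functional X T + functional Y T"
proof -
  note fX = functional[OF X] and fY = functional[OF Y]
  have r: "represents \<T> M (N X + N Y) (X + Y) (\<lambda>T. functional X T + functional Y T)"
    unfolding represents_def
  proof (intro conjI ballI allI)
    fix T assume T: "T \<in> \<T>"
    show "cmod (functional X T + functional Y T) \<le> (N X + N Y) * M T"
      unfolding distrib_right
      by (rule order_trans[OF norm_triangle_ineq add_mono[OF represents_bound[OF fX T] represents_bound[OF fY T]]])
  qed (simp_all add: represents_add[OF fX] represents_add[OF fY] represents_scale[OF fX] represents_scale[OF fY]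
      represents_rk[OF fX] represents_rk[OF fY] blinfun.add_left cinner_add_left distrib_left)
  have b: "X + Y \<in> bounded_ops" using X Y \<S>_bounded cvec.subspace_add[OF subspace_bounded_ops] by blast
  have K: "N X + N Y \<ge> 0" by (intro add_nonneg_nonneg N_nonneg)
  show ?thesis by (rule functional_eq[OF b K r T])
qed

lemma functional_scale:
  assumes X: "X \<in> \<S>" and T: "T \<in> \<T>"
  shows "functional (c *\<^sub>C X) T = c * functional X T"
proof -
  note fX = functional[OF X]
  have r: "represents \<T> M (cmod c * N X) (c *\<^sub>C X) (\<lambda>T. c * functional X T)"
    unfolding represents_def
  proof (intro conjI ballI allI)
    fix T assume T: "T \<in> \<T>"
    show "cmod (c * functional X T) \<le> cmod c * N X * M T"
      using mult_left_mono[OF represents_bound[OF fX T] norm_ge_zero[of c]] by (simp add: norm_mult mult.assoc)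
  qed (simp_all add: represents_add[OF fX] represents_scale[OF fX]
      represents_rk[OF fX] scaleC_blinfun.rep_eq cinner_scaleC_left distrib_left)
  have b: "c *\<^sub>C X \<in> bounded_ops" using X \<S>_bounded cvec.subspace_scale[OF subspace_bounded_ops] by blast
  have K: "cmod c * N X \<ge> 0" by (intro mult_nonneg_nonneg N_nonneg norm_ge_zero)
  show ?thesis by (rule functional_eq[OF b K r T])
qed

section \<open>The projection onto the skew operators\<close>

lemma skew_iff: "X \<in> bounded_ops \<Longrightarrow> X \<in> skew_ops C \<longleftrightarrow> ctrans C X = - X"
  by (simp add: skew_ops_eq[OF conj])

lemma subspace_skew: "cvec.subspace (skew_ops C)"
  unfolding skew_ops_eq[OF conj] cvec.subspace_def
proof (intro conjI ballI allI; (elim CollectE conjE)?; intro CollectI conjI)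
  have "0 *\<^sub>C ctrans C 0 = ctrans C (0 *\<^sub>C 0)"
    by (rule ctrans_scale[OF conj cvec.subspace_0[OF subspace_bounded_ops], symmetric])
  then show "ctrans C 0 = - 0" by simp
qed (simp_all add: cvec.subspace_0 cvec.subspace_add cvec.subspace_scale subspace_bounded_ops
    ctrans_add[OF conj] ctrans_scale[OF conj])

lemma subspace_skew_\<T>: "cvec.subspace (skew_ops C \<inter> \<T>)"
  by (rule cvec.subspace_inter[OF subspace_skew \<T>_sub])

definition skew_part :: "('a \<Rightarrow>\<^sub>L 'a) \<Rightarrow> ('a \<Rightarrow>\<^sub>L 'a)" where
  "skew_part T = (1 / 2) *\<^sub>C (T - ctrans C T)"

lemma \<T>_boundedD: "T \<in> \<T> \<Longrightarrow> T \<in> bounded_ops"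
  using \<T>_bounded by blast

lemma ctrans_minus: "T \<in> bounded_ops \<Longrightarrow> ctrans C (- T) = - ctrans C T"
  using ctrans_scale[OF conj, of T "-1"] by (simp add: scaleC_minus1_left)

lemma skew_part_skew: "T \<in> \<T> \<Longrightarrow> skew_part T \<in> skew_ops C \<inter> \<T>"
proof
  assume T: "T \<in> \<T>"
  show D: "skew_part T \<in> \<T>"
    unfolding skew_part_def by (intro cvec.subspace_scale[OF \<T>_sub] cvec.subspace_diff[OF \<T>_sub] T \<T>_ctrans)
  have b: "T \<in> bounded_ops" "ctrans C T \<in> bounded_ops" using T \<T>_ctrans \<T>_bounded by blast+
  have b': "T - ctrans C T \<in> bounded_ops" "- ctrans C T \<in> bounded_ops"
    using b by (auto intro: cvec.subspace_diff cvec.subspace_neg subspace_bounded_ops)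
  have "ctrans C (T - ctrans C T) = ctrans C T - T"
    using ctrans_add[OF conj b(1) b'(2)] by (simp add: ctrans_minus b ctrans_ctrans[OF conj])
  then have "ctrans C (skew_part T) = (1 / 2) *\<^sub>C (ctrans C T - T)"
    unfolding skew_part_def by (simp add: ctrans_scale[OF conj b'(1)])
  also have "\<dots> = - skew_part T"
    unfolding skew_part_def by (simp flip: cvec.scale_minus_right)
  finally show "skew_part T \<in> skew_ops C" by (simp add: skew_iff[OF \<T>_boundedD[OF D]])
qed

lemma skew_part_eq: "T \<in> skew_ops C \<inter> \<T> \<Longrightarrow> skew_part T = T"
proof -
  assume T: "T \<in> skew_ops C \<inter> \<T>"
  then have "ctrans C T = - T" by (simp add: skew_ops_eq[OF conj])
  then show ?thesis
    by (simp add: skew_part_def scaleC_add_right flip: scaleC_add_left)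
qed

lemma M_skew_part: "T \<in> \<T> \<Longrightarrow> M (skew_part T) \<le> M T"
proof -
  assume T: "T \<in> \<T>"
  have m: "(-1) *\<^sub>C ctrans C T \<in> \<T>" by (intro cvec.subspace_scale[OF \<T>_sub] \<T>_ctrans T)
  have "skew_part T = (1 / 2) *\<^sub>C (T + (-1) *\<^sub>C ctrans C T)"
    by (simp add: skew_part_def scaleC_minus1_left)
  also have "M \<dots> \<le> 1 / 2 * M (T + (-1) *\<^sub>C ctrans C T)"
    using M_scale[OF cvec.subspace_add[OF \<T>_sub T m], of "1/2"] by (simp add: norm_divide)
  also have "\<dots> \<le> 1 / 2 * (M T + M T)"
    using M_add[OF T m] M_scale[OF \<T>_ctrans[OF T], of "-1"] M_ctrans[OF T] by simp
  finally show ?thesis by simp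
qed

lemma skew_part_add: "S \<in> \<T> \<Longrightarrow> T \<in> \<T> \<Longrightarrow> skew_part (S + T) = skew_part S + skew_part T"
  by (simp add: skew_part_def ctrans_add[OF conj \<T>_boundedD \<T>_boundedD] flip: scaleC_add_right)

lemma skew_part_scale: "T \<in> \<T> \<Longrightarrow> skew_part (c *\<^sub>C T) = c *\<^sub>C skew_part T"
  by (simp add: skew_part_def ctrans_scale[OF conj \<T>_boundedD] scaleC_scaleC mult.commute
      flip: cvec.scale_right_diff_distrib)

lemma skew_part_ctrans: "T \<in> \<T> \<Longrightarrow> skew_part (ctrans C T) = (-1) *\<^sub>C skew_part T"
  by (simp add: skew_part_def ctrans_ctrans[OF conj \<T>_boundedD] scaleC_minus1_left flip: cvec.scale_minus_right)

text \<open>The trace pairing is invariant under the involution \<open>X \<mapsto> C X\<^sup>* C\<close>, hence a skew \<open>X\<close>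
  only sees the skew part of \<open>T\<close>.\<close>

lemma functional_skew_part:
  assumes X: "X \<in> skew_ops C \<inter> \<S>" and T: "T \<in> \<T>"
  shows "functional X (skew_part T) = functional X T"
proof -
  have X': "X \<in> \<S>" "ctrans C X = - X" "X \<in> bounded_ops" using X \<S>_bounded by (auto simp: skew_ops_eq[OF conj])
  note f = functional[OF X'(1)]
  \<comment> \<open>On \<open>rk u v\<close> the composition with \<open>ctrans C\<close> has the
    value \<open>cinner (ctrans C X v) u\<close>, and the sign compensates
    \<open>ctrans C X = - X\<close>. By uniqueness this functional is the original one.\<close>
  have "represents \<T> M (N X) X (\<lambda>T. - functional X (ctrans C T))"
    unfolding represents_def
  proof (intro conjI ballI allI)
    fix T assume T: "T \<in> \<T>"
    have "cmod (functional X (ctrans C T)) \<le> N X * M (ctrans C T)"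
      by (rule represents_bound[OF f \<T>_ctrans[OF T]])
    also have "\<dots> \<le> N X * M T" by (intro mult_left_mono M_ctrans T N_nonneg)
    finally show "cmod (- functional X (ctrans C T)) \<le> N X * M T" by simp
  next
    fix u v
    have "functional X (ctrans C (rk u v)) = cinner (ctrans C X v) u"
      by (simp add: ctrans_rk[OF conj] represents_rk[OF f] cinner_ctrans[OF conj X'(3)])
    then show "- functional X (ctrans C (rk u v)) = cinner (X v) u"
      by (simp add: X'(2) blinfun.minus_left cinner_minus_left)
  qed (simp_all add: ctrans_add[OF conj \<T>_boundedD \<T>_boundedD] ctrans_scale[OF conj \<T>_boundedD] \<T>_ctrans
      represents_add[OF f] represents_scale[OF f])
  then have *: "functional X T = - functional X (ctrans C T)" by (rule represents_unique[OF f _ T])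
  have m: "(-1) *\<^sub>C ctrans C T \<in> \<T>" by (intro cvec.subspace_scale[OF \<T>_sub] \<T>_ctrans T)
  have "skew_part T = (1 / 2) *\<^sub>C (T + (-1) *\<^sub>C ctrans C T)"
    by (simp add: skew_part_def scaleC_minus1_left)
  then have "functional X (skew_part T) = 1 / 2 * (functional X T + (-1) * functional X (ctrans C T))"
    by (simp only: represents_scale[OF f cvec.subspace_add[OF \<T>_sub T m]] represents_add[OF f T m]
        represents_scale[OF f \<T>_ctrans[OF T]])
  then show ?thesis using * by simp
qed

section \<open>The isometry onto the dual of the skew part\<close>

definition embedding :: "('a \<Rightarrow>\<^sub>L 'a) \<Rightarrow> ('a \<Rightarrow>\<^sub>L 'a) \<Rightarrow> complex" where
  "embedding X = restrict (functional X) (skew_ops C \<inter> \<T>)"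

lemma embedding_in_dual:
  assumes X: "X \<in> skew_ops C \<inter> \<S>"
  shows "embedding X \<in> dual_space (skew_ops C \<inter> \<T>) M"
proof -
  have f: "represents \<T> M (N X) X (functional X)" using X by (intro functional) simp
  show ?thesis unfolding dual_space_def mem_Collect_eq
  proof (intro conjI ballI allI exI)
    show "embedding X \<in> extensional (skew_ops C \<inter> \<T>)" by (simp add: embedding_def)
    show "cmod (embedding X T) \<le> N X * M T" if "T \<in> skew_ops C \<inter> \<T>" for T
      using that represents_bound[OF f] by (simp add: embedding_def)
  qed (simp_all add: embedding_def cvec.subspace_add[OF subspace_skew] cvec.subspace_add[OF \<T>_sub]
      cvec.subspace_scale[OF subspace_skew] cvec.subspace_scale[OF \<T>_sub]
      represents_add[OF f] represents_scale[OF f])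
qed

text \<open>\<open>rk u v\<close> is not skew in general, but the functional of a skew operator
  takes the same value on its skew part. Hence the restriction still determines every entry of
  \<open>X\<close>.\<close>

lemma embedding_inj: "inj_on embedding (skew_ops C \<inter> \<S>)"
proof (rule inj_onI, rule blinfun_cinner_eqI)
  fix X Y v u
  assume X: "X \<in> skew_ops C \<inter> \<S>" and Y: "Y \<in> skew_ops C \<inter> \<S>" and eq: "embedding X = embedding Y"
  have f: "represents \<T> M (N X) X (functional X)" "represents \<T> M (N Y) Y (functional Y)"
    using X Y by (auto intro: functional)
  have "functional X (rk u v) = embedding X (skew_part (rk u v))"
    using functional_skew_part[OF X \<T>_rk] skew_part_skew[OF \<T>_rk] by (simp add: embedding_def)
  also have "\<dots> = functional Y (rk u v)"
    unfolding eq using functional_skew_part[OF Y \<T>_rk] skew_part_skew[OF \<T>_rk] by (simp add: embedding_def)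
  finally show "cinner (X v) u = cinner (Y v) u" by (simp add: represents_rk[OF f(1)] represents_rk[OF f(2)])
qed

lemma embedding_surj:
  assumes \<phi>: "\<phi> \<in> dual_space (skew_ops C \<inter> \<T>) M"
  shows "\<phi> \<in> embedding ` (skew_ops C \<inter> \<S>)"
proof -
  have \<phi>_ext: "\<phi> \<in> extensional (skew_ops C \<inter> \<T>)"
    and \<phi>_add: "\<And>S T. S \<in> skew_ops C \<inter> \<T> \<Longrightarrow> T \<in> skew_ops C \<inter> \<T> \<Longrightarrow> \<phi> (S + T) = \<phi> S + \<phi> T"
    and \<phi>_scale: "\<And>c T. T \<in> skew_ops C \<inter> \<T> \<Longrightarrow> \<phi> (c *\<^sub>C T) = c * \<phi> T"
    using \<phi> unfolding dual_space_def by auto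
  obtain L where "\<forall>T\<in>skew_ops C \<inter> \<T>. cmod (\<phi> T) \<le> L * M T"
    using \<phi> unfolding dual_space_def by blast
  note L = this[rule_format]
  define K where "K = \<bar>L\<bar>"
  have K: "K \<ge> 0" by (simp add: K_def)
  define f where "f T = \<phi> (skew_part T)" for T
  have f_add: "f (S + T) = f S + f T" if "S \<in> \<T>" "T \<in> \<T>" for S T
    unfolding f_def skew_part_add[OF that] by (intro \<phi>_add skew_part_skew that)
  have f_scale: "f (c *\<^sub>C T) = c * f T" if "T \<in> \<T>" for c T
    unfolding f_def skew_part_scale[OF that] by (intro \<phi>_scale skew_part_skew that)
  have f_bound: "cmod (f T) \<le> K * M T" if T: "T \<in> \<T>" for T
  proof -
    have "cmod (f T) \<le> L * M (skew_part T)" unfolding f_def by (intro L skew_part_skew T)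
    also have "\<dots> \<le> K * M (skew_part T)" unfolding K_def by (intro mult_right_mono M_nonneg) simp
    also have "\<dots> \<le> K * M T" by (intro mult_left_mono M_skew_part T K)
    finally show ?thesis .
  qed
  \<comment> \<open>The order \<open>rk y x\<close> makes the form linear in \<open>x\<close> and
    conjugate-linear in \<open>y\<close>.\<close>
  have "\<exists>X\<in>bounded_ops. \<forall>x y. cinner (blinfun_apply X x) y = f (rk y x)"
  proof (rule bounded_ops_exists[where K = K])
    show "f (rk z (x + y)) = f (rk z x) + f (rk z y)" for x y z by (simp add: rk_add_right f_add \<T>_rk)
    show "f (rk z (c *\<^sub>C x)) = c * f (rk z x)" for c x z by (simp add: rk_scale_right f_scale \<T>_rk)
    show "f (rk (x + y) z) = f (rk x z) + f (rk y z)" for x y z by (simp add: rk_add_left f_add \<T>_rk)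
    show "f (rk (c *\<^sub>C x) z) = cnj c * f (rk x z)" for c x z by (simp add: rk_scale_left f_scale \<T>_rk)
    show "cmod (f (rk y x)) \<le> K * norm x * norm y" for x y
      using order_trans[OF f_bound[OF \<T>_rk] mult_left_mono[OF M_rk[of y x] K]] by (simp add: mult_ac)
  qed
  then obtain X where X: "X \<in> bounded_ops" "\<And>x y. cinner (blinfun_apply X x) y = f (rk y x)" by blast
  have r: "represents \<T> M K X f"
    unfolding represents_def using f_add f_scale f_bound X(2) by simp
  \<comment> \<open>The extension \<open>f\<close> changes sign under \<open>ctrans C\<close>,
    because the skew part does; on rank-one operators this is skewness of \<open>X\<close>.\<close>
  have "ctrans C X = - X"
  proof (rule blinfun_cinner_eqI)
    fix x y
    have "cinner (ctrans C X x) y = f (ctrans C (rk y x))"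
      by (simp add: cinner_ctrans[OF conj X(1)] X(2) ctrans_rk[OF conj])
    also have "\<dots> = \<phi> ((-1) *\<^sub>C skew_part (rk y x))"
      unfolding f_def skew_part_ctrans[OF \<T>_rk] ..
    also have "\<dots> = - f (rk y x)"
      unfolding f_def \<phi>_scale[OF skew_part_skew[OF \<T>_rk]] by simp
    finally show "cinner (ctrans C X x) y = cinner ((- X) x) y"
      by (simp add: X(2) blinfun.minus_left cinner_minus_left)
  qed
  then have XS: "X \<in> skew_ops C \<inter> \<S>" using rep[OF X(1) K r] by (simp add: skew_iff[OF X(1)])
  have "\<phi> T = embedding X T" for T
  proof (cases "T \<in> skew_ops C \<inter> \<T>")
    case True
    then have "embedding X T = functional X T" by (simp add: embedding_def)
    also have "\<dots> = f T" using True by (intro functional_eq[OF X(1) K r]) simp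
    also have "\<dots> = \<phi> T" unfolding f_def skew_part_eq[OF True] ..
    finally show ?thesis ..
  next
    case False
    then show ?thesis using extensional_arb[OF \<phi>_ext False]
      by (simp only: embedding_def restrict_def if_False)
  qed
  then have "\<phi> = embedding X" by (rule ext)
  then show ?thesis using XS by (rule image_eqI)
qed

text \<open>The dual norm \<open>D\<close> bounds the functional on skew operators, and by the
  contraction onto the skew part it bounds it on all of \<open>\<T>\<close>. So \<open>X\<close>
  represents a functional with bound \<open>D\<close>, and \<open>rep\<close> gives
  \<open>N X \<le> D\<close>.\<close>

lemma embedding_norm:
  assumes X: "X \<in> skew_ops C \<inter> \<S>"
  shows "dual_norm (skew_ops C \<inter> \<T>) M (embedding X) = N X"
proof -
  define T1 where "T1 = {T \<in> skew_ops C \<inter> \<T>. M T \<le> 1}"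
  define D where "D = (SUP T\<in>T1. cmod (embedding X T))"
  have Xb: "X \<in> bounded_ops" and f: "represents \<T> M (N X) X (functional X)"
    using X \<S>_bounded by (auto intro: functional)
  have le: "cmod (embedding X T) \<le> N X" if "T \<in> T1" for T
  proof -
    have "cmod (embedding X T) \<le> N X * M T"
      using that represents_bound[OF f] by (simp add: embedding_def T1_def)
    also have "\<dots> \<le> N X" using that N_nonneg by (simp add: T1_def mult_left_le)
    finally show ?thesis .
  qed
  \<comment> \<open>The zero operator lies in the unit ball, so the supremum is taken over a
    nonempty set and \<open>D \<ge> 0\<close>.\<close>
  have "M 0 \<le> 0"
    using M_scale[OF cvec.subspace_0[OF \<T>_sub], of 0] by simp
  then have 0: "0 \<in> T1"
    using cvec.subspace_0[OF subspace_skew_\<T>] by (simp add: T1_def)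
  have D_ge: "cmod (embedding X T) \<le> D" if "T \<in> T1" for T
    unfolding D_def by (rule cSUP_upper[OF that bdd_aboveI2]) (rule le)
  have D0: "D \<ge> 0" using D_ge[OF 0] norm_ge_zero order_trans by blast
  \<comment> \<open>The locale does not say that \<open>M\<close> vanishes only at 0; where
    \<open>M T = 0\<close>, the bound by \<open>N X\<close> already makes the functional
    vanish.\<close>
  have bound: "cmod (functional X T) \<le> D * M T" if T: "T \<in> skew_ops C \<inter> \<T>" for T
  proof (cases "M T = 0")
    case True
    then show ?thesis using represents_bound[OF f, of T] T by simp
  next
    case False
    then have pos: "M T > 0" using M_nonneg[of T] by simp
    define T' where "T' = complex_of_real (1 / M T) *\<^sub>C T"
    have "M T' \<le> 1"
      unfolding T'_def using M_scale[of T "complex_of_real (1 / M T)"] T pos by (simp add: norm_divide)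
    then have "T' \<in> T1"
      using cvec.subspace_scale[OF subspace_skew_\<T> T] by (simp add: T1_def T'_def)
    from D_ge[OF this] have "cmod (functional X T') \<le> D"
      using \<open>T' \<in> T1\<close> by (simp add: embedding_def T1_def)
    moreover have "functional X T' = complex_of_real (1 / M T) * functional X T"
      unfolding T'_def using T by (intro represents_scale[OF f]) simp
    ultimately show ?thesis using pos by (simp add: norm_mult norm_divide field_simps)
  qed
  have "represents \<T> M D X (functional X)"
    unfolding represents_def
  proof (intro conjI ballI allI)
    fix T assume T: "T \<in> \<T>"
    have "cmod (functional X T) = cmod (functional X (skew_part T))"
      by (simp add: functional_skew_part[OF X T])
    also have "\<dots> \<le> D * M (skew_part T)" by (rule bound[OF skew_part_skew[OF T]])
    also have "\<dots> \<le> D * M T" by (intro mult_left_mono M_skew_part T D0)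
    finally show "cmod (functional X T) \<le> D * M T" .
  qed (simp_all add: represents_add[OF f] represents_scale[OF f] represents_rk[OF f])
  then have "N X \<le> D" using rep[OF Xb D0] by simp
  moreover have "D \<le> N X"
    unfolding D_def using 0 le by (intro cSUP_least) auto
  ultimately show ?thesis by (simp add: dual_norm_def D_def T1_def)
qed

theorem isometric_to_dual: "isometric_to_dual (skew_ops C \<inter> \<S>) N (skew_ops C \<inter> \<T>) M"
  unfolding isometric_to_dual_def
proof (intro exI conjI ballI allI)
  show "bij_betw embedding (skew_ops C \<inter> \<S>) (dual_space (skew_ops C \<inter> \<T>) M)"
    unfolding bij_betw_def using embedding_inj embedding_in_dual embedding_surj by blast
  show "embedding (X + Y) T = embedding X T + embedding Y T"
    if "X \<in> skew_ops C \<inter> \<S>" "Y \<in> skew_ops C \<inter> \<S>" "T \<in> skew_ops C \<inter> \<T>" for X Y T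
    using that by (simp add: embedding_def functional_add)
  show "embedding (c *\<^sub>C X) T = c * embedding X T"
    if "X \<in> skew_ops C \<inter> \<S>" "T \<in> skew_ops C \<inter> \<T>" for c X T
    using that by (simp add: embedding_def functional_scale)
qed (rule embedding_norm)

end

section \<open>The three dual pairs\<close>

lemma skew_dual_pair_schatten:
  fixes C :: "'a::chilbert_space \<Rightarrow> 'a"
  assumes C: "conjugation C" and q: "q \<ge> 1"
    and S: "\<S> \<subseteq> bounded_ops" "\<And>X. N X \<ge> 0"
    and exists_rep: "\<And>X. X \<in> \<S> \<Longrightarrow> \<exists>f. represents (schatten_class q) (schatten_norm q) (N X) X f"
    and rep: "\<And>X K f. X \<in> bounded_ops \<Longrightarrow> K \<ge> 0 \<Longrightarrow>
      represents (schatten_class q) (schatten_norm q) K X f \<Longrightarrow> X \<in> \<S> \<and> N X \<le> K"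
  shows "skew_dual_pair C \<S> N (schatten_class q) (schatten_norm q)"
proof
  show "schatten_class q \<subseteq> (bounded_ops :: ('a \<Rightarrow>\<^sub>L 'a) set)" by (auto intro: schatten_bounded)
qed (fact C subspace_schatten[OF q] schatten_norm_nonneg schatten_add(2)[OF _ _ q] schatten_scale(2)[OF _ q]
    schatten_ctrans(1)[OF _ q C] schatten_ctrans(2)[OF _ q C] schatten_rk(1)[OF q] schatten_rk(2)[OF q]
    schatten_approx_finrank[OF _ q] S exists_rep rep)+

lemma skew_dual_pair_compact:
  fixes C :: "'a::chilbert_space \<Rightarrow> 'a"
  assumes C: "conjugation C"
  shows "skew_dual_pair C (schatten_class 1) (schatten_norm 1) compact_ops norm"
proof
  show "compact_ops \<subseteq> (bounded_ops :: ('a \<Rightarrow>\<^sub>L 'a) set)" "schatten_class 1 \<subseteq> (bounded_ops :: ('a \<Rightarrow>\<^sub>L 'a) set)"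
    by (auto intro: schatten_bounded compact_ops_bounded)
  show "norm (c *\<^sub>C T) \<le> cmod c * norm T" for c and T :: "'a \<Rightarrow>\<^sub>L 'a" by (simp add: norm_scaleC_blinfun)
  show "norm (ctrans C T) \<le> norm T" if "T \<in> compact_ops" for T
    by (rule norm_ctrans_le[OF C compact_ops_bounded[OF that]])
  show "ctrans C T \<in> compact_ops" if "T \<in> compact_ops" for T by (rule compact_ctrans[OF that C])
  show "X \<in> schatten_class 1 \<and> schatten_norm 1 X \<le> K"
    if "X \<in> bounded_ops" "K \<ge> 0" "represents compact_ops norm K X f" for X :: "'a \<Rightarrow>\<^sub>L 'a" and K f
    by (rule represented_trace_class[OF that(1,3,2)])
qed (simp_all add: C subspace_compact_ops norm_triangle_ineq rk_compact norm_rk_le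
    compact_approx_finrank trace_represents_trace_class)

theorem proposition2p9:
  fixes C :: "'a::chilbert_space \<Rightarrow> 'a"
  assumes "separable_space (euclidean :: 'a topology)"
    and "infinite_dimensional TYPE('a)"
    and "conjugation C"
  shows "isometric_to_dual (skew_ops C) norm
           (skew_ops C \<inter> schatten_class 1) (schatten_norm 1) \<and>
         isometric_to_dual (skew_ops C \<inter> schatten_class 1) (schatten_norm 1)
           (skew_ops C \<inter> compact_ops) norm \<and>
         (\<forall>p q :: real. 1 < p \<and> 1 < q \<and> 1 / p + 1 / q = 1 \<longrightarrow>
           isometric_to_dual (skew_ops C \<inter> schatten_class p) (schatten_norm p)
             (skew_ops C \<inter> schatten_class q) (schatten_norm q))"
proof (intro conjI allI impI)
  note C = assms(3)
  \<comment> \<open>The pair for the exponents infinity and 1: all bounded operators against the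
    trace class.\<close>
  have "skew_dual_pair C bounded_ops norm (schatten_class 1) (schatten_norm 1)"
    using represented_bounded_op trace_represents_bounded_op
    by (intro skew_dual_pair_schatten[OF C]) auto
  then have "isometric_to_dual (skew_ops C \<inter> bounded_ops) norm
      (skew_ops C \<inter> schatten_class 1) (schatten_norm 1)"
    by (rule skew_dual_pair.isometric_to_dual)
  moreover have "skew_ops C \<inter> bounded_ops = skew_ops C" by (auto simp: skew_ops_def)
  ultimately show "isometric_to_dual (skew_ops C) norm (skew_ops C \<inter> schatten_class 1) (schatten_norm 1)"
    by simp
  show "isometric_to_dual (skew_ops C \<inter> schatten_class 1) (schatten_norm 1) (skew_ops C \<inter> compact_ops) norm"
    by (rule skew_dual_pair.isometric_to_dual[OF skew_dual_pair_compact[OF C]])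
  fix p q :: real assume "1 < p \<and> 1 < q \<and> 1 / p + 1 / q = 1"
  then have pq: "p > 1" "q > 1" "1 / p + 1 / q = 1" by auto
  have "skew_dual_pair C (schatten_class p) (schatten_norm p) (schatten_class q) (schatten_norm q)"
  proof (rule skew_dual_pair_schatten[OF C])
    show "X \<in> schatten_class p \<and> schatten_norm p X \<le> K"
      if "X \<in> bounded_ops" "K \<ge> 0" "represents (schatten_class q) (schatten_norm q) K X f"
      for X :: "'a \<Rightarrow>\<^sub>L 'a" and K f
      by (rule represented_schatten[OF pq that(1,3,2)])
    show "\<exists>f. represents (schatten_class q) (schatten_norm q) (schatten_norm p X) X f"
      if "X \<in> schatten_class p" for X :: "'a \<Rightarrow>\<^sub>L 'a"
      by (rule trace_represents_schatten[OF pq that])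
  qed (use pq in \<open>auto intro: schatten_bounded\<close>)
  then show "isometric_to_dual (skew_ops C \<inter> schatten_class p) (schatten_norm p)
      (skew_ops C \<inter> schatten_class q) (schatten_norm q)"
    by (rule skew_dual_pair.isometric_to_dual)
qed

end
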